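(* Let $G$ be a nonbipartite graph of order $n\ge 5$ and size at least $\left\lfloor (n-1)^2/4\right\rfloor+2$ that is not isomorphic to $BT(n)$. Then $G$ contains three (i.e. at least three distinct) weakly pancyclic vertices.
   Context: All graphs are finite and simple. The order of a graph is its number of vertices and its size is its number of edges. The girth $g(G)$ is the length of a shortest cycle of $G$, and the circumference $c(G)$ is the length of a longest cycle of $G$. A vertex $v$ of $G$ is called weakly pancyclic if for every integer $\ell$ with $g(G)\le \ell\le c(G)$, $v$ lies on a cycle of length $\ell$ in $G$. For an integer $n\ge 5$, $BT(n)$ denotes the graph of order $n$ obtained by identifying an edge of the complete bipartite graph $K_{\lfloor (n-1)/2\rfloor,\lceil (n-1)/2\rceil}$ with an edge of the triangle $C_3$ (equivalently, add to $K_{\lfloor (n-1)/2\rfloor,\lceil (n-1)/2\rceil}$ one new vertex adjacent to exactly the two endpoints of one edge). *)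

theory Defs
  imports Main
begin

text \<open>A graph is a pair of a vertex set and a set of edges; an undirected edge is the
  two-element set of its endpoints, so a simple graph of size \<open>m\<close> has exactly \<open>m\<close> edges.\<close>

type_synonym 'a graph = "'a set \<times> 'a set set"

abbreviation verts :: "'a graph \<Rightarrow> 'a set" where
  "verts G \<equiv> fst G"

abbreviation edges :: "'a graph \<Rightarrow> 'a set set" where
  "edges G \<equiv> snd G"

definition simple_graph :: "'a graph \<Rightarrow> bool" where
  "simple_graph G \<longleftrightarrow> finite (verts G) \<and> (\<forall>e\<in>edges G. e \<subseteq> verts G \<and> card e = 2)"

definition graph_order :: "'a graph \<Rightarrow> nat" where
  "graph_order G = card (verts G)"

definition graph_size :: "'a graph \<Rightarrow> nat" where
  "graph_size G = card (edges G)"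

definition bipartite :: "'a graph \<Rightarrow> bool" where
  "bipartite G \<longleftrightarrow>
     (\<exists>A B. A \<union> B = verts G \<and> A \<inter> B = {} \<and> (\<forall>e\<in>edges G. \<exists>a\<in>A. \<exists>b\<in>B. e = {a, b}))"

definition graph_iso :: "'a graph \<Rightarrow> 'b graph \<Rightarrow> bool" where
  "graph_iso G H \<longleftrightarrow>
     (\<exists>f. bij_betw f (verts G) (verts H) \<and>
          (\<forall>u\<in>verts G. \<forall>v\<in>verts G. {u, v} \<in> edges G \<longleftrightarrow> {f u, f v} \<in> edges H))"

text \<open>A cycle is given by the list of its distinct vertices in cyclic order, without repeating
  the first vertex at the end; the length of the cycle is therefore the length of the list.\<close>

definition is_cycle :: "'a graph \<Rightarrow> 'a list \<Rightarrow> bool" where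
  "is_cycle G xs \<longleftrightarrow>
     3 \<le> length xs \<and> distinct xs \<and> set xs \<subseteq> verts G \<and>
     (\<forall>i<length xs. {xs ! i, xs ! (Suc i mod length xs)} \<in> edges G)"

text \<open>Girth and circumference are meaningful only for finite graphs that contain a cycle
  (in particular for finite nonbipartite graphs); otherwise \<open>Min\<close> and \<open>Max\<close> return no useful value.\<close>

definition girth :: "'a graph \<Rightarrow> nat" where
  "girth G = Min {length xs |xs. is_cycle G xs}"

definition circumference :: "'a graph \<Rightarrow> nat" where
  "circumference G = Max {length xs |xs. is_cycle G xs}"

definition weakly_pancyclic_vertex :: "'a graph \<Rightarrow> 'a \<Rightarrow> bool" where
  "weakly_pancyclic_vertex G v \<longleftrightarrow>
     v \<in> verts G \<and>
     (\<forall>l. girth G \<le> l \<and> l \<le> circumference G \<longrightarrow>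
          (\<exists>xs. is_cycle G xs \<and> length xs = l \<and> v \<in> set xs))"

definition complete_bipartite :: "nat \<Rightarrow> nat \<Rightarrow> nat graph" where
  "complete_bipartite p q = ({..<p + q}, {{i, j} |i j. i < p \<and> p \<le> j \<and> j < p + q})"

text \<open>The complete bipartite graph below has the vertices \<open>0, \<dots>, n - 2\<close>; its parts have
  \<open>\<lfloor>(n - 1) / 2\<rfloor>\<close> and \<open>\<lceil>(n - 1) / 2\<rceil> = n div 2\<close> elements. The new vertex is \<open>n - 1\<close>, and it is
  joined to the endpoints of the edge between \<open>0\<close> and \<open>(n - 1) div 2\<close>, the least elements
  of the two parts. Complete bipartite graphs are
  edge-transitive, so the choice of this edge is immaterial. Intended for \<open>n \<ge> 5\<close>.\<close>

definition BT :: "nat \<Rightarrow> nat graph" where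
  "BT n = (let K = complete_bipartite ((n - 1) div 2) (n div 2) in
     (insert (n - 1) (verts K),
      edges K \<union> {{n - 1, 0}, {n - 1, (n - 1) div 2}}))"

end

theory Submission
  imports Defs
begin

text \<open>
  Induction on the order \<open>n\<close>, for the statement that some three vertices lie on cycles of all
  lengths from 3 to the circumference. If a vertex \<open>u\<close> has degree at most \<open>(n - 1) / 2\<close>, then
  \<open>G - u\<close> satisfies the size bound for \<open>n - 1\<close>, and either induction applies to it, or it is
  bipartite or isomorphic to \<open>BT (n - 1)\<close>; in the last two cases \<open>G - u\<close> misses so few edges that the
  required cycles can be written down. If \<open>G\<close> is not Hamiltonian, the end of a longest path off a
  longest cycle is such a vertex \<open>u\<close>, and the longest cycle survives in \<open>G - u\<close>.

  If \<open>G\<close> is Hamiltonian, it also has a cycle of length \<open>n - 1\<close>: otherwise an averaging argument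
  gives a chord of span three skipping two vertices \<open>r\<close>, \<open>s\<close> of large degree sum, and the
  neighbourhoods of \<open>r\<close> and \<open>s\<close> on the shortened cycle are so rigid that they contradict the induction
  hypothesis (for the existence of that cycle) for \<open>G - {r, s}\<close>. If some vertex omitted by a cycle of
  length \<open>n - 1\<close> has low degree, it serves as \<open>u\<close>. Otherwise every omitted vertex is on cycles of all
  lengths by the pigeonhole principle, and rerouting a cycle through an omitted vertex omits others,
  which yields three vertices.
\<close>

section \<open>Graphs and periodic cycles\<close>

text \<open>The floor of (n - 1)^2 / 4 drops by exactly the floor of (n - 1) / 2 from order n to
  order n - 1, so deleting a vertex of low degree preserves the size bound with its constant 2, but
  with no slack. BT(n) attains the bound with equality and therefore has to be carried through the
  induction as an exception. It does harm only from order 5 on, since at order 4 its triangle still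
  supplies three vertices; hence the guards \<open>5 \<le> n\<close> and the triangle as base case.

  In the Hamiltonian case a deletion loses length n, which every vertex recovers from the
  Hamiltonian cycle. Length n - 1 must not be lost as well, and this is why a cycle of that length
  is sought.

  Deleting \<open>r\<close> and \<open>s\<close> of degree sum n - \<delta> removes n - \<delta> - 1
  edges while the bound drops by n - 2. For \<delta> \<ge> 1 the bound is kept; \<delta> = 0 forces
  a bipartition. The contradiction for \<delta> \<ge> 1 is a count of the edges of a cycle of length
  n - 3 in the rest, which succeeds as soon as n is large compared with \<delta>; the averaging
  delivers just such pairs.\<close>

definition adj :: "'a graph \<Rightarrow> 'a \<Rightarrow> 'a \<Rightarrow> bool" where
  "adj G u v \<longleftrightarrow> {u, v} \<in> edges G"

definition nbh :: "'a graph \<Rightarrow> 'a \<Rightarrow> 'a set" where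
  "nbh G v = {u. adj G v u}"

definition del :: "'a graph \<Rightarrow> 'a set \<Rightarrow> 'a graph" where
  "del G X = (verts G - X, {e \<in> edges G. e \<inter> X = {}})"

text \<open>A cycle of length \<open>m\<close> is handled as an \<open>m\<close>-periodic sequence of vertices indexed by the
  integers, so that no index arithmetic modulo \<open>m\<close> appears in the cycle constructions.\<close>

definition cyc :: "'a graph \<Rightarrow> int \<Rightarrow> (int \<Rightarrow> 'a) \<Rightarrow> bool" where
  "cyc G m c \<longleftrightarrow> 3 \<le> m \<and> (\<forall>i j. c i = c j \<longleftrightarrow> i mod m = j mod m) \<and> (\<forall>i. adj G (c i) (c (i + 1)))"

text \<open>Lists enter as stretches of a periodic cycle. Both ends are integers and may be negative
  or exceed the period, so a stretch across the starting point needs no case split.\<close>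

definition seg :: "(int \<Rightarrow> 'a) \<Rightarrow> int \<Rightarrow> int \<Rightarrow> 'a list" where
  "seg c i j = map c [i..j]"

lemma adj_sym: "adj G u v \<longleftrightarrow> adj G v u"
  by (simp add: adj_def insert_commute)

lemma adj_in:
  assumes "simple_graph G" "adj G u v"
  shows "u \<in> verts G" "v \<in> verts G" "u \<noteq> v"
proof -
  have e: "{u, v} \<subseteq> verts G" "card {u, v} = 2"
    using assms unfolding simple_graph_def adj_def by auto
  then show "u \<in> verts G" "v \<in> verts G" by auto
  show "u \<noteq> v" using e(2) by auto
qed

lemma simple_finite: "simple_graph G \<Longrightarrow> finite (verts G)"
  by (simp add: simple_graph_def)

lemma finite_edges: "simple_graph G \<Longrightarrow> finite (edges G)"
  unfolding simple_graph_def by (meson Pow_iff finite_Pow_iff finite_subset subsetI)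

lemma edge_obtain:
  assumes "simple_graph G" "e \<in> edges G"
  obtains u v where "e = {u, v}" "adj G u v" "u \<noteq> v" "u \<in> verts G" "v \<in> verts G"
  using assms unfolding simple_graph_def adj_def by (metis card_2_iff insert_subset)

lemma nbh_subset: "simple_graph G \<Longrightarrow> nbh G v \<subseteq> verts G - {v}"
  unfolding nbh_def by (auto dest: adj_in)

lemma finite_nbh: "simple_graph G \<Longrightarrow> finite (nbh G v)"
  using nbh_subset simple_finite by (meson finite_Diff finite_subset)

lemma del_simple: "simple_graph G \<Longrightarrow> simple_graph (del G X)"
  unfolding simple_graph_def del_def by auto

lemma verts_del [simp]: "verts (del G X) = verts G - X"
  by (simp add: del_def)

lemma adj_del [simp]: "adj (del G X) u v \<longleftrightarrow> adj G u v \<and> u \<notin> X \<and> v \<notin> X"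
  unfolding adj_def del_def by auto

lemma del_del: "del (del G X) Y = del G (X \<union> Y)"
  unfolding del_def by auto

lemma card_star:
  assumes "simple_graph G"
  shows "card {e \<in> edges G. v \<in> e} = card (nbh G v)"
proof -
  have "{e \<in> edges G. v \<in> e} = (\<lambda>u. {v, u}) ` nbh G v"
  proof
    show "{e \<in> edges G. v \<in> e} \<subseteq> (\<lambda>u. {v, u}) ` nbh G v"
    proof
      fix e assume "e \<in> {e \<in> edges G. v \<in> e}"
      then have e: "e \<in> edges G" "v \<in> e" by auto
      obtain x y where xy: "e = {x, y}" "adj G x y" by (rule edge_obtain[OF assms e(1)])
      then have "e = {v, x} \<and> adj G v x \<or> e = {v, y} \<and> adj G v y"
        using e(2) adj_sym[of G x y] by auto
      then show "e \<in> (\<lambda>u. {v, u}) ` nbh G v" by (auto simp: nbh_def)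
    qed
    show "(\<lambda>u. {v, u}) ` nbh G v \<subseteq> {e \<in> edges G. v \<in> e}"
      unfolding nbh_def adj_def by auto
  qed
  moreover have "inj_on (\<lambda>u. {v, u}) (nbh G v)"
    by (auto simp: inj_on_def doubleton_eq_iff)
  ultimately show ?thesis by (simp add: card_image)
qed

lemma edges_del_vertex:
  assumes "simple_graph G"
  shows "card (edges G) = card (edges (del G {v})) + card (nbh G v)"
proof -
  let ?S = "{e \<in> edges G. v \<in> e}"
  have 0: "edges G = edges (del G {v}) \<union> ?S" "edges (del G {v}) \<inter> ?S = {}"
    unfolding del_def by auto
  have "card (edges (del G {v}) \<union> ?S) = card (edges (del G {v})) + card ?S"
    by (rule card_Un_disjoint) (use 0 finite_edges[OF assms] finite_edges[OF del_simple[OF assms]] in auto)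
  then show ?thesis using 0(1) card_star[OF assms] by simp
qed

lemma handshake:
  assumes "simple_graph G"
  shows "(\<Sum>v\<in>verts G. card (nbh G v)) = 2 * card (edges G)"
proof -
  have fe: "finite (edges G)" and fv: "finite (verts G)"
    by (rule finite_edges[OF assms], rule simple_finite[OF assms])
  have "(\<Sum>v\<in>verts G. card (nbh G v)) = (\<Sum>v\<in>verts G. \<Sum>e\<in>edges G. if v \<in> e then 1 else 0)"
    by (rule sum.cong[OF refl]) (simp add: card_star[OF assms, symmetric] fe sum.If_cases Int_def)
  also have "\<dots> = (\<Sum>e\<in>edges G. \<Sum>v\<in>verts G. if v \<in> e then 1 else 0)"
    by (rule sum.swap)
  also have "\<dots> = (\<Sum>e\<in>edges G. 2)"
  proof (rule sum.cong[OF refl])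
    fix e assume "e \<in> edges G"
    then have "e \<subseteq> verts G" "card e = 2" using assms unfolding simple_graph_def by auto
    then show "(\<Sum>v\<in>verts G. if v \<in> e then 1 else 0) = (2::nat)"
      using fv by (simp add: sum.If_cases Int_absorb1 Collect_mem_eq)
  qed
  finally show ?thesis by simp
qed

section \<open>Windows, symmetries and segments of a periodic cycle\<close>

lemma cyc_rangeI: "simple_graph G \<Longrightarrow> cyc G m c \<Longrightarrow> c i \<in> verts G"
  unfolding cyc_def using adj_in by metis

lemma cyc_adj: "cyc G m c \<Longrightarrow> adj G (c i) (c (i + 1))"
  unfolding cyc_def by auto

lemma cyc_adj': "cyc G m c \<Longrightarrow> j = i + 1 \<Longrightarrow> adj G (c i) (c j)"
  unfolding cyc_def by auto

lemma cyc_period: "cyc G m c \<Longrightarrow> c (i + m) = c i"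
  unfolding cyc_def by (metis mod_add_self2)

lemma cyc_period': "cyc G m c \<Longrightarrow> c (i - m) = c i"
  unfolding cyc_def by (metis minus_mod_self2)

lemma cyc_eq: "cyc G m c \<Longrightarrow> c i = c j \<longleftrightarrow> i mod m = j mod m"
  unfolding cyc_def by auto

lemma cyc_neq:
  assumes "cyc G m c" "i < j" "j < i + m"
  shows "c i \<noteq> c j"
proof -
  have "3 \<le> m" using assms(1) unfolding cyc_def by linarith
  have "\<not> m dvd (j - i)" using zdvd_not_zless[of "j - i" m] assms by auto
  then have "j mod m \<noteq> i mod m" by (simp add: mod_eq_dvd_iff)
  then show ?thesis using cyc_eq[OF assms(1), of i j] by simp
qed

lemma cyc_mirror: "cyc G m c \<Longrightarrow> cyc G m (\<lambda>i. c (- i))"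
proof -
  assume a: "cyc G m c"
  have "(- i) mod m = (- j) mod m \<longleftrightarrow> i mod m = j mod m" for i j :: int
  proof -
    have "- i - - j = j - i" by simp
    then show ?thesis unfolding mod_eq_dvd_iff by (simp add: dvd_diff_commute)
  qed
  moreover have "adj G (c (- i)) (c (- (i + 1)))" for i
  proof -
    have "adj G (c (- (i + 1))) (c (- i))" by (rule cyc_adj'[OF a]) simp
    then show ?thesis by (rule adj_sym[THEN iffD1])
  qed
  ultimately show ?thesis using a unfolding cyc_def by auto
qed

lemma cyc_shift: "cyc G m c \<Longrightarrow> cyc G m (\<lambda>i. c (i + t))"
proof -
  assume a: "cyc G m c"
  have "(i + t) mod m = (j + t) mod m \<longleftrightarrow> i mod m = j mod m" for i j :: int
    by (simp add: mod_eq_dvd_iff)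
  moreover have "adj G (c (i + t)) (c (i + 1 + t))" for i
    using cyc_adj[OF a, of "i + t"] by (simp add: algebra_simps)
  ultimately show ?thesis using a unfolding cyc_def by auto
qed

lemma range_shift: "range (\<lambda>i::int. c (i + t)) = range c"
proof -
  have "c i \<in> range (\<lambda>i. c (i + t))" for i
    by (rule range_eqI[of _ _ "i - t"]) simp
  then show ?thesis by auto
qed

lemma range_mirror: "range (\<lambda>i::int. c (- i)) = range c"
proof -
  have "c i \<in> range (\<lambda>i. c (- i))" for i
    by (rule range_eqI[of _ _ "- i"]) simp
  then show ?thesis by auto
qed

lemma cyc_range_window:
  assumes "cyc G m c"
  shows "range c = c ` {a..<a + m}"
proof -
  have m: "0 < m" using assms unfolding cyc_def by linarith
  have "c i \<in> c ` {a..<a + m}" for i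
  proof -
    have "(a + (i - a) mod m) mod m = i mod m"
      by (simp add: mod_add_right_eq)
    then have "c i = c (a + (i - a) mod m)"
      using cyc_eq[OF assms, of i "a + (i - a) mod m"] by simp
    moreover have "a + (i - a) mod m \<in> {a..<a + m}" using m by simp
    ultimately show ?thesis by (rule image_eqI)
  qed
  then show ?thesis by blast
qed

lemma cyc_inj_window:
  assumes "cyc G m c"
  shows "inj_on c {a..<a + m}"
proof (rule inj_onI)
  fix x y assume "x \<in> {a..<a + m}" "y \<in> {a..<a + m}" "c x = c y"
  then show "x = y" using cyc_neq[OF assms, of x y] cyc_neq[OF assms, of y x] by force
qed

lemma cyc_card_range:
  assumes "cyc G m c"
  shows "card (range c) = nat m"
  using cyc_range_window[OF assms, of 0] card_image[OF cyc_inj_window[OF assms, of 0]] by simp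

lemma cyc_finite_range: "cyc G m c \<Longrightarrow> finite (range c)"
  by (subst cyc_range_window[where a=0]) auto

lemma cyc_window_obtain:
  assumes "cyc G m c"
  obtains j where "a \<le> j" "j < a + m" "c j = c i"
proof -
  have "c i \<in> c ` {a..<a + m}" using cyc_range_window[OF assms] by blast
  then show thesis using that by auto
qed

lemma cyc_del: "cyc (del G X) m c \<longleftrightarrow> cyc G m c \<and> range c \<inter> X = {}"
proof -
  have "range c \<inter> X = {} \<longleftrightarrow> (\<forall>i. c i \<notin> X)" by blast
  then show ?thesis unfolding cyc_def adj_del by blast
qed

text \<open>Rerouted cycles are certified in this form: a list glued from segments is checked by
  \<open>successively\<close> at its joints, which spares the constructions the index
  \<open>Suc i mod length xs\<close> of \<open>is_cycle\<close>.\<close>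

lemma is_cycle_successively:
  assumes "simple_graph G" "3 \<le> length xs" "distinct xs" "successively (adj G) xs"
    "adj G (last xs) (hd xs)"
  shows "is_cycle G xs"
proof -
  have step: "adj G (xs ! i) (xs ! (Suc i mod length xs))" if "i < length xs" for i
  proof (cases "Suc i = length xs")
    case True
    moreover have "xs \<noteq> []" using assms(2) by auto
    ultimately have "xs ! i = last xs" "xs ! (Suc i mod length xs) = hd xs"
      by (metis last_conv_nth diff_Suc_1, metis hd_conv_nth mod_self)
    then show ?thesis using assms(5) by simp
  next
    case False
    with that have "Suc i < length xs" by simp
    then show ?thesis using assms(4) successively_nth by fastforce
  qed
  moreover have "set xs \<subseteq> verts G"
  proof
    fix x assume "x \<in> set xs"
    then obtain i where "i < length xs" "x = xs ! i" by (metis in_set_conv_nth)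
    then show "x \<in> verts G" using adj_in(1)[OF assms(1) step] by simp
  qed
  ultimately show ?thesis using assms unfolding is_cycle_def adj_def by auto
qed

lemma is_cycle_imp_cyc:
  assumes "is_cycle G xs"
  obtains c where "cyc G (int (length xs)) c" "range c = set xs"
proof -
  let ?n = "length xs"
  define c where "c i = xs ! nat (i mod int ?n)" for i
  have n: "3 \<le> ?n" "distinct xs" using assms unfolding is_cycle_def by auto
  have lt: "nat (i mod int ?n) < ?n" for i
  proof -
    have "0 < int ?n" using n(1) by linarith
    then have "0 \<le> i mod int ?n" "i mod int ?n < int ?n" by simp_all
    then show ?thesis by linarith
  qed
  have 1: "c i = c j \<longleftrightarrow> i mod int ?n = j mod int ?n" for i j
  proof -
    have p: "0 < int ?n" using n(1) by linarith
    have "c i = c j \<longleftrightarrow> nat (i mod int ?n) = nat (j mod int ?n)"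
      unfolding c_def by (rule nth_eq_iff_index_eq[OF n(2) lt lt])
    also have "\<dots> \<longleftrightarrow> i mod int ?n = j mod int ?n"
      by (rule eq_nat_nat_iff) (use p in simp_all)
    finally show ?thesis .
  qed
  have 2: "adj G (c i) (c (i + 1))" for i
  proof -
    let ?k = "nat (i mod int ?n)"
    have "(i + 1) mod int ?n = (i mod int ?n + 1) mod int ?n" by (simp add: mod_add_left_eq)
    also have "i mod int ?n = int ?k"
    proof -
      have "0 < int ?n" using n(1) by linarith
      then have "0 \<le> i mod int ?n" by simp
      then show ?thesis by simp
    qed
    also have "(int ?k + 1) mod int ?n = int (Suc ?k mod ?n)"
      by (simp add: zmod_int add.commute)
    finally have "c (i + 1) = xs ! (Suc ?k mod ?n)" unfolding c_def by simp
    then show ?thesis using assms lt unfolding is_cycle_def adj_def c_def by auto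
  qed
  have "range c = set xs"
  proof
    show "range c \<subseteq> set xs" unfolding c_def using lt by auto
    show "set xs \<subseteq> range c"
    proof
      fix x assume "x \<in> set xs"
      then obtain i where "i < ?n" "x = xs ! i" by (metis in_set_conv_nth)
      then have "c (int i) = x" unfolding c_def by simp
      then show "x \<in> range c" by blast
    qed
  qed
  moreover have "cyc G (int ?n) c" unfolding cyc_def using 1 2 n by auto
  ultimately show thesis using that by blast
qed

lemma set_seg [simp]: "set (seg c i j) = c ` {i..j}"
  by (simp add: seg_def)

lemma length_seg [simp]: "length (seg c i j) = nat (j - i + 1)"
  by (simp add: seg_def)

lemma hd_seg: "i \<le> j \<Longrightarrow> hd (seg c i j) = c i"
  unfolding seg_def by (simp add: hd_map upto_rec1)

lemma last_seg: "i \<le> j \<Longrightarrow> last (seg c i j) = c j"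
  unfolding seg_def by (simp add: last_map upto_rec2)

lemma seg_nonempty: "i \<le> j \<Longrightarrow> seg c i j \<noteq> []"
  unfolding seg_def by simp

lemma successively_seg:
  assumes "cyc G m c"
  shows "successively (adj G) (seg c i j)"
proof (induction "nat (j - i + 1)" arbitrary: i)
  case 0
  then show ?case by (simp add: seg_def)
next
  case (Suc k)
  show ?case
  proof (cases "i < j")
    case True
    have "seg c i j = c i # seg c (i + 1) j" unfolding seg_def using True by (simp add: upto_rec1)
    moreover have "successively (adj G) (seg c (i + 1) j)" using Suc by simp
    moreover have "hd (seg c (i + 1) j) = c (i + 1)" using True hd_seg by (simp add: hd_seg)
    ultimately show ?thesis using cyc_adj[OF assms, of i] by (simp add: successively_Cons)
  next
    case False
    then have "i = j" using Suc by simp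
    then show ?thesis by (simp add: seg_def)
  qed
qed

lemma distinct_seg:
  assumes "cyc G m c" "j < i + m"
  shows "distinct (seg c i j)"
proof -
  have "inj_on c (set [i..j])"
    by (rule inj_on_subset[OF cyc_inj_window[OF assms(1), of i]]) (use assms(2) in auto)
  then show ?thesis unfolding seg_def distinct_map by simp
qed

lemma seg_disjoint:
  assumes "cyc G m c" "j < k" "l < i + m"
  shows "c ` {i..j} \<inter> c ` {k..l} = {}"
proof -
  have *: "c x \<noteq> c y" if "x \<in> {i..j}" "y \<in> {k..l}" for x y
    by (rule cyc_neq[OF assms(1)]) (use that assms(2,3) in auto)
  show ?thesis
  proof (rule equals0I)
    fix z assume "z \<in> c ` {i..j} \<inter> c ` {k..l}"
    then obtain x y where "x \<in> {i..j}" "y \<in> {k..l}" "z = c x" "z = c y"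
      by (elim IntE imageE) simp
    then show False using *[of x y] by simp
  qed
qed

lemma successively_adj_rev: "successively (adj G) (rev xs) \<longleftrightarrow> successively (adj G) xs"
proof -
  have "(\<lambda>x y. adj G y x) = adj G" by (intro ext) (rule adj_sym)
  then show ?thesis by (simp only: successively_rev)
qed

definition on_cycle :: "'a graph \<Rightarrow> 'a \<Rightarrow> nat \<Rightarrow> bool" where
  "on_cycle G v l \<longleftrightarrow> (\<exists>xs. is_cycle G xs \<and> length xs = l \<and> v \<in> set xs)"

lemma is_cycle_del: "is_cycle (del G X) xs \<Longrightarrow> is_cycle G xs"
  unfolding is_cycle_def del_def by auto

lemma is_cycle_del_iff: "is_cycle (del G X) xs \<longleftrightarrow> is_cycle G xs \<and> set xs \<inter> X = {}"
proof
  assume "is_cycle (del G X) xs"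
  then show "is_cycle G xs \<and> set xs \<inter> X = {}" unfolding is_cycle_def del_def by auto
next
  assume a: "is_cycle G xs \<and> set xs \<inter> X = {}"
  have "{xs ! i, xs ! (Suc i mod length xs)} \<inter> X = {}" if "i < length xs" for i
  proof -
    have "Suc i mod length xs < length xs" by (rule mod_less_divisor) (use that in linarith)
    then have "xs ! i \<in> set xs" "xs ! (Suc i mod length xs) \<in> set xs" using that by auto
    then show ?thesis using a by auto
  qed
  then show "is_cycle (del G X) xs" using a unfolding is_cycle_def del_def by auto
qed

lemma cycle_length_le:
  assumes "simple_graph G" "is_cycle G xs"
  shows "length xs \<le> card (verts G)"
proof -
  have "distinct xs" "set xs \<subseteq> verts G" using assms(2) unfolding is_cycle_def by blast+
  then show ?thesis
    using card_mono[OF simple_finite[OF assms(1)], of "set xs"] distinct_card[of xs] by simp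
qed

lemma on_cycle_del: "on_cycle (del G X) v l \<Longrightarrow> on_cycle G v l"
  unfolding on_cycle_def using is_cycle_del by blast

section \<open>Rerouting cycles\<close>

text \<open>A chord of span two bypasses \<open>c (i + 1)\<close>: the segment from
  \<open>i + 2\<close> to \<open>i + m\<close> has \<open>m - 1\<close> vertices and ends in
  \<open>c i\<close>, where the chord closes it.\<close>

lemma cyc_skip:
  assumes "simple_graph G" "cyc G m c" "4 \<le> m" "adj G (c i) (c (i + 2))"
  shows "is_cycle G (seg c (i + 2) (i + m))"
proof (rule is_cycle_successively[OF assms(1)])
  show "successively (adj G) (seg c (i + 2) (i + m))" by (rule successively_seg[OF assms(2)])
  show "distinct (seg c (i + 2) (i + m))" by (rule distinct_seg[OF assms(2)]) simp
  show "adj G (last (seg c (i + 2) (i + m))) (hd (seg c (i + 2) (i + m)))"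
    using assms(3,4) cyc_period[OF assms(2), of i] by (simp add: hd_seg last_seg)
qed (use assms(3) in simp)

text \<open>The cycle runs from \<open>c (i + k)\<close> forwards to \<open>c (i - 1)\<close>, jumps
  to \<open>c (i + k - 2)\<close>, runs backwards to \<open>c i\<close> and jumps home. Only
  \<open>c (i + k - 1)\<close> is left out.\<close>

lemma cyc_cross:
  assumes "simple_graph G" "cyc G m c" "3 \<le> k" "k \<le> m - 1"
    and "adj G (c i) (c (i + k))" "adj G (c (i - 1)) (c (i + k - 2))"
  shows "\<exists>xs. is_cycle G xs \<and> int (length xs) = m - 1"
proof -
  let ?P = "seg c (i + k) (i - 1 + m)" and ?R = "seg c i (i + k - 2)"
  have ne: "?P \<noteq> []" "?R \<noteq> []" using assms(3,4) by (simp_all add: seg_def)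
  have per: "c (i - 1 + m) = c (i - 1)" by (rule cyc_period[OF assms(2)])
  have hl: "hd ?P = c (i + k)" "last ?P = c (i - 1)" "hd ?R = c i" "last ?R = c (i + k - 2)"
    using assms(3,4) per by (simp_all add: hd_seg last_seg)
  have disj: "set ?P \<inter> set ?R = {}"
    using seg_disjoint[OF assms(2), of "i + k - 2" "i + k" "i - 1 + m" i] by (simp add: Int_commute)
  have "is_cycle G (?P @ rev ?R)"
  proof (rule is_cycle_successively[OF assms(1)])
    show "distinct (?P @ rev ?R)"
      using disj distinct_seg[OF assms(2), of "i - 1 + m" "i + k"]
        distinct_seg[OF assms(2), of "i + k - 2" i] assms(3,4) by simp
    show "successively (adj G) (?P @ rev ?R)"
      unfolding successively_append_iff successively_adj_rev
      using successively_seg[OF assms(2)] hl ne assms(6) by (simp add: hd_rev)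
    show "adj G (last (?P @ rev ?R)) (hd (?P @ rev ?R))"
      using ne hl assms(5) by (simp add: last_rev)
    show "3 \<le> length (?P @ rev ?R)" using assms(3,4) by simp
  qed
  moreover have "int (length (?P @ rev ?R)) = m - 1" using assms(3,4) by simp
  ultimately show ?thesis by blast
qed

lemma cyc_insert:
  assumes "simple_graph G" "cyc G m c" "v \<notin> range c" "1 \<le> t" "t \<le> m - 1"
    and "adj G v (c i)" "adj G v (c (i + t))"
  shows "is_cycle G (v # seg c i (i + t))"
proof (rule is_cycle_successively[OF assms(1)])
  have ne: "seg c i (i + t) \<noteq> []" using assms(4) by (simp_all add: seg_def)
  show "successively (adj G) (v # seg c i (i + t))"
    using successively_seg[OF assms(2)] assms(4,6) by (simp add: successively_Cons hd_seg)
  show "distinct (v # seg c i (i + t))"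
    using distinct_seg[OF assms(2), of "i + t" i] assms(3,5) by auto
  show "adj G (last (v # seg c i (i + t))) (hd (v # seg c i (i + t)))"
    using ne assms(4,7) by (simp add: last_seg adj_sym[of G v])
qed (use assms(4) in simp)

text \<open>Dropping the edges that leave \<open>c i\<close> and \<open>c j\<close> forwards cuts
  the cycle into two paths. One is reversed, and they are rejoined through the given edge at one
  pair of ends and through \<open>v\<close> at the other.\<close>

lemma cyc_insert_cross:
  assumes "simple_graph G" "cyc G m c" "v \<notin> range c" "i < j" "j < i + m"
    and "adj G v (c i)" "adj G v (c j)" "adj G (c (i + 1)) (c (j + 1))"
  shows "\<exists>xs. is_cycle G xs \<and> int (length xs) = m + 1"
proof -
  let ?P = "seg c (i + 1) j" and ?R = "seg c (j + 1) (i + m)"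
  have ne: "?P \<noteq> []" "?R \<noteq> []" using assms(4,5) by (simp_all add: seg_def)
  have hl: "hd ?P = c (i + 1)" "last ?P = c j" "hd ?R = c (j + 1)" "last ?R = c i"
    using assms(4,5) cyc_period[OF assms(2), of i] by (simp_all add: hd_seg last_seg)
  have disj: "set ?P \<inter> set ?R = {}"
    using seg_disjoint[OF assms(2), of j "j + 1" "i + m" "i + 1"] by simp
  have "is_cycle G (v # rev ?P @ ?R)"
  proof (rule is_cycle_successively[OF assms(1)])
    have "v \<notin> set ?P" "v \<notin> set ?R" using assms(3) by auto
    then show "distinct (v # rev ?P @ ?R)"
      using disj distinct_seg[OF assms(2), of j "i + 1"]
        distinct_seg[OF assms(2), of "i + m" "j + 1"] assms(4,5) by simp
    have "successively (adj G) (rev ?P @ ?R)"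
      unfolding successively_append_iff successively_adj_rev
      using successively_seg[OF assms(2)] hl ne assms(8) by (simp add: last_rev)
    then show "successively (adj G) (v # rev ?P @ ?R)"
      using ne hl assms(7) by (simp add: successively_Cons hd_append hd_rev)
    show "adj G (last (v # rev ?P @ ?R)) (hd (v # rev ?P @ ?R))"
      using ne hl assms(6) by (simp add: adj_sym[of G v])
    show "3 \<le> length (v # rev ?P @ ?R)" using assms(4,5) by simp
  qed
  moreover have "int (length (v # rev ?P @ ?R)) = m + 1" using assms(4,5) by simp
  ultimately show ?thesis by blast
qed

lemma cyc_insert2:
  assumes "simple_graph G" "cyc G m c" "a \<le> b" "b < a + m"
    and "r \<notin> range c" "s \<notin> range c" "adj G r s" "adj G s (c a)" "adj G r (c b)"
  shows "\<exists>xs. is_cycle G xs \<and> int (length xs) = b - a + 3"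
proof -
  let ?P = "seg c a b"
  have ne: "?P \<noteq> []" using assms(3) by (simp_all add: seg_def)
  have "is_cycle G (s # ?P @ [r])"
  proof (rule is_cycle_successively[OF assms(1)])
    have "s \<noteq> r" using adj_in(3)[OF assms(1,7)] by simp
    moreover have "r \<notin> set ?P" "s \<notin> set ?P" using assms(5,6) by auto
    ultimately show "distinct (s # ?P @ [r])" using distinct_seg[OF assms(2,4)] by simp
    show "successively (adj G) (s # ?P @ [r])"
      using successively_seg[OF assms(2)] ne assms(3,8,9)
      by (simp add: successively_Cons successively_append_iff hd_seg last_seg adj_sym[of G r])
    show "adj G (last (s # ?P @ [r])) (hd (s # ?P @ [r]))" using assms(7) by simp
    show "3 \<le> length (s # ?P @ [r])" using assms(3) by simp
  qed
  moreover have "int (length (s # ?P @ [r])) = b - a + 3" using assms(3) by simp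
  ultimately show ?thesis by blast
qed

text \<open>The cycle is \<open>c j\<close> backwards to \<open>c (i + 2)\<close>, then
  \<open>r\<close> and \<open>s\<close>, then \<open>c (j + 1)\<close> forwards to
  \<open>c i\<close>, closed by the chord. It loses \<open>c (i + 1)\<close> and gains two
  vertices.\<close>

lemma cyc_chord_insert2:
  assumes "simple_graph G" "cyc G m c" "i + 2 \<le> j" "j < i + m"
    and "r \<notin> range c" "s \<notin> range c" "adj G r s"
    and "adj G (c i) (c j)" "adj G r (c (i + 2))" "adj G s (c (j + 1))"
  shows "\<exists>xs. is_cycle G xs \<and> int (length xs) = m + 1"
proof -
  let ?P = "seg c (i + 2) j" and ?R = "seg c (j + 1) (i + m)"
  have ne: "?P \<noteq> []" "?R \<noteq> []" using assms(3,4) by (simp_all add: seg_def)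
  have hl: "hd ?P = c (i + 2)" "last ?P = c j" "hd ?R = c (j + 1)" "last ?R = c i"
    using assms(3,4) cyc_period[OF assms(2), of i] by (simp_all add: hd_seg last_seg)
  have disj: "set ?P \<inter> set ?R = {}"
    using seg_disjoint[OF assms(2), of j "j + 1" "i + m" "i + 2"] by simp
  have "is_cycle G (rev ?P @ r # s # ?R)"
  proof (rule is_cycle_successively[OF assms(1)])
    have "s \<noteq> r" using adj_in(3)[OF assms(1,7)] by simp
    moreover have "r \<notin> set ?P" "r \<notin> set ?R" "s \<notin> set ?P" "s \<notin> set ?R" using assms(5,6) by auto
    ultimately show "distinct (rev ?P @ r # s # ?R)"
      using disj distinct_seg[OF assms(2), of j "i + 2"]
        distinct_seg[OF assms(2), of "i + m" "j + 1"] assms(3,4) by auto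
    have "successively (adj G) (r # s # ?R)"
      using successively_seg[OF assms(2)] ne hl assms(7,10) by (simp add: successively_Cons)
    then show "successively (adj G) (rev ?P @ r # s # ?R)"
      unfolding successively_append_iff successively_adj_rev
      using successively_seg[OF assms(2)] hl ne assms(9) by (simp add: last_rev adj_sym[of G r])
    show "adj G (last (rev ?P @ r # s # ?R)) (hd (rev ?P @ r # s # ?R))"
      using ne hl assms(8) by (simp add: hd_append hd_rev)
    show "3 \<le> length (rev ?P @ r # s # ?R)" using assms(3,4) by simp
  qed
  moreover have "int (length (rev ?P @ r # s # ?R)) = m + 1" using assms(3,4) by simp
  ultimately show ?thesis by blast
qed

section \<open>Sums over one period\<close>

lemma periodic_mod:
  fixes m :: int
  assumes "\<And>i. P (i + m) = P i"
  shows "P (i mod m) = P i"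
proof -
  have "P (i + k * m) = P i" for i k
  proof (induction k rule: int_induct[where k=0])
    case (step1 k)
    have "i + (k + 1) * m = (i + k * m) + m" by (simp add: algebra_simps)
    then show ?case using assms[of "i + k * m"] step1 by (simp only:)
  next
    case (step2 k)
    have "i + k * m = (i + (k - 1) * m) + m" by (simp add: algebra_simps)
    then show ?case using assms[of "i + (k - 1) * m"] step2 by (simp only:)
  qed simp
  from this[of "i mod m" "i div m"] show ?thesis by simp
qed

lemma sum_window_shift:
  fixes f :: "int \<Rightarrow> int"
  assumes "0 < m" "\<And>i. f (i + m) = f i"
  shows "(\<Sum>i\<in>{0..<m}. f (i + t)) = (\<Sum>i\<in>{0..<m}. f i)"
proof -
  have pm: "f (i mod m) = f i" for i by (rule periodic_mod) (rule assms(2))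
  show ?thesis
  proof (rule sum.reindex_bij_witness[where i = "\<lambda>i. (i - t) mod m" and j = "\<lambda>i. (i + t) mod m"])
    fix a assume "a \<in> {0..<m}"
    then show "((a + t) mod m - t) mod m = a" by (simp add: mod_diff_left_eq)
    show "(a + t) mod m \<in> {0..<m}" using assms(1) by simp
    show "f ((a + t) mod m) = f (a + t)" by (rule pm)
  next
    fix a assume "a \<in> {0..<m}"
    then show "((a - t) mod m + t) mod m = a" by (simp add: mod_add_left_eq)
    show "(a - t) mod m \<in> {0..<m}" using assms(1) by simp
  qed
qed

lemma cyc_cong:
  assumes "cyc G m c" "c i = c j"
  shows "c (i + t) = c (j + t)"
  using assms cyc_eq[OF assms(1)] by (metis mod_add_cong)

section \<open>Bipartitions and missing pairs\<close>

lemma bip_edges: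
  assumes "simple_graph G" "A \<union> B = verts G" "A \<inter> B = {}"
    and "\<And>u v. adj G u v \<Longrightarrow> u \<in> A \<longleftrightarrow> v \<in> B"
  shows "card (edges G) + card {(a, b) \<in> A \<times> B. \<not> adj G a b} = card A * card B"
proof -
  have fin: "finite A" "finite B" using simple_finite[OF assms(1)] assms(2) by (metis finite_Un)+
  let ?E = "{(a, b) \<in> A \<times> B. adj G a b}" and ?N = "{(a, b) \<in> A \<times> B. \<not> adj G a b}"
  have "card ?E + card ?N = card (?E \<union> ?N)"
    by (rule card_Un_disjoint[symmetric]) (use fin in \<open>auto intro: finite_subset[of _ "A \<times> B"]\<close>)
  also have "?E \<union> ?N = A \<times> B" by auto
  finally have 1: "card ?E + card ?N = card A * card B" by (simp add: card_cartesian_product)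
  have "edges G = (\<lambda>(a, b). {a, b}) ` ?E"
  proof
    show "edges G \<subseteq> (\<lambda>(a, b). {a, b}) ` ?E"
    proof
      fix e assume e: "e \<in> edges G"
      obtain x y where xy: "e = {x, y}" "adj G x y" "x \<in> verts G" "y \<in> verts G"
        by (rule edge_obtain[OF assms(1) e])
      have yx: "adj G y x" using xy(2) by (rule adj_sym[THEN iffD1])
      show "e \<in> (\<lambda>(a, b). {a, b}) ` ?E"
      proof (cases "x \<in> A")
        case True
        then have "(x, y) \<in> ?E" using assms(4)[OF xy(2)] xy(2) by simp
        then show ?thesis using xy(1) by force
      next
        case False
        then have "y \<in> A" "x \<in> B" using assms(2) assms(4)[OF xy(2)] xy(3,4) by auto
        then have "(y, x) \<in> ?E" using yx by simp
        then show ?thesis using xy(1) by (force simp: insert_commute)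
      qed
    qed
    show "(\<lambda>(a, b). {a, b}) ` ?E \<subseteq> edges G" by (auto simp: adj_def)
  qed
  moreover have "inj_on (\<lambda>(a, b). {a, b}) ?E"
    using assms(3) by (auto simp: inj_on_def doubleton_eq_iff)
  ultimately have "card (edges G) = card ?E" by (simp add: card_image)
  then show ?thesis using 1 by simp
qed

lemma bipartite_adj:
  assumes "simple_graph G" "bipartite G"
  obtains A B where "A \<union> B = verts G" "A \<inter> B = {}" "\<And>u v. adj G u v \<Longrightarrow> u \<in> A \<longleftrightarrow> v \<in> B"
proof -
  obtain A B where AB: "A \<union> B = verts G" "A \<inter> B = {}" "\<forall>e\<in>edges G. \<exists>a\<in>A. \<exists>b\<in>B. e = {a, b}"
    using assms(2) unfolding bipartite_def by blast
  have "u \<in> A \<longleftrightarrow> v \<in> B" if uv: "adj G u v" for u v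
  proof -
    obtain a b where "a \<in> A" "b \<in> B" "{u, v} = {a, b}" using AB(3) uv unfolding adj_def by blast
    then show ?thesis using AB(2) by (auto simp: doubleton_eq_iff)
  qed
  then show thesis using AB(1,2) that by blast
qed

lemma bipartiteI:
  assumes "simple_graph G" "A \<union> B = verts G" "A \<inter> B = {}"
    and "\<And>u v. adj G u v \<Longrightarrow> u \<in> A \<longleftrightarrow> v \<in> B"
  shows "bipartite G"
  unfolding bipartite_def
proof (intro exI conjI ballI)
  fix e assume e: "e \<in> edges G"
  obtain x y where xy: "e = {x, y}" "adj G x y" "x \<in> verts G" "y \<in> verts G"
    by (rule edge_obtain[OF assms(1) e])
  then show "\<exists>a\<in>A. \<exists>b\<in>B. e = {a, b}"
    using assms(2,3) assms(4)[OF xy(2)] by (metis UnE disjoint_iff insert_commute)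
qed (use assms in auto)

lemma bipartiteI_indep:
  assumes "simple_graph G" "A \<union> B = verts G" "A \<inter> B = {}"
    and "\<And>u v. u \<in> A \<Longrightarrow> v \<in> A \<Longrightarrow> \<not> adj G u v" "\<And>u v. u \<in> B \<Longrightarrow> v \<in> B \<Longrightarrow> \<not> adj G u v"
  shows "bipartite G"
proof (rule bipartiteI[OF assms(1-3)])
  fix u v assume uv: "adj G u v"
  show "u \<in> A \<longleftrightarrow> v \<in> B"
    using adj_in(1,2)[OF assms(1) uv] assms(2-5) uv by (metis UnE disjoint_iff)
qed

text \<open>One period of indices is counted. For a periodic \<open>P\<close> this is the number of
  cycle vertices with the property (\<open>cnt_image\<close>) and is unchanged when the argument is
  shifted (\<open>cnt_shift\<close>), so disjoint shifted index sets yield inequalities between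
  counts.\<close>

definition cnt :: "int \<Rightarrow> (int \<Rightarrow> bool) \<Rightarrow> nat" where
  "cnt m P = card {i \<in> {0..<m}. P i}"

lemma cnt_image:
  assumes "cyc G m c" "\<And>i. P (i + m) = P i"
  shows "card (c ` {i. P i}) = cnt m P"
proof -
  have m: "0 < m" using assms(1) unfolding cyc_def by linarith
  have "c ` {i. P i} = c ` {i \<in> {0..<m}. P i}"
  proof
    show "c ` {i. P i} \<subseteq> c ` {i \<in> {0..<m}. P i}"
    proof
      fix v assume "v \<in> c ` {i. P i}"
      then obtain i where i: "v = c i" "P i" by blast
      have "c i = c (i mod m)" using cyc_eq[OF assms(1), of i "i mod m"] by simp
      moreover have "P (i mod m)" using periodic_mod[of P m i, OF assms(2)] i(2) by simp
      ultimately show "v \<in> c ` {i \<in> {0..<m}. P i}" using i(1) m by simp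
    qed
  qed auto
  moreover have "inj_on c {i \<in> {0..<m}. P i}"
    by (rule inj_on_subset[OF cyc_inj_window[OF assms(1), of 0]]) auto
  ultimately show ?thesis unfolding cnt_def by (simp add: card_image)
qed

lemma cnt_shift:
  assumes "0 < m" "\<And>i. P (i + m) = P i"
  shows "cnt m (\<lambda>i. P (i + t)) = cnt m P"
proof -
  have eq: "int (cnt m R) = (\<Sum>i\<in>{0..<m}. of_bool (R i))" for R
    unfolding cnt_def by (simp add: of_bool_def sum.If_cases Int_def)
  have "int (cnt m (\<lambda>i. P (i + t))) = int (cnt m P)"
    unfolding eq by (rule sum_window_shift[OF assms(1), where f = "\<lambda>i. of_bool (P i)"]) (simp only: assms(2))
  then show ?thesis by simp
qed

lemma finite_cnt: "finite {i \<in> {0..<m::int}. P i}"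
  by (rule finite_subset[of _ "{0..<m}"]) auto

lemma cnt_mono: "(\<And>i. P i \<Longrightarrow> R i) \<Longrightarrow> cnt m P \<le> cnt m R"
  unfolding cnt_def by (rule card_mono[OF finite_cnt]) auto

lemma cnt_add:
  assumes "\<And>i. \<not> (P i \<and> R i)"
  shows "cnt m (\<lambda>i. P i \<or> R i) = cnt m P + cnt m R"
proof -
  have eq: "{i \<in> {0..<m}. P i \<or> R i} = {i \<in> {0..<m}. P i} \<union> {i \<in> {0..<m}. R i}" by auto
  have "{i \<in> {0..<m}. P i} \<inter> {i \<in> {0..<m}. R i} = {}" using assms by auto
  then show ?thesis unfolding cnt_def eq by (rule card_Un_disjoint[OF finite_cnt finite_cnt])
qed

lemma cnt_True: "cnt m (\<lambda>i. True) = nat m"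
proof -
  have "{i \<in> {0..<m}. True} = {0..<m}" by auto
  then show ?thesis unfolding cnt_def by simp
qed

text \<open>In one period a vertex of \<open>S\<close> occurs at most once as \<open>d t\<close> and
  at most once as \<open>d (t + 1)\<close>, hence meets at most two edges of the cycle.\<close>

lemma cyc_cover:
  assumes "cyc G m d" "finite S"
  shows "card {t \<in> {0..<m}. d t \<in> S \<or> d (t + 1) \<in> S} \<le> 2 * card S"
proof -
  have "card {t \<in> {0..<m}. e t \<in> S} \<le> card S" if "cyc G m e" for e
  proof (rule card_inj_on_le[OF _ _ assms(2)])
    show "inj_on e {t \<in> {0..<m}. e t \<in> S}"
      by (rule inj_on_subset[OF cyc_inj_window[OF that, of 0]]) auto
  qed auto
  from this[OF assms(1)] this[OF cyc_shift[OF assms(1), of 1]]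
  have "card {t \<in> {0..<m}. d t \<in> S} \<le> card S" "card {t \<in> {0..<m}. d (t + 1) \<in> S} \<le> card S" .
  moreover have "{t \<in> {0..<m}. d t \<in> S \<or> d (t + 1) \<in> S} =
      {t \<in> {0..<m}. d t \<in> S} \<union> {t \<in> {0..<m}. d (t + 1) \<in> S}" by auto
  ultimately show ?thesis
    using card_Un_le[of "{t \<in> {0..<m}. d t \<in> S}" "{t \<in> {0..<m}. d (t + 1) \<in> S}"] by simp
qed

text \<open>This is the drop of the size bound when two vertices are deleted from a graph of order
  \<open>k + 2\<close>; it comes from (k + 1)^2 - (k - 1)^2 = 4 k.\<close>

lemma square_div4: "(k + 1)\<^sup>2 div 4 = (k - 1)\<^sup>2 div 4 + (k::nat)" if "1 \<le> k"
proof -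
  define j where "j = k - 1"
  then have "k = j + 1" using that by simp
  then have "(k + 1)\<^sup>2 = (k - 1)\<^sup>2 + k * 4" by (simp add: power2_eq_square algebra_simps)
  then show ?thesis by simp
qed

text \<open>For order \<open>2 * k\<close> the size bound without its constant falls short of the
  size of the balanced complete bipartite graph by \<open>k\<close>, which limits the missing pairs
  of a bipartite graph that satisfies the bound.\<close>

lemma square_div4_even: "(2 * k - 1)\<^sup>2 div 4 + k = k * (k::nat)"
proof (cases k)
  case (Suc j)
  then have "(2 * k - 1)\<^sup>2 = 1 + 4 * (j * j + j)" by (simp add: power2_eq_square algebra_simps)
  then show ?thesis using Suc by simp
qed simp

text \<open>The product (x - 1)(y - 1) is nonnegative. This compares the number of pairs between two
  classes of neighbours with the number of neighbours.\<close>

lemma product_lower: "1 \<le> x \<Longrightarrow> 1 \<le> y \<Longrightarrow> x + y \<le> x * y + (1::nat)"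
  by (cases x; cases y) auto

section \<open>Two adjacent vertices off a cycle\<close>

text \<open>In the application \<open>c\<close> closes up a Hamiltonian cycle through a chord that skips just
  \<open>r\<close> and \<open>s\<close>, and \<open>m + 1\<close> is one less than the order of the graph.\<close>

locale outside_pair =
  fixes G :: "'a graph" and m :: int and c :: "int \<Rightarrow> 'a" and r s :: 'a
  assumes simple: "simple_graph G" and cyc: "cyc G m c"
    and r_out: "r \<notin> range c" and s_out: "s \<notin> range c" and rs: "adj G r s"
    and no_cycle: "\<And>xs. is_cycle G xs \<Longrightarrow> int (length xs) \<noteq> m + 1"
begin

text \<open>The situation is symmetric in \<open>r\<close> and \<open>s\<close> and under reversal
  of the cycle. The primed rules and the rules for predecessors come from these two interpretations
  instead of new cycle constructions.\<close>

lemma swap: "outside_pair G m c s r"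
  using simple cyc r_out s_out rs no_cycle by unfold_locales (auto simp: adj_sym[of G s r])

lemma mirror: "outside_pair G m (\<lambda>i. c (- i)) r s"
  using simple cyc_mirror[OF cyc] r_out s_out rs no_cycle
  by unfold_locales (auto simp: range_mirror)

lemma m3: "3 \<le> m"
  using cyc unfolding cyc_def by linarith

abbreviation I :: "int \<Rightarrow> bool" where "I i \<equiv> adj G r (c i)"
abbreviation J :: "int \<Rightarrow> bool" where "J i \<equiv> adj G s (c i)"
abbreviation Q :: "int \<Rightarrow> bool" where "Q i \<equiv> \<not> I i \<and> \<not> J i"

lemma per [simp]: "c (i + m) = c i"
  by (rule cyc_period[OF cyc])

section \<open>Adjacencies excluded by the absence of a cycle of length \<open>m + 1\<close>\<close>

lemma no_consecutive: "\<not> (I i \<and> I (i + 1))"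
proof
  assume a: "I i \<and> I (i + 1)"
  have "c (i + 1 + (m - 1)) = c i" using per[of i] by (simp add: algebra_simps)
  then have "is_cycle G (r # seg c (i + 1) (i + 1 + (m - 1)))"
    using cyc_insert[OF simple cyc r_out, of "m - 1" "i + 1"] a m3 by simp
  then show False using no_cycle m3 by fastforce
qed

text \<open>Replacing \<open>c (i + 1)\<close> by the two vertices \<open>r\<close> and
  \<open>s\<close> would give a cycle of length \<open>m + 1\<close>.\<close>

lemma dist_two: "\<not> (I i \<and> J (i + 2))"
proof
  assume a: "I i \<and> J (i + 2)"
  then show False
    using cyc_insert2[OF simple cyc _ _ r_out s_out rs, of "i + 2" "i + m"] m3 no_cycle by force
qed

text \<open>Otherwise \<open>r\<close> could be inserted by reversing an arc between two of its
  neighbours. The index of \<open>c j\<close> is first moved into the period that starts at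
  \<open>i\<close>, as the insertion needs ordered indices.\<close>

lemma succ_indep:
  assumes "I i" "I j" "c i \<noteq> c j"
  shows "\<not> adj G (c (i + 1)) (c (j + 1))"
proof
  assume a: "adj G (c (i + 1)) (c (j + 1))"
  obtain k where k: "i \<le> k" "k < i + m" "c k = c j" by (rule cyc_window_obtain[OF cyc])
  then have "c (k + 1) = c (j + 1)" by (intro cyc_cong[OF cyc])
  moreover have "i \<noteq> k" using k assms(3) by auto
  ultimately show False
    using cyc_insert_cross[OF simple cyc r_out, of i k] k assms(1,2) a no_cycle by fastforce
qed

text \<open>The second hypothesis excludes the cycle edge that leaves \<open>c i\<close> forwards;
  any other edge at \<open>c i\<close> admits the rerouting that drops \<open>c (i + 1)\<close> and
  inserts \<open>r\<close> and \<open>s\<close>.\<close>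

lemma chord_rule:
  assumes "adj G (c i) (c j)" "c j \<noteq> c (i + 1)"
  shows "\<not> (I (i + 2) \<and> J (j + 1))"
proof
  assume a: "I (i + 2) \<and> J (j + 1)"
  obtain k where k: "i \<le> k" "k < i + m" "c k = c j" by (rule cyc_window_obtain[OF cyc])
  then have "c (k + 1) = c (j + 1)" by (intro cyc_cong[OF cyc])
  moreover have "i \<noteq> k" using k assms(1) adj_in(3)[OF simple assms(1)] by auto
  moreover have "i + 1 \<noteq> k" using k assms(2) by auto
  ultimately show False
    using cyc_chord_insert2[OF simple cyc _ _ r_out s_out rs, of i k] k assms(1) a no_cycle by force
qed

text \<open>An edge of \<open>d\<close> could be replaced by the path through \<open>r\<close> and
  \<open>s\<close>, which adds two vertices. Later \<open>d\<close> is the cycle that the induction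
  hypothesis supplies in the graph without \<open>r\<close> and \<open>s\<close>.\<close>

lemma other_cycle_rule:
  assumes d: "cyc G (m - 1) d" and "r \<notin> range d" "s \<notin> range d"
    and "adj G r (d t)" "adj G s (d (t + 1))"
  shows False
proof -
  have "d (t + (m - 1)) = d t" by (rule cyc_period[OF d])
  then show False
    using cyc_insert2[OF simple d _ _ assms(2,3) rs, of "t + 1" "t + (m - 1)"] m3 no_cycle assms(4,5)
    by force
qed

lemma no_consecutive': "\<not> (J i \<and> J (i + 1))"
  using outside_pair.no_consecutive[OF swap] .

lemma dist_two': "\<not> (J i \<and> I (i + 2))"
  using outside_pair.dist_two[OF swap] .

lemma succ_indep':
  "J i \<Longrightarrow> J j \<Longrightarrow> c i \<noteq> c j \<Longrightarrow> \<not> adj G (c (i + 1)) (c (j + 1))"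
  using outside_pair.succ_indep[OF swap] .

lemma pred_indep: "I i \<Longrightarrow> I j \<Longrightarrow> c i \<noteq> c j \<Longrightarrow> \<not> adj G (c (i - 1)) (c (j - 1))"
  using outside_pair.succ_indep[OF mirror, of "- i" "- j"] by simp

lemma pred_indep': "J i \<Longrightarrow> J j \<Longrightarrow> c i \<noteq> c j \<Longrightarrow> \<not> adj G (c (i - 1)) (c (j - 1))"
  using outside_pair.succ_indep'[OF mirror, of "- i" "- j"] by simp

lemma chord_rule':
  "adj G (c i) (c j) \<Longrightarrow> c j \<noteq> c (i - 1) \<Longrightarrow> \<not> (I (i - 2) \<and> J (j - 1))"
  using outside_pair.chord_rule[OF mirror, of "- i" "- j"] by simp

lemma other_cycle_rule':
  "cyc G (m - 1) d \<Longrightarrow> r \<notin> range d \<Longrightarrow> s \<notin> range d \<Longrightarrow> adj G s (d t) \<Longrightarrow> adj G r (d (t + 1)) \<Longrightarrow> False"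
  by (rule outside_pair.other_cycle_rule[OF swap])

lemma ceq_iff: "c i = c j \<longleftrightarrow> m dvd (i - j)"
  using cyc_eq[OF cyc, of i j] by (simp add: mod_eq_dvd_iff)

lemma cneq: "0 < \<bar>i - j\<bar> \<Longrightarrow> \<bar>i - j\<bar> < m \<Longrightarrow> c i \<noteq> c j"
  unfolding ceq_iff using zdvd_not_zless[of "\<bar>i - j\<bar>" m] by simp

text \<open>An edge between two neighbours of \<open>r\<close> forces vertices adjacent to neither
  \<open>r\<close> nor \<open>s\<close> close to its ends. As there are at most two of these, they
  have to serve both ends at once, which is possible only if they are the two consecutive vertices
  that the chord spans.\<close>

lemma inner_chord:
  assumes m5: "5 \<le> m" and noZ: "\<And>i. \<not> (I i \<and> J i)" and q2: "card (c ` {i. Q i}) \<le> 2"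
    and ij: "I i" "I j" "adj G (c i) (c j)"
  shows "c j = c (i - 3) \<and> c ` {i. Q i} = {c (i - 1), c (i - 2)} \<or>
         c i = c (j - 3) \<and> c ` {i. Q i} = {c (j - 1), c (j - 2)}"
proof -
  let ?QV = "c ` {i. Q i}"
  have finQ: "finite ?QV" by (rule finite_subset[OF _ cyc_finite_range[OF cyc]]) auto
  have nij: "c i \<noteq> c j" using adj_in(3)[OF simple ij(3)] .
  have ji: "adj G (c j) (c i)" using ij(3) by (rule adj_sym[THEN iffD1])
  have step: "\<not> I (x + 1) \<and> \<not> I (x - 1) \<and> \<not> J (x + 2) \<and> \<not> J (x - 2)" if "I x" for x
    using no_consecutive[of x] no_consecutive[of "x - 1"] dist_two[of x] dist_two'[of "x - 2"] that
    by auto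
  have nadj: "c j \<noteq> c (i + 1)" "c j \<noteq> c (i - 1)" "c i \<noteq> c (j + 1)" "c i \<noteq> c (j - 1)"
    using step[OF ij(1)] step[OF ij(2)] ij(1,2) by metis+
  note si = step[OF ij(1)] and sj = step[OF ij(2)]
  \<comment> \<open>Without a vertex of \<open>Q\<close> here, both predecessors would be neighbours
    of \<open>s\<close> with adjacent successors. The facts below use the mirrored rule and the
    chord rules in the same way.\<close>
  have e: "Q (i - 1) \<or> Q (j - 1)" using succ_indep'[of "i - 1" "j - 1"] si sj ij(3) nij
      cyc_cong[OF cyc, of "i - 1" "j - 1" 1] by auto
  have f: "Q (i + 1) \<or> Q (j + 1)" using pred_indep'[of "i + 1" "j + 1"] si sj ij(3) nij
      cyc_cong[OF cyc, of "i + 1" "j + 1" "-1"] by auto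
  have a: "Q (i + 2) \<or> Q (j + 1)" using chord_rule[OF ij(3) nadj(1)] si sj by auto
  have b: "Q (i - 2) \<or> Q (j - 1)" using chord_rule'[OF ij(3) nadj(2)] si sj by auto
  have c: "Q (j + 2) \<or> Q (i + 1)" using chord_rule[OF ji nadj(3)] si sj by auto
  have d: "Q (j - 2) \<or> Q (i - 1)" using chord_rule'[OF ji nadj(4)] si sj by auto
  have three: False if "Q x" "Q y" "Q z" "c x \<noteq> c y" "c y \<noteq> c z" "c x \<noteq> c z" for x y z
  proof -
    have "card {c x, c y, c z} \<le> card ?QV" by (rule card_mono[OF finQ]) (use that in auto)
    then show False using that q2 by simp
  qed
  have two: "?QV = {c x, c y}" if "Q x" "Q y" "c x \<noteq> c y" for x y
  proof -
    have "{c x, c y} \<subseteq> ?QV" using that by auto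
    moreover have "card ?QV \<le> card {c x, c y}" using that q2 by simp
    ultimately show ?thesis using finQ by (metis card_seteq)
  qed
  \<comment> \<open>Two distinct vertices flanked by the same two vertices would make the cycle
    close after four steps, against \<open>5 \<le> m\<close>.\<close>
  have both: False if "Q (x - 1)" "Q (x + 1)" "Q (y - 1)" "Q (y + 1)" "c x \<noteq> c y" for x y
  proof -
    have qv: "?QV = {c (x - 1), c (x + 1)}" using two[of "x - 1" "x + 1"] that(1,2) cneq[of "x - 1" "x + 1"] m5 by simp
    have "c (y + 1) \<in> ?QV" "c (y - 1) \<in> ?QV" using that by auto
    then have "c (y + 1) = c (x - 1) \<or> c (y + 1) = c (x + 1)" "c (y - 1) = c (x - 1) \<or> c (y - 1) = c (x + 1)"
      unfolding qv by auto
    moreover have "c (y + 1) \<noteq> c (x + 1)" using that(5) cyc_cong[OF cyc, of "y + 1" "x + 1" "-1"] by auto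
    moreover have "c (y - 1) \<noteq> c (x - 1)" using that(5) cyc_cong[OF cyc, of "y - 1" "x - 1" 1] by auto
    ultimately have "m dvd (y + 1 - (x - 1))" "m dvd (y - 1 - (x + 1))" by (auto simp: ceq_iff)
    then have "m dvd (y + 1 - (x - 1)) - (y - 1 - (x + 1))" by (rule dvd_diff)
    then have "m dvd 4" by simp
    then show False using zdvd_imp_le[of m 4] m5 by simp
  qed
  \<comment> \<open>The two \<open>Q\<close> vertices before \<open>x\<close> and those after
    \<open>y\<close> coincide, and the order must be \<open>y\<close>, \<open>Q\<close>,
    \<open>Q\<close>, \<open>x\<close>: the other matching would put \<open>x\<close> itself into
    \<open>Q\<close>.\<close>
  have core: "c y = c (x - 3) \<and> ?QV = {c (x - 1), c (x - 2)}"
    if "Q (x - 1)" "Q (x - 2)" "Q (y + 1)" "Q (y + 2)" "I x" for x y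
  proof -
    have qv: "?QV = {c (x - 1), c (x - 2)}" using two[of "x - 1" "x - 2"] that(1,2) cneq[of "x - 1" "x - 2"] m5 by simp
    have "c (y + 1) \<in> ?QV" using that by auto
    then have "c (y + 1) = c (x - 1) \<or> c (y + 1) = c (x - 2)" unfolding qv by auto
    moreover have "c (y + 1) \<noteq> c (x - 1)"
    proof
      assume "c (y + 1) = c (x - 1)"
      then have "c (y + 1 + 1) = c (x - 1 + 1)" by (rule cyc_cong[OF cyc])
      then have "c (y + 2) = c x" by (simp add: algebra_simps)
      then show False using that(4,5) by auto
    qed
    ultimately have "c (y + 1) = c (x - 2)" by simp
    then have "c (y + 1 - 1) = c (x - 2 - 1)" using cyc_cong[OF cyc, of "y + 1" "x - 2" "-1"] by simp
    then show ?thesis using qv by simp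
  qed
  show ?thesis
  proof (cases "Q (i - 1)")
    case i1: True
    show ?thesis
    proof (cases "Q (i + 1)")
      case True
      have "\<not> Q (i + 2)" "\<not> Q (i - 2)"
        using three[of "i - 1" "i + 1" "i + 2"] three[of "i - 1" "i + 1" "i - 2"] i1 True
          cneq m5 by auto
      then show ?thesis using a b both[OF i1 True _ _ nij] by blast
    next
      case False
      then have j: "Q (j + 1)" "Q (j + 2)" using c f by auto
      show ?thesis
      proof (cases "Q (j - 1)")
        case True
        then show ?thesis using three[of "j - 1" "j + 1" "j + 2"] j cneq m5 by auto
      next
        case False
        then show ?thesis using core[OF i1 _ j ij(1)] b by blast
      qed
    qed
  next
    case False
    then have j: "Q (j - 1)" "Q (j - 2)" using d e by auto
    have nj: "\<not> Q (j + 1)" using three[of "j - 1" "j - 2" "j + 1"] j cneq m5 by auto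
    then have "Q (i + 1)" "Q (i + 2)" using a f by auto
    then show ?thesis using core[OF j _ _ ij(2)] by blast
  qed
qed

section \<open>Counting cycle vertices adjacent to both or to neither of \<open>r\<close> and
  \<open>s\<close>\<close>

abbreviation Z :: "int \<Rightarrow> bool" where "Z i \<equiv> I i \<and> J i"

text \<open>At distance one from a common neighbour the rule on consecutive neighbours applies to
  \<open>r\<close> and to \<open>s\<close>; at distance two \<open>dist_two\<close> applies with
  either vertex in either role.\<close>

lemma Z_Q: "Z i \<Longrightarrow> Q (i + 1) \<and> Q (i - 1) \<and> Q (i + 2) \<and> Q (i - 2)"
  using no_consecutive[of i] no_consecutive[of "i - 1"] no_consecutive'[of i] no_consecutive'[of "i - 1"]
    dist_two[of i] dist_two'[of i] dist_two[of "i - 2"] dist_two'[of "i - 2"] by auto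

lemma m0: "0 < m"
  using m3 by simp

lemma cnt_Q: "int (cnt m Q) = m - int (cnt m I) - int (cnt m J) + int (cnt m Z)"
proof -
  have "cnt m (\<lambda>i. I i \<or> (\<not> I i \<and> J i)) = cnt m I + cnt m (\<lambda>i. \<not> I i \<and> J i)"
    by (rule cnt_add) auto
  moreover have "cnt m (\<lambda>i. Z i \<or> (\<not> I i \<and> J i)) = cnt m Z + cnt m (\<lambda>i. \<not> I i \<and> J i)"
    by (rule cnt_add) auto
  moreover have "cnt m (\<lambda>i. (I i \<or> (\<not> I i \<and> J i)) \<or> Q i) = cnt m (\<lambda>i. I i \<or> (\<not> I i \<and> J i)) + cnt m Q"
    by (rule cnt_add) auto
  moreover have "(\<lambda>i. Z i \<or> (\<not> I i \<and> J i)) = J" by auto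
  moreover have "(\<lambda>i. (I i \<or> (\<not> I i \<and> J i)) \<or> Q i) = (\<lambda>i. True)" by auto
  ultimately show ?thesis using cnt_True[of m] m0 by simp
qed

lemma two_cnt_Z: "cnt m (\<lambda>i. Z (i + 1) \<or> Z (i + 2)) = 2 * cnt m Z"
proof -
  have "cnt m (\<lambda>i. Z (i + 1) \<or> Z (i + 2)) = cnt m (\<lambda>i. Z (i + 1)) + cnt m (\<lambda>i. Z (i + 2))"
  proof (rule cnt_add)
    fix i show "\<not> (Z (i + 1) \<and> Z (i + 2))"
      using no_consecutive[of "i + 1"] by (auto simp: add.assoc)
  qed
  moreover have "cnt m (\<lambda>i. Z (i + 1)) = cnt m Z" "cnt m (\<lambda>i. Z (i + 2)) = cnt m Z"
    by (rule cnt_shift[OF m0, where P = Z], simp)+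
  ultimately show ?thesis by simp
qed

lemma Z_le_Q: "2 * cnt m Z \<le> cnt m Q"
  unfolding two_cnt_Z[symmetric]
proof (rule cnt_mono)
  fix i assume "Z (i + 1) \<or> Z (i + 2)"
  then show "Q i" using Z_Q[of "i + 1"] Z_Q[of "i + 2"] by auto
qed

text \<open>These are the vertices right after a run of \<open>Q\<close> that see exactly one of
  \<open>r\<close> and \<open>s\<close>. Together with \<open>Q\<close> they meet every edge between
  cycle vertices except those joining a neighbour of \<open>r\<close> to a neighbour of
  \<open>s\<close>, and such edges cannot lie on \<open>d\<close>.\<close>

definition Q_succ :: "int \<Rightarrow> bool" where
  "Q_succ i \<longleftrightarrow> Q (i - 1) \<and> \<not> Q i \<and> \<not> Z i"

lemma per': "c (i + m - k) = c (i - k)" "c (i + m + k) = c (i + k)"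
  using per[of "i - k"] per[of "i + k"] by (simp_all add: algebra_simps)

text \<open>A vertex counted by \<open>Q_succ\<close> has its predecessor in \<open>Q\<close>, and a
  common neighbour has its last two predecessors there. All these predecessors are distinct.\<close>

lemma cnt_Q_succ: "cnt m Q_succ + 2 * cnt m Z \<le> cnt m Q"
proof -
  have "cnt m (\<lambda>i. Q_succ i \<or> Z i) = cnt m Q_succ + cnt m Z"
    by (rule cnt_add) (simp add: Q_succ_def)
  moreover have "cnt m (\<lambda>i. (Q_succ i \<or> Z i) \<or> Z (i + 1)) = cnt m (\<lambda>i. Q_succ i \<or> Z i) + cnt m (\<lambda>i. Z (i + 1))"
  proof (rule cnt_add)
    fix i show "\<not> ((Q_succ i \<or> Z i) \<and> Z (i + 1))"
      using Z_Q[of "i + 1"] by (auto simp: Q_succ_def)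
  qed
  moreover have "cnt m (\<lambda>i. Z (i + 1)) = cnt m Z"
    by (rule cnt_shift[OF m0, where P = Z]) simp
  moreover have "cnt m (\<lambda>i. (Q_succ i \<or> Z i) \<or> Z (i + 1)) \<le> cnt m (\<lambda>i. Q (i + -1))"
  proof (rule cnt_mono)
    fix i assume "(Q_succ i \<or> Z i) \<or> Z (i + 1)"
    moreover have "i + -1 = i - 1" "i + 1 - 2 = i - 1" by simp_all
    ultimately show "Q (i + -1)" using Z_Q[of i] Z_Q[of "i + 1"] unfolding Q_succ_def by metis
  qed
  moreover have "cnt m (\<lambda>i. Q (i + -1)) = cnt m Q"
    by (rule cnt_shift[OF m0, where P = Q]) (simp only: per)
  ultimately show ?thesis by simp
qed

lemma edge_cases:
  assumes d: "cyc G (m - 1) d" and rd: "range d \<subseteq> range c"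
  obtains i j where "d t = c i" "d (t + 1) = c j" "adj G (c i) (c j)"
    "Q i \<or> Q j \<or> (I i \<and> I j \<and> \<not> J i \<and> \<not> J j) \<or> (J i \<and> J j \<and> \<not> I i \<and> \<not> I j)"
proof -
  have out: "r \<notin> range d" "s \<notin> range d" using rd r_out s_out by auto
  obtain i j where ij: "d t = c i" "d (t + 1) = c j" using rd by blast
  have "adj G (c i) (c j)" using cyc_adj[OF d, of t] ij by simp
  moreover have "\<not> (I i \<and> J j)" "\<not> (J i \<and> I j)"
    using other_cycle_rule[OF d out, of t] other_cycle_rule'[OF d out, of t] ij by auto
  ultimately show thesis using that[OF ij] by blast
qed

text \<open>The predecessors of the two ends are not neighbours of \<open>r\<close>. They are not
  both neighbours of \<open>s\<close> either, because successors of neighbours of \<open>s\<close>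
  are independent. So one predecessor lies in \<open>Q\<close>.\<close>

lemma inner_Q_succ:
  assumes "I i" "I j" "\<not> J i" "\<not> J j" "adj G (c i) (c j)"
  shows "Q_succ i \<or> Q_succ j"
proof -
  have "\<not> I (i - 1)" "\<not> I (j - 1)"
    using no_consecutive[of "i - 1"] no_consecutive[of "j - 1"] assms by auto
  moreover have "\<not> (J (i - 1) \<and> J (j - 1))"
    using succ_indep'[of "i - 1" "j - 1"] assms(5) adj_in(3)[OF simple assms(5)]
      cyc_cong[OF cyc, of "i - 1" "j - 1" 1] by auto
  ultimately show ?thesis using assms unfolding Q_succ_def by auto
qed

lemma Q_succ_swap: "outside_pair.Q_succ G c s r = Q_succ"
proof -
  interpret S: outside_pair G m c s r by (rule swap)
  show ?thesis unfolding S.Q_succ_def[abs_def] Q_succ_def[abs_def] by (intro ext) blast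
qed

lemma inner_Q_succ':
  assumes "J i" "J j" "\<not> I i" "\<not> I j" "adj G (c i) (c j)"
  shows "Q_succ i \<or> Q_succ j"
  using outside_pair.inner_Q_succ[OF swap] assms unfolding Q_succ_swap by blast

text \<open>\<open>Q\<close> and \<open>Q_succ\<close> meet all edges of \<open>d\<close>. Together
  they have at most 2 |Q| - 2 |Z| elements, and each meets at most two edges of
  \<open>d\<close>.\<close>

lemma cover_bound:
  assumes d: "cyc G (m - 1) d" and rd: "range d \<subseteq> range c"
  shows "m - 1 \<le> 4 * (int (cnt m Q) - int (cnt m Z))"
proof -
  let ?S = "c ` {i. Q i} \<union> c ` {i. Q_succ i}"
  have fin: "finite ?S" by (rule finite_subset[OF _ cyc_finite_range[OF cyc]]) auto
  have "d t \<in> ?S \<or> d (t + 1) \<in> ?S" for t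
  proof -
    obtain i j where "d t = c i" "d (t + 1) = c j" "adj G (c i) (c j)"
      "Q i \<or> Q j \<or> (I i \<and> I j \<and> \<not> J i \<and> \<not> J j) \<or> (J i \<and> J j \<and> \<not> I i \<and> \<not> I j)"
      by (rule edge_cases[OF d rd])
    moreover from this have "Q i \<or> Q j \<or> Q_succ i \<or> Q_succ j"
      using inner_Q_succ[of i j] inner_Q_succ'[of i j] by blast
    ultimately show ?thesis by auto
  qed
  then have "{t \<in> {0..<m - 1}. d t \<in> ?S \<or> d (t + 1) \<in> ?S} = {0..<m - 1}" by auto
  then have le: "m - 1 \<le> 2 * int (card ?S)" using cyc_cover[OF d fin] by simp
  have "card ?S \<le> card (c ` {i. Q i}) + card (c ` {i. Q_succ i})" by (rule card_Un_le)
  also have "card (c ` {i. Q i}) = cnt m Q"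
    by (rule cnt_image[OF cyc]) simp
  also have "card (c ` {i. Q_succ i}) = cnt m Q_succ"
    by (rule cnt_image[OF cyc]) (simp add: Q_succ_def per')
  finally have "int (card ?S) \<le> int (cnt m Q) + int (cnt m Q_succ)"
    by (simp only: of_nat_add[symmetric] of_nat_le_iff)
  moreover have "int (cnt m Q_succ) + 2 * int (cnt m Z) \<le> int (cnt m Q)"
    using of_nat_mono[OF cnt_Q_succ, where 'a = int] by simp
  moreover have "m - 1 \<le> 4 * (q - z)" if "k \<le> q + p" "p + 2 * z \<le> q" "m - 1 \<le> 2 * k" for k q p z :: int
    using that by presburger
  ultimately show ?thesis using le by blast
qed

lemma four_Q:
  assumes "5 \<le> m" "Z z"
  shows "4 \<le> cnt m Q"
proof -
  have "card {c (z - 2), c (z - 1), c (z + 1), c (z + 2)} \<le> card (c ` {i. Q i})"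
  proof (rule card_mono)
    show "finite (c ` {i. Q i})" by (rule finite_subset[OF _ cyc_finite_range[OF cyc]]) auto
    show "{c (z - 2), c (z - 1), c (z + 1), c (z + 2)} \<subseteq> c ` {i. Q i}"
      using Z_Q[OF assms(2)] by auto
  qed
  moreover have "card {c (z - 2), c (z - 1), c (z + 1), c (z + 2)} = 4"
    using cneq assms(1) by simp
  moreover have "card (c ` {i. Q i}) = cnt m Q"
    by (rule cnt_image[OF cyc]) simp
  ultimately show ?thesis by simp
qed

text \<open>The counts leave only |Q| = 4 and |Z| = 2, where \<open>Q\<close> consists of the two
  predecessors of each common neighbour. Then the pattern of a common neighbour followed by two
  vertices of \<open>Q\<close> fills the whole cycle. The vertex \<open>c (- 1)\<close>, being a
  neighbour of \<open>r\<close>, is a common neighbour, and \<open>s\<close> has two consecutive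
  neighbours.\<close>

lemma no_Z:
  assumes m5: "5 \<le> m" and I1: "I (- 1)" and J0: "J 0"
    and d: "int (cnt m Q) = \<delta> + int (cnt m Z)" "\<delta> \<le> 2"
  shows "\<not> Z z"
proof
  assume z: "Z z"
  have q: "cnt m Q = 2 * cnt m Z" using four_Q[OF m5 z] Z_le_Q d by linarith
  have eq: "{i \<in> {0..<m}. Z (i + 1) \<or> Z (i + 2)} = {i \<in> {0..<m}. Q i}"
  proof (rule card_seteq[OF finite_cnt])
    show "{i \<in> {0..<m}. Z (i + 1) \<or> Z (i + 2)} \<subseteq> {i \<in> {0..<m}. Q i}"
    proof
      fix i assume "i \<in> {i \<in> {0..<m}. Z (i + 1) \<or> Z (i + 2)}"
      then show "i \<in> {i \<in> {0..<m}. Q i}" using Z_Q[of "i + 1"] Z_Q[of "i + 2"] by auto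
    qed
    show "card {i \<in> {0..<m}. Q i} \<le> card {i \<in> {0..<m}. Z (i + 1) \<or> Z (i + 2)}"
      using q two_cnt_Z unfolding cnt_def by simp
  qed
  have bk: "Z (x + 1) \<or> Z (x + 2)" if "Q x" for x
  proof -
    have x: "c (x mod m) = c x" using cyc_eq[OF cyc, of "x mod m" x] by simp
    then have "x mod m \<in> {i \<in> {0..<m}. Q i}" using that m0 by simp
    then have "Z (x mod m + 1) \<or> Z (x mod m + 2)" unfolding eq[symmetric] by blast
    then show ?thesis using cyc_cong[OF cyc x] by simp
  qed
  have step: "Z (x + 3)" if "Z x" for x
    using bk[of "x + 1"] Z_Q[OF that] by (auto simp: add.assoc)
  have Zk: "Z (z + 3 * int k)" for k
  proof (induction k)
    case (Suc k)
    then show ?case using step[of "z + 3 * int k"] by (simp add: algebra_simps)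
  qed (use z in simp)
  have all: "Z x \<or> Q x" if "z \<le> x" for x
  proof -
    define k where "k = nat ((x - z) div 3)"
    have "x = z + 3 * int k \<or> x = z + 3 * int k + 1 \<or> x = z + 3 * int k + 2"
      using that unfolding k_def by auto
    then show ?thesis using Zk[of k] Z_Q[OF Zk[of k]] by auto
  qed
  \<comment> \<open>The pattern is propagated upwards from \<open>z\<close> only; \<open>w\<close>
    lifts the index - 1 by whole periods above \<open>z\<close>.\<close>
  obtain w :: int where w: "0 \<le> w" "z + 1 \<le> w" by (rule that[of "max 0 (z + 1)"]) auto
  define x where "x = - 1 + m * w"
  have "1 * w \<le> m * w" by (rule mult_right_mono) (use m0 w in auto)
  then have "z \<le> x" unfolding x_def using w by linarith
  moreover have cx: "c x = c (- 1)" unfolding ceq_iff x_def by simp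
  ultimately have "Z x" using all[of x] I1 by auto
  moreover have "c (x + 1) = c 0" using cyc_cong[OF cyc cx, of 1] by simp
  ultimately show False using no_consecutive'[of x] J0 by auto
qed

text \<open>An edge of \<open>d\<close> that avoids \<open>Q\<close> spans a gap formed by the two
  vertices of \<open>Q\<close>, so there is at most one, and \<open>m - 1\<close> is at most 2 |Q| +
  1. What remains is \<open>m = 6\<close> with one such edge, settled by inspecting the other two
  cycle vertices.\<close>

lemma refined_bound:
  assumes m5: "5 \<le> m" and noZ: "\<And>i. \<not> Z i" and q2: "cnt m Q \<le> 2" and q1: "m = 5 \<Longrightarrow> cnt m Q \<le> 1"
    and d: "cyc G (m - 1) d" and rd: "range d \<subseteq> range c"
  shows False
proof -
  let ?QV = "c ` {i. Q i}"
  have fin: "finite ?QV" by (rule finite_subset[OF _ cyc_finite_range[OF cyc]]) auto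
  have cq: "card ?QV = cnt m Q" by (rule cnt_image[OF cyc]) simp
  let ?T = "{0..<m - 1}"
  let ?Tq = "{t \<in> ?T. d t \<in> ?QV \<or> d (t + 1) \<in> ?QV}"
  have cover: "card ?Tq \<le> 2 * cnt m Q" using cyc_cover[OF d fin] cq by simp
  have m41: "4 \<le> m - 1" using m5 by simp
  have inner: "\<exists>i. {d t, d (t + 1)} = {c i, c (i - 3)} \<and> ?QV = {c (i - 1), c (i - 2)} \<and>
      (I i \<and> I (i - 3) \<or> J i \<and> J (i - 3))" if t: "t \<in> ?T - ?Tq" for t
  proof -
    obtain i j where ij: "d t = c i" "d (t + 1) = c j" "adj G (c i) (c j)"
      "Q i \<or> Q j \<or> (I i \<and> I j \<and> \<not> J i \<and> \<not> J j) \<or> (J i \<and> J j \<and> \<not> I i \<and> \<not> I j)"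
      by (rule edge_cases[OF d rd])
    have "\<not> Q i" "\<not> Q j" using t ij(1,2) by auto
    then consider "I i" "I j" | "J i" "J j" using ij(4) by blast
    then show ?thesis
    proof cases
      case 1
      then have "c j = c (i - 3) \<and> ?QV = {c (i - 1), c (i - 2)} \<or>
         c i = c (j - 3) \<and> ?QV = {c (j - 1), c (j - 2)}"
        using inner_chord[OF m5 noZ _ _ _ ij(3)] q2 cq by simp
      then show ?thesis
      proof
        assume a: "c j = c (i - 3) \<and> ?QV = {c (i - 1), c (i - 2)}"
        show ?thesis by (rule exI[of _ i]) (use a 1 ij(1,2) in simp)
      next
        assume a: "c i = c (j - 3) \<and> ?QV = {c (j - 1), c (j - 2)}"
        show ?thesis by (rule exI[of _ j]) (use a 1 ij(1,2) in \<open>simp add: insert_commute\<close>)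
      qed
    next
      case 2
      have noZ': "\<not> (J i \<and> I i)" for i using noZ[of i] by blast
      have sw: "{i. \<not> J i \<and> \<not> I i} = {i. Q i}" by auto
      have "c j = c (i - 3) \<and> ?QV = {c (i - 1), c (i - 2)} \<or>
         c i = c (j - 3) \<and> ?QV = {c (j - 1), c (j - 2)}"
        using outside_pair.inner_chord[OF swap m5 noZ' _ 2 ij(3)] q2 cq unfolding sw by simp
      then show ?thesis
      proof
        assume a: "c j = c (i - 3) \<and> ?QV = {c (i - 1), c (i - 2)}"
        show ?thesis by (rule exI[of _ i]) (use a 2 ij(1,2) in simp)
      next
        assume a: "c i = c (j - 3) \<and> ?QV = {c (j - 1), c (j - 2)}"
        show ?thesis by (rule exI[of _ j]) (use a 2 ij(1,2) in \<open>simp add: insert_commute\<close>)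
      qed
    qed
  qed
  \<comment> \<open>Both edges span the same two consecutive vertices, in the same order since
    \<open>m\<close> does not divide 2. So they are one edge, and it occurs at a single place of
    \<open>d\<close>.\<close>
  have uniq: "t = t'" if tt: "t \<in> ?T - ?Tq" "t' \<in> ?T - ?Tq" for t t'
  proof -
    obtain i where i: "{d t, d (t + 1)} = {c i, c (i - 3)}" "?QV = {c (i - 1), c (i - 2)}"
      using inner[OF tt(1)] by blast
    obtain j where j: "{d t', d (t' + 1)} = {c j, c (j - 3)}" "?QV = {c (j - 1), c (j - 2)}"
      using inner[OF tt(2)] by blast
    have "c (i - 1) = c (j - 1)"
    proof (rule ccontr)
      assume "c (i - 1) \<noteq> c (j - 1)"
      then have "c (i - 1) = c (j - 2)" "c (i - 2) = c (j - 1)"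
        using i(2) j(2) by (metis doubleton_eq_iff)+
      then have "m dvd (i - 1 - (j - 2))" "m dvd (i - 2 - (j - 1))" by (simp_all only: ceq_iff)
      then have "m dvd (i - 1 - (j - 2)) - (i - 2 - (j - 1))" by (rule dvd_diff)
      then have "m dvd 2" by simp
      then show False using zdvd_imp_le[of m 2] m5 by simp
    qed
    then have "c i = c j" "c (i - 3) = c (j - 3)"
      using cyc_cong[OF cyc, of "i - 1" "j - 1" 1] cyc_cong[OF cyc, of "i - 1" "j - 1" "-2"] by simp_all
    then have "{d t, d (t + 1)} = {d t', d (t' + 1)}" using i(1) j(1) by simp
    then have "d t = d t' \<or> d t = d (t' + 1) \<and> d (t + 1) = d t'" by (auto simp: doubleton_eq_iff)
    moreover have False if "d t = d (t' + 1) \<and> d (t + 1) = d t'"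
    proof -
      have "(m - 1) dvd (t + 1 - t')" "(m - 1) dvd (t - (t' + 1))"
        using that cyc_eq[OF d] by (simp_all only: mod_eq_dvd_iff)
      then have "(m - 1) dvd (t + 1 - t') - (t - (t' + 1))" by (rule dvd_diff)
      then have "(m - 1) dvd 2" by simp
      then show False using zdvd_imp_le[of "m - 1" 2] m5 by simp
    qed
    ultimately have "d t = d t'" by blast
    then show "t = t'"
      using inj_onD[OF cyc_inj_window[OF d, of 0]] tt by auto
  qed
  have part: "card ?T \<le> card ?Tq + card (?T - ?Tq)"
    using card_Un_le[of ?Tq "?T - ?Tq"] by (metis (no_types, lifting) Un_Diff_cancel Un_absorb1 mem_Collect_eq subsetI)
  have cT: "int (card ?T) = m - 1" using m5 by simp
  have i1: "card (?T - ?Tq) \<le> 1"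
  proof -
    have f: "finite (?T - ?Tq)" by (rule finite_Diff) (rule finite_atLeastLessThan_int)
    have "card (?T - ?Tq) \<le> Suc 0"
      unfolding card_le_Suc0_iff_eq[OF f] by (intro ballI uniq)
    then show ?thesis by (simp only: One_nat_def)
  qed
  have two: "cnt m Q = 2" if tt: "t \<in> ?T - ?Tq" for t
  proof -
    obtain i where "?QV = {c (i - 1), c (i - 2)}" using inner[OF tt] by blast
    moreover have "c (i - 1) \<noteq> c (i - 2)" by (rule cneq) (use m5 in auto)
    ultimately show ?thesis using cq by simp
  qed
  \<comment> \<open>\<open>c (i + 1)\<close> and \<open>c (i + 2)\<close> form the arc opposite to
    the gap. Neither is in \<open>Q\<close>, so \<open>c (i + 2)\<close> sees the same one of
    \<open>r\<close>, \<open>s\<close> as \<open>c i\<close> does, and so does the next vertex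
    \<open>c (i + 3)\<close>, which is \<open>c (i - 3)\<close>.\<close>
  have six: False if tt: "t \<in> ?T - ?Tq" and m6: "m = 6" for t
  proof -
    obtain i where i: "?QV = {c (i - 1), c (i - 2)}" "I i \<and> I (i - 3) \<or> J i \<and> J (i - 3)"
      using inner[OF tt] by blast
    have ne: "c (i + 1) \<noteq> c (i - 1)" "c (i + 1) \<noteq> c (i - 2)" "c (i + 2) \<noteq> c (i - 1)" "c (i + 2) \<noteq> c (i - 2)"
      using cneq m6 by auto
    have "c (i + 1) \<notin> ?QV" "c (i + 2) \<notin> ?QV" unfolding i(1) using ne by auto
    then have nq: "\<not> Q (i + 1)" "\<not> Q (i + 2)" by auto
    have c3: "c (i + 2 + 1) = c (i - 3)" using per[of "i - 3"] m6 by (simp add: algebra_simps)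
    from i(2) show False
    proof
      assume "I i \<and> I (i - 3)"
      then have "I (i + 2)" using nq dist_two[of i] by auto
      then show False using no_consecutive[of "i + 2"] c3 \<open>I i \<and> I (i - 3)\<close> by simp
    next
      assume "J i \<and> J (i - 3)"
      then have "J (i + 2)" using nq dist_two'[of i] by auto
      then show False using no_consecutive'[of "i + 2"] c3 \<open>J i \<and> J (i - 3)\<close> by simp
    qed
  qed
  show False
  proof (cases "?T - ?Tq = {}")
    case True
    then have "m - 1 \<le> 2 * int (cnt m Q)" using part cover cT by (metis (no_types, lifting) add.right_neutral card.empty int_ops(7) le_trans of_nat_le_iff of_nat_numeral)
    then show False using q1 q2 m5 by (cases "m = 5") auto
  next
    case False
    then obtain t where t: "t \<in> ?T - ?Tq" by blast
    have "m - 1 \<le> 2 * int (cnt m Q) + 1" using part cover cT i1 by linarith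
    then have "m - 1 \<le> 5" using two[OF t] by simp
    then have "m = 5 \<or> m = 6" using m5 by presburger
    then show False using two[OF t] six[OF t] q1 by auto
  qed
qed

section \<open>The graph without \<open>r\<close> and \<open>s\<close>\<close>

lemma window_before:
  obtains k where "c k = c j" "k < b" "b - m \<le> k"
  using cyc_window_obtain[OF cyc, of "b - m" j] by (metis diff_add_cancel)

text \<open>The pairs of successors of neighbours of \<open>r\<close> in different classes are missing edges; one
  more missing pair comes from predecessors, since otherwise \<open>I\<close> would contain every other
  vertex.\<close>

lemma mixed_missing:
  assumes AB: "A \<union> B = range c" "A \<inter> B = {}"
    and bip: "\<And>i j. adj G (c i) (c j) \<Longrightarrow> c i \<in> A \<longleftrightarrow> c j \<in> B"
    and mix: "I i0" "c i0 \<in> A" "I j0" "c j0 \<in> B"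
  shows "cnt m I \<le> card {(a, b) \<in> A \<times> B. \<not> adj G a b}"
proof -
  let ?M = "{(a, b) \<in> A \<times> B. \<not> adj G a b}"
  have finAB: "finite A" "finite B" using cyc_finite_range[OF cyc] AB(1) by (metis finite_Un)+
  have alt: "c (i + 1) \<in> B \<longleftrightarrow> c i \<in> A" for i
    using bip[OF cyc_adj[OF cyc, of i]] by simp
  have cls: "c i \<in> B \<longleftrightarrow> c i \<notin> A" for i using AB by blast
  have alt': "c (i - 1) \<in> B \<longleftrightarrow> c i \<in> A" "c (i - 1) \<in> A \<longleftrightarrow> c i \<in> B" "c (i + 1) \<in> A \<longleftrightarrow> c i \<in> B" for i
    using alt[of "i - 1"] alt[of i] cls by auto
  let ?XA = "c ` {i. I i \<and> c i \<in> A}" and ?XB = "c ` {i. I i \<and> c i \<in> B}"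
  let ?SA = "(\<lambda>i. c (i + 1)) ` {i. I i \<and> c i \<in> A}" and ?SB = "(\<lambda>i. c (i + 1)) ` {i. I i \<and> c i \<in> B}"
  have cntI: "cnt m I = cnt m (\<lambda>i. I i \<and> c i \<in> A) + cnt m (\<lambda>i. I i \<and> c i \<in> B)"
  proof -
    have "cnt m (\<lambda>i. (I i \<and> c i \<in> A) \<or> (I i \<and> c i \<in> B)) =
        cnt m (\<lambda>i. I i \<and> c i \<in> A) + cnt m (\<lambda>i. I i \<and> c i \<in> B)"
      by (rule cnt_add) (use cls in auto)
    moreover have "(\<lambda>i. (I i \<and> c i \<in> A) \<or> (I i \<and> c i \<in> B)) = I" using cls by auto
    ultimately show ?thesis by simp
  qed
  have cS: "cyc G m (\<lambda>i. c (i + 1))" by (rule cyc_shift[OF cyc])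
  have perc: "c (i + m + 1) = c (i + 1)" for i using per[of "i + 1"] by (simp add: algebra_simps)
  have cardS: "card ?SA = cnt m (\<lambda>i. I i \<and> c i \<in> A)" "card ?SB = cnt m (\<lambda>i. I i \<and> c i \<in> B)"
    by (rule cnt_image[OF cS], simp)+
  have finS: "finite ?SA" "finite ?SB"
    by (rule finite_subset[OF _ cyc_finite_range[OF cyc]]; auto)+
  have pos: "1 \<le> card ?SA" "1 \<le> card ?SB"
    using finS mix by (simp_all add: Suc_le_eq card_gt_0_iff) blast+
  \<comment> \<open>The cycle alternates between the classes, so successors of neighbours in
    \<open>B\<close> lie in \<open>A\<close> and conversely.\<close>
  have sub: "?SB \<times> ?SA \<subseteq> ?M"
  proof
    fix p assume "p \<in> ?SB \<times> ?SA"
    then obtain i j where ij: "p = (c (j + 1), c (i + 1))" "I i" "c i \<in> A" "I j" "c j \<in> B" by auto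
    have "c j \<noteq> c i" using ij(3,5) cls by metis
    then show "p \<in> ?M" using ij alt alt' succ_indep[of j i] by simp
  qed
  obtain i1 where i1: "I i1" "c i1 \<in> A" "\<not> I (i1 - 2)"
  proof (rule ccontr)
    assume "\<not> thesis"
    then have down: "I (i - 2)" if "I i" "c i \<in> A" for i using that \<open>\<And>i1. I i1 \<Longrightarrow> c i1 \<in> A \<Longrightarrow> \<not> I (i1 - 2) \<Longrightarrow> thesis\<close> by blast
    have twoA: "c (i - 2) \<in> A \<longleftrightarrow> c i \<in> A" for i
      using alt'(2)[of "i - 1"] alt'(1)[of i] by (simp add: algebra_simps)
    have all: "I (i0 - 2 * int k) \<and> c (i0 - 2 * int k) \<in> A" for k
    proof (induction k)
      case (Suc k)
      then show ?case using down[of "i0 - 2 * int k"] twoA[of "i0 - 2 * int k"]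
        by (simp add: algebra_simps)
    qed (use mix in simp)
    obtain j where j: "c j = c j0" "j < i0" by (rule window_before[of j0 i0]) auto
    have j1: "c (j + 1) \<in> A" using alt' j mix by simp
    define k where "k = nat ((i0 - (j + 1)) div 2)"
    have "i0 - 2 * int k = j + 1 \<or> i0 - 2 * int k = j + 2" using j(2) unfolding k_def by auto
    moreover have "c (j + 2) \<notin> A" using alt[of "j + 1"] j1 cls by (simp add: add.assoc)
    ultimately have "I (j + 1)" using all[of k] by auto
    then show False using no_consecutive[of j] j(1) mix(3) by simp
  qed
  \<comment> \<open>This pair is outside the product: if \<open>c (i1 - 1)\<close> were the
    successor of a neighbour of \<open>r\<close>, that neighbour would be
    \<open>c (i1 - 2)\<close>.\<close>
  let ?p = "(c (j0 - 1), c (i1 - 1))"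
  have "c j0 \<noteq> c i1" using mix(4) i1(2) cls by metis
  then have pM: "?p \<in> ?M" using alt' mix i1 pred_indep[of j0 i1] by simp
  have pn: "?p \<notin> ?SB \<times> ?SA"
  proof
    assume "?p \<in> ?SB \<times> ?SA"
    then obtain i where i: "c (i1 - 1) = c (i + 1)" "I i" by auto
    have "c (i1 - 1 + - 1) = c (i + 1 + - 1)" by (rule cyc_cong[OF cyc i(1)])
    then show False using i(2) i1(3) by simp
  qed
  have "finite ?M" by (rule finite_subset[of _ "A \<times> B"]) (use finAB in auto)
  then have "card (insert ?p (?SB \<times> ?SA)) \<le> card ?M" by (rule card_mono) (use sub pM in blast)
  then have "card ?SB * card ?SA + 1 \<le> card ?M" using pn finS by (simp add: card_cartesian_product)
  then show ?thesis using product_lower[OF pos(2,1)] cntI cardS by simp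
qed

lemma half_bound: "2 * int (cnt m I) \<le> m"
proof -
  have "cnt m (\<lambda>i. I i \<or> I (i + 1)) = cnt m I + cnt m (\<lambda>i. I (i + 1))"
    by (rule cnt_add) (rule no_consecutive)
  moreover have "cnt m (\<lambda>i. I (i + 1)) = cnt m I"
    by (rule cnt_shift[OF m0, where P = I]) simp
  moreover have "cnt m (\<lambda>i. I i \<or> I (i + 1)) \<le> cnt m (\<lambda>i. True)" by (rule cnt_mono) simp
  ultimately show ?thesis using cnt_True[of m] m0 by simp
qed

lemma half_bound': "2 * int (cnt m J) \<le> m"
  using outside_pair.half_bound[OF swap] .

lemma nbh_r:
  assumes "verts G = insert r (insert s (range c))"
  shows "nbh G r = insert s (c ` {i. I i})" "card (nbh G r) = cnt m I + 1"
proof -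
  show eq: "nbh G r = insert s (c ` {i. I i})"
    unfolding nbh_def using rs adj_in(2,3)[OF simple, of r] assms by auto
  have fin: "finite (c ` {i. I i})" by (rule finite_subset[OF _ cyc_finite_range[OF cyc]]) auto
  have "card (c ` {i. I i}) = cnt m I" by (rule cnt_image[OF cyc]) simp
  moreover have "s \<notin> c ` {i. I i}" using s_out by auto
  ultimately show "card (nbh G r) = cnt m I + 1" unfolding eq using fin by simp
qed

lemma nbh_s:
  assumes "verts G = insert r (insert s (range c))"
  shows "nbh G s = insert r (c ` {i. J i})" "card (nbh G s) = cnt m J + 1"
  using outside_pair.nbh_r[OF swap] assms by (simp_all add: insert_commute)

lemma edges_H:
  assumes "verts G = insert r (insert s (range c))"
  shows "card (edges G) = card (edges (del G {r, s})) + cnt m I + cnt m J + 1"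
proof -
  have "nbh (del G {r}) s = nbh G s - {r}"
    using adj_in(3)[OF simple rs] by (auto simp: nbh_def)
  moreover have "r \<in> nbh G s" using nbh_s(1)[OF assms] by simp
  ultimately have "card (nbh (del G {r}) s) = cnt m J"
    using nbh_s(2)[OF assms] finite_nbh[OF simple, of s] by simp
  then show ?thesis
    using edges_del_vertex[OF simple, of r] edges_del_vertex[OF del_simple[OF simple], of "{r}" s]
      nbh_r(2)[OF assms] by (simp add: del_del insert_commute)
qed

text \<open>If the rest is bipartite, the cycle alternates, so m = 2 k with classes of size k, and
  the size bound leaves at most k - 1 - \<delta> missing pairs. Each of \<open>r\<close> and
  \<open>s\<close> has at most k neighbours on the cycle, hence at least k - \<delta>. By
  \<open>mixed_missing\<close> the neighbours of each lie in one class, and \<open>c (- 1)\<close>,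
  \<open>c 0\<close> show that the two classes differ; the bipartition extends to
  \<open>G\<close>.\<close>

lemma H_not_bipartite:
  assumes V: "verts G = insert r (insert s (range c))" and nb: "\<not> bipartite G"
    and I1: "I (- 1)" and J0: "J 0"
    and deg: "int (cnt m I) + int (cnt m J) = m - \<delta>"
    and size: "(nat m - 1)\<^sup>2 div 4 + 2 + nat \<delta> \<le> card (edges (del G {r, s})) + 1" "1 \<le> \<delta>"
  shows "\<not> bipartite (del G {r, s})"
proof
  let ?H = "del G {r, s}"
  assume "bipartite ?H"
  then obtain A' B' where AB': "A' \<union> B' = verts ?H" "A' \<inter> B' = {}" "\<And>u v. adj ?H u v \<Longrightarrow> u \<in> A' \<longleftrightarrow> v \<in> B'"
    using bipartite_adj[OF del_simple[OF simple]] by metis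
  have vH: "verts ?H = range c" using V r_out s_out by auto
  obtain A B where AB: "A \<union> B = range c" "A \<inter> B = {}" "\<And>u v. adj ?H u v \<Longrightarrow> u \<in> A \<longleftrightarrow> v \<in> B"
    and c1: "c (- 1) \<in> A"
  proof (cases "c (- 1) \<in> A'")
    case True
    then show thesis using that[of A' B'] AB' vH by auto
  next
    case False
    have "u \<in> B' \<longleftrightarrow> v \<in> A'" if "adj ?H u v" for u v
      using AB'(3)[OF that[THEN adj_sym[THEN iffD1]]] by blast
    then show thesis using that[of B' A'] False AB'(1,2) vH by blast
  qed
  have inR: "c i \<notin> {r, s}" for i using r_out s_out by auto
  have bip: "c i \<in> A \<longleftrightarrow> c j \<in> B" if "adj G (c i) (c j)" for i j
    using AB(3)[of "c i" "c j"] that inR[of i] inR[of j] by simp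
  have cls: "c i \<in> B \<longleftrightarrow> c i \<notin> A" for i using AB by blast
  have alt: "c (i + 1) \<in> B \<longleftrightarrow> c i \<in> A" for i
    using bip[OF cyc_adj[OF cyc, of i]] by simp
  have cA: "card A = cnt m (\<lambda>i. c i \<in> A)" "card B = cnt m (\<lambda>i. c i \<in> B)"
  proof -
    have "A = c ` {i. c i \<in> A}" "B = c ` {i. c i \<in> B}" using AB(1) by auto
    moreover have "card (c ` {i. c i \<in> A}) = cnt m (\<lambda>i. c i \<in> A)" "card (c ` {i. c i \<in> B}) = cnt m (\<lambda>i. c i \<in> B)"
      by (rule cnt_image[OF cyc], simp)+
    ultimately show "card A = cnt m (\<lambda>i. c i \<in> A)" "card B = cnt m (\<lambda>i. c i \<in> B)" by metis+
  qed
  have "cnt m (\<lambda>i. c (i + 1) \<in> B) = cnt m (\<lambda>i. c i \<in> B)"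
    by (rule cnt_shift[OF m0, where P = "\<lambda>i. c i \<in> B"]) simp
  then have eqAB: "card B = card A" using cA alt by simp
  have "cnt m (\<lambda>i. c i \<in> A \<or> c i \<in> B) = cnt m (\<lambda>i. c i \<in> A) + cnt m (\<lambda>i. c i \<in> B)"
    by (rule cnt_add) (use cls in auto)
  moreover have "(\<lambda>i. c i \<in> A \<or> c i \<in> B) = (\<lambda>i. True)" using cls by auto
  ultimately have m2: "nat m = 2 * card A" using cA eqAB cnt_True[of m] by simp
  have miss: "card (edges ?H) + card {(a, b) \<in> A \<times> B. \<not> adj G a b} = card A * card A"
  proof -
    have "{(a, b) \<in> A \<times> B. \<not> adj ?H a b} = {(a, b) \<in> A \<times> B. \<not> adj G a b}"
    proof (rule set_eqI)
      fix p :: "'a \<times> 'a"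
      obtain a b where p: "p = (a, b)" by (cases p)
      have "a \<in> A \<Longrightarrow> a \<noteq> r \<and> a \<noteq> s" "b \<in> B \<Longrightarrow> b \<noteq> r \<and> b \<noteq> s"
        using AB(1) r_out s_out by blast+
      then show "p \<in> {(a, b) \<in> A \<times> B. \<not> adj ?H a b} \<longleftrightarrow> p \<in> {(a, b) \<in> A \<times> B. \<not> adj G a b}"
        unfolding p by auto
    qed
    then show ?thesis
      using bip_edges[OF del_simple[OF simple], of A B "{r, s}"] AB vH eqAB by simp
  qed
  have sz: "card {(a, b) \<in> A \<times> B. \<not> adj G a b} + 1 + nat \<delta> \<le> card A"
    using miss size m2 square_div4_even[of "card A"] by simp
  have sw: "card {(b, a) \<in> B \<times> A. \<not> adj G b a} = card {(a, b) \<in> A \<times> B. \<not> adj G a b}"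
  proof (rule bij_betw_same_card[where f = prod.swap])
    show "bij_betw prod.swap {(b, a) \<in> B \<times> A. \<not> adj G b a} {(a, b) \<in> A \<times> B. \<not> adj G a b}"
      by (rule bij_betw_byWitness[where f' = prod.swap]) (auto simp: adj_sym[of G])
  qed
  have hb: "int (cnt m I) \<le> int (card A)" "int (cnt m J) \<le> int (card A)"
    using half_bound half_bound' m2 m0 by linarith+
  then have lo: "int (card A) - \<delta> \<le> int (cnt m I)" "int (card A) - \<delta> \<le> int (cnt m J)"
    using deg m2 m0 by linarith+
  have unI: "c i \<in> A" if "I i" for i
  proof (rule ccontr)
    assume "c i \<notin> A"
    then have "cnt m I \<le> card {(a, b) \<in> A \<times> B. \<not> adj G a b}"
      using mixed_missing[OF AB(1,2) bip I1 c1 that] cls by blast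
    then show False using sz lo(1) size(2) by linarith
  qed
  have c0: "c 0 \<in> B" using alt[of "- 1"] c1 by simp
  have unJ: "c i \<in> B" if "J i" for i
  proof (rule ccontr)
    assume "c i \<notin> B"
    then have "cnt m J \<le> card {(a, b) \<in> A \<times> B. \<not> adj G a b}"
      using outside_pair.mixed_missing[OF swap AB(1,2) bip _ _ J0 c0, of i] that cls by blast
    then show False using sz lo(2) size(2) by linarith
  qed
  have "bipartite G"
  proof (rule bipartiteI_indep[OF simple])
    show "insert s A \<union> insert r B = verts G" using AB(1) V by auto
    have "s \<notin> B" "r \<notin> A" using AB(1) r_out s_out by blast+
    then show "insert s A \<inter> insert r B = {}" using AB(2) adj_in(3)[OF simple rs] by blast
    have noA: "\<not> adj G u v" if uv: "u \<in> A" "v \<in> A" for u v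
    proof -
      obtain i j where "u = c i" "v = c j" using uv AB(1) by blast
      then show ?thesis using bip cls uv by blast
    qed
    have noB: "\<not> adj G u v" if uv: "u \<in> B" "v \<in> B" for u v
    proof -
      obtain i j where "u = c i" "v = c j" using uv AB(1) by blast
      then show ?thesis using bip cls uv by blast
    qed
    have sA: "\<not> adj G s u" if uv: "u \<in> A" for u
    proof -
      obtain i where "u = c i" using uv AB(1) by blast
      then show ?thesis using unJ cls uv by blast
    qed
    have rB: "\<not> adj G r u" if uv: "u \<in> B" for u
    proof -
      obtain i where "u = c i" using uv AB(1) by blast
      then show ?thesis using unI cls uv by blast
    qed
    have irr: "\<not> adj G x x" for x using adj_in(3)[OF simple] by blast
    show "\<not> adj G u v" if "u \<in> insert s A" "v \<in> insert s A" for u v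
      using that noA sA irr adj_sym[of G u v] by blast
    show "\<not> adj G u v" if "u \<in> insert r B" "v \<in> insert r B" for u v
      using that noB rB irr adj_sym[of G u v] by blast
  qed
  then show False using nb by blast
qed

text \<open>This is the case \<delta> = 0. Each cycle vertex sees exactly one of \<open>r\<close>
  and \<open>s\<close>, and an edge inside one of the two sets would join successors of two
  neighbours of the other vertex.\<close>

lemma complementary_bipartite:
  assumes V: "verts G = insert r (insert s (range c))"
    and Q0: "cnt m Q = 0" and Z0: "cnt m Z = 0"
  shows "bipartite G"
proof -
  have emp: "\<not> P i" if "cnt m P = 0" "\<And>i. P (i + m) = P i" for P i
  proof
    assume "P i"
    have "card (c ` {i. P i}) = cnt m P" by (rule cnt_image[OF cyc]) (rule that(2))
    then have "card (c ` {i. P i}) = 0" using that(1) by simp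
    moreover have "finite (c ` {i. P i})" by (rule finite_subset[OF _ cyc_finite_range[OF cyc]]) auto
    ultimately show False using \<open>P i\<close> by simp
  qed
  have noQ: "\<not> Q i" for i by (rule emp[OF Q0]) simp
  have noZ: "\<not> Z i" for i by (rule emp[OF Z0]) simp
  have IJ: "J i \<longleftrightarrow> \<not> I i" for i using noQ[of i] noZ[of i] by blast
  have irr: "\<not> adj G x x" for x using adj_in(3)[OF simple] by blast
  have nI: "\<not> adj G (c i) (c j)" if "I i" "I j" for i j
  proof
    assume a: "adj G (c i) (c j)"
    have "J (i - 1)" "J (j - 1)"
      using no_consecutive[of "i - 1"] no_consecutive[of "j - 1"] that IJ by auto
    then show False using succ_indep'[of "i - 1" "j - 1"] a adj_in(3)[OF simple a]
      cyc_cong[OF cyc, of "i - 1" "j - 1" 1] by auto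
  qed
  have nJ: "\<not> adj G (c i) (c j)" if "J i" "J j" for i j
  proof
    assume a: "adj G (c i) (c j)"
    have "I (i - 1)" "I (j - 1)"
      using no_consecutive'[of "i - 1"] no_consecutive'[of "j - 1"] that IJ by auto
    then show False using succ_indep[of "i - 1" "j - 1"] a adj_in(3)[OF simple a]
      cyc_cong[OF cyc, of "i - 1" "j - 1" 1] by auto
  qed
  show ?thesis
  proof (rule bipartiteI_indep[OF simple])
    show "insert s (c ` {i. I i}) \<union> insert r (c ` {i. J i}) = verts G" using V IJ by auto
    show "insert s (c ` {i. I i}) \<inter> insert r (c ` {i. J i}) = {}"
      using r_out s_out adj_in(3)[OF simple rs] IJ by (auto dest: sym)
    show "\<not> adj G u v" if "u \<in> insert s (c ` {i. I i})" "v \<in> insert s (c ` {i. I i})" for u v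
      using that nI irr IJ adj_sym[of G u v] by auto
    show "\<not> adj G u v" if "u \<in> insert r (c ` {i. J i})" "v \<in> insert r (c ` {i. J i})" for u v
      using that nJ irr IJ adj_sym[of G u v] by auto
  qed
qed

text \<open>The bound drops by \<open>m\<close> and m - \<delta> + 1 edges are lost, so for \<delta>
  \<ge> 1 the induction hypothesis applies to the rest. The thresholds on \<open>m\<close> are those
  at which \<open>cover_bound\<close> excludes \<delta> = 3 and \<open>refined_bound\<close>
  excludes \<delta> = 2.\<close>

theorem pair_contradiction:
  assumes V: "verts G = insert r (insert s (range c))" and nb: "\<not> bipartite G"
    and I1: "I (- 1)" and J0: "J 0"
    and size: "(nat m + 1)\<^sup>2 div 4 + 2 \<le> card (edges G)"
    and deg: "int (card (nbh G r)) + int (card (nbh G s)) = m + 2 - \<delta>" "0 \<le> \<delta>" "\<delta> \<le> 3"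
    and m: "5 \<le> m" "2 \<le> \<delta> \<Longrightarrow> 6 \<le> m" "3 \<le> \<delta> \<Longrightarrow> 14 \<le> m"
    and IH: "\<not> bipartite (del G {r, s}) \<Longrightarrow> (nat m - 1)\<^sup>2 div 4 + 2 \<le> card (edges (del G {r, s})) \<Longrightarrow>
      \<exists>xs. is_cycle (del G {r, s}) xs \<and> int (length xs) = m - 1"
  shows False
proof -
  have IJ: "int (cnt m I) + int (cnt m J) = m - \<delta>"
    using deg(1) nbh_r(2)[OF V] nbh_s(2)[OF V] by simp
  have dQ: "int (cnt m Q) = \<delta> + int (cnt m Z)" using cnt_Q IJ by linarith
  show False
  proof (cases "\<delta> = 0")
    case True
    then have "cnt m Q = 0" "cnt m Z = 0" using dQ Z_le_Q by linarith+
    then show False using complementary_bipartite[OF V] nb by blast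
  next
    case False
    then have d1: "1 \<le> \<delta>" using deg(2) by simp
    have sz: "(nat m - 1)\<^sup>2 div 4 + 2 + nat \<delta> \<le> card (edges (del G {r, s})) + 1"
      using size edges_H[OF V] square_div4[of "nat m"] IJ d1 m(1) by linarith
    have "\<not> bipartite (del G {r, s})"
      by (rule H_not_bipartite[OF V nb I1 J0 IJ sz d1])
    then obtain xs where xs: "is_cycle (del G {r, s}) xs" "int (length xs) = m - 1"
      using IH sz d1 by force
    obtain d where d: "cyc (del G {r, s}) (m - 1) d"
      using is_cycle_imp_cyc[OF xs(1)] xs(2) by metis
    then have dG: "cyc G (m - 1) d" and rd: "range d \<inter> {r, s} = {}" unfolding cyc_del by auto
    have rd': "range d \<subseteq> range c"
    proof
      fix v assume v: "v \<in> range d"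
      then have "v \<in> verts G" using cyc_rangeI[OF simple dG] by auto
      then show "v \<in> range c" using V rd v by blast
    qed
    \<comment> \<open>|Q| - |Z| equals \<delta>. For \<delta> = 3 the right side is 12, whereas
      \<open>m - 1\<close> is at least 13.\<close>
    have cb: "m - 1 \<le> 4 * \<delta>" using cover_bound[OF dG rd'] dQ by simp
    then have d2: "\<delta> \<le> 2" using m(3) deg(3) by force
    have nz: "\<not> Z i" for i by (rule no_Z[OF m(1) I1 J0 dQ d2])
    have "{i \<in> {0..<m}. Z i} = {}" using nz by blast
    then have "cnt m Z = 0" unfolding cnt_def by (simp only: card.empty)
    then have q: "int (cnt m Q) = \<delta>" using dQ by simp
    have "\<not> 2 \<le> \<delta>" if "m = 5" using m(2) that by auto
    then have q1: "cnt m Q \<le> 1" if "m = 5" using q that by linarith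
    have q2: "cnt m Q \<le> 2" using q d2 by linarith
    show False by (rule refined_bound[OF m(1) nz q2 q1 dG rd'])
  qed
qed

end

section \<open>Hamiltonian graphs\<close>

lemma cyc_imp_cycle:
  assumes "simple_graph G" "cyc G m c"
  shows "is_cycle G (seg c 0 (m - 1))" "set (seg c 0 (m - 1)) = range c" "int (length (seg c 0 (m - 1))) = m"
proof -
  have m: "3 \<le> m" using assms(2) unfolding cyc_def by linarith
  show "is_cycle G (seg c 0 (m - 1))"
  proof (rule is_cycle_successively[OF assms(1)])
    show "distinct (seg c 0 (m - 1))" by (rule distinct_seg[OF assms(2)]) simp
    show "successively (adj G) (seg c 0 (m - 1))" by (rule successively_seg[OF assms(2)])
    have "adj G (c (m - 1)) (c 0)"
      using cyc_adj[OF assms(2), of "m - 1"] cyc_period[OF assms(2), of 0] by simp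
    then show "adj G (last (seg c 0 (m - 1))) (hd (seg c 0 (m - 1)))"
      using m by (simp add: hd_seg last_seg)
  qed (use m in simp)
  have "{0..m - 1} = {0..<0 + m}" by auto
  then show "set (seg c 0 (m - 1)) = range c" using cyc_range_window[OF assms(2), of 0] by simp
  show "int (length (seg c 0 (m - 1))) = m" using m by simp
qed

lemma square_div4_lower: "k\<^sup>2 \<le> 4 * (k\<^sup>2 div 4) + (1::nat)"
proof (cases "even k")
  case True
  then obtain j where "k = 2 * j" by blast
  then show ?thesis by (simp add: power2_eq_square)
next
  case False
  then obtain j where "k = 2 * j + 1" by (rule oddE)
  then have "k\<^sup>2 = 4 * (j * j + j) + 1" by (simp add: power2_eq_square algebra_simps)
  then show ?thesis by presburger
qed

lemma degree_sum_cycle: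
  assumes G: "simple_graph G" "cyc G N c" "range c = verts G"
  shows "(\<Sum>i\<in>{0..<N}. int (card (nbh G (c i)))) = 2 * int (card (edges G))"
proof -
  have "(\<Sum>i\<in>{0..<N}. int (card (nbh G (c i)))) = (\<Sum>v\<in>c ` {0..<N}. int (card (nbh G v)))"
    using sum.reindex[OF cyc_inj_window[OF G(2), of 0], of "\<lambda>v. int (card (nbh G v))"] by simp
  also have "c ` {0..<N} = verts G" using cyc_range_window[OF G(2), of 0] G(3) by simp
  finally show ?thesis using handshake[OF G(1)] by (metis of_nat_mult of_nat_numeral of_nat_sum)
qed

lemma degree_cycle:
  assumes G: "simple_graph G" "cyc G N c" "range c = verts G"
  shows "int (card (nbh G (c i))) = (\<Sum>k\<in>{1..N - 1}. of_bool (adj G (c i) (c (i + k))))"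
proof -
  let ?K = "{k \<in> {1..N - 1}. adj G (c i) (c (i + k))}"
  have "nbh G (c i) = (\<lambda>k. c (i + k)) ` ?K"
  proof
    show "nbh G (c i) \<subseteq> (\<lambda>k. c (i + k)) ` ?K"
    proof
      fix v assume v: "v \<in> nbh G (c i)"
      then have a: "adj G (c i) v" by (simp add: nbh_def)
      have "v \<in> range c" using adj_in(2)[OF G(1) a] G(3) by simp
      then obtain j0 where "v = c j0" by blast
      then obtain j where j: "i \<le> j" "j < i + N" "c j = v"
        using cyc_window_obtain[OF G(2), of i j0] by metis
      have "j \<noteq> i" using adj_in(3)[OF G(1) a] j(3) by auto
      then have "j - i \<in> ?K" using j a by auto
      then show "v \<in> (\<lambda>k. c (i + k)) ` ?K" by (rule rev_image_eqI) (simp add: j)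
    qed
  qed (auto simp: nbh_def)
  moreover have "inj_on (\<lambda>k. c (i + k)) ?K"
  proof (rule inj_onI)
    fix x y assume xy: "x \<in> ?K" "y \<in> ?K" "c (i + x) = c (i + y)"
    then show "x = y"
      using cyc_neq[OF G(2), of "i + x" "i + y"] cyc_neq[OF G(2), of "i + y" "i + x"]
      by (cases "x < y"; cases "y < x") auto
  qed
  ultimately have "card (nbh G (c i)) = card ?K" by (simp add: card_image)
  also have "int (card ?K) = (\<Sum>k\<in>{1..N - 1}. if adj G (c i) (c (i + k)) then 1 else 0)"
    by (simp add: sum.If_cases Int_def)
  finally show ?thesis by (simp add: of_bool_def)
qed

text \<open>The average over the indices with \<open>C k = 1\<close> is cleared of its denominator.
  Over the integers, exceeding it means exceeding it by at least one, which explains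
  \<open>?S + 1\<close> in the proof.\<close>

lemma exists_le_average:
  fixes f C :: "int \<Rightarrow> int"
  assumes "finite W" "\<And>k. C k = 0 \<or> C k = 1" "0 < (\<Sum>k\<in>W. C k)"
  shows "\<exists>k\<in>W. C k = 1 \<and> f k * (\<Sum>k\<in>W. C k) \<le> (\<Sum>k\<in>W. C k * f k)"
proof (rule ccontr)
  let ?g = "\<Sum>k\<in>W. C k" and ?S = "\<Sum>k\<in>W. C k * f k"
  assume "\<not> ?thesis"
  then have a: "C k * (?S + 1) \<le> C k * (f k * ?g)" if "k \<in> W" for k
    using assms(2)[of k] that by force
  have "?g * (?S + 1) = (\<Sum>k\<in>W. C k * (?S + 1))" by (rule sum_distrib_right)
  also have "\<dots> \<le> (\<Sum>k\<in>W. C k * (f k * ?g))" by (rule sum_mono) (rule a)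
  also have "\<dots> = ?S * ?g" unfolding sum_distrib_right by (simp add: mult.assoc)
  finally show False using assms(3) by (simp add: algebra_simps)
qed

text \<open>The cross rule makes the chords from \<open>c i\<close> and \<open>c (i - 1)\<close> compete, and \<open>\<beta> i\<close> counts the
  places where neither is present. Summing over the cycle, the size bound leaves room for only
  \<open>2 g - 8\<close> such places, where \<open>g\<close> is the number of chords of span three; \<open>k\<close> is a chord whose
  deficiency is at most the average over these \<open>g\<close> chords.\<close>

lemma good_short_chord:
  fixes N :: int
  assumes G: "simple_graph G" "cyc G N c" "range c = verts G" and N7: "7 \<le> N"
    and no_cycle: "\<And>xs. is_cycle G xs \<Longrightarrow> int (length xs) \<noteq> N - 1"
    and size: "N * N - 2 * N + 8 \<le> 4 * int (card (edges G))"
  obtains k \<delta> where "adj G (c k) (c (k + 3))" "0 \<le> \<delta>" "\<delta> \<le> 3" "2 \<le> \<delta> \<Longrightarrow> 8 \<le> N" "3 \<le> \<delta> \<Longrightarrow> 16 \<le> N"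
    "int (card (nbh G (c (k + 1)))) + int (card (nbh G (c (k + 2)))) = N - \<delta>"
proof -
  let ?W = "{0..<N}"
  have N0: "0 < N" using N7 by simp
  define A :: "int \<Rightarrow> int \<Rightarrow> int" where "A i k = of_bool (adj G (c i) (c (i + k)))" for i k
  have A01: "A i k = 0 \<or> A i k = 1" for i k unfolding A_def by auto
  have per: "c (i + N) = c i" for i by (rule cyc_period[OF G(2)])
  have perA: "A (i + N) k = A i k" for i k
    unfolding A_def using per[of i] per[of "i + k"] by (simp add: algebra_simps)
  have no2: "\<not> adj G (c i) (c (i + 2))" for i
    using cyc_skip[OF G(1,2), of i] no_cycle[of "seg c (i + 2) (i + N)"] N7 by auto
  have cross: "\<not> (adj G (c i) (c (i + k)) \<and> adj G (c (i - 1)) (c (i + k - 2)))"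
    if "3 \<le> k" "k \<le> N - 1" for i k
    using cyc_cross[OF G(1,2) that, of i] no_cycle by blast
  have A1: "A i 1 = 1" for i unfolding A_def using cyc_adj[OF G(2)] by simp
  have A2: "A i 2 = 0" for i unfolding A_def using no2 by simp
  have AN1: "A i (N - 1) = 1" for i
  proof -
    have "c (i + (N - 1)) = c (i - 1)" using per[of "i - 1"] by (simp add: algebra_simps)
    moreover have "adj G (c i) (c (i - 1))"
      using cyc_adj[OF G(2), of "i - 1"] by (simp add: adj_sym[of G "c i"])
    ultimately show ?thesis unfolding A_def by simp
  qed
  have AN2: "A i (N - 2) = 0" for i
  proof -
    have "c (i + (N - 2)) = c (i - 2)" using per[of "i - 2"] by (simp add: algebra_simps)
    moreover have "\<not> adj G (c i) (c (i - 2))"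
      using no2[of "i - 2"] by (simp add: adj_sym[of G "c i"])
    ultimately show ?thesis unfolding A_def by simp
  qed
  have AN3: "A (i - 1) (N - 3) = A (i - 4) 3" for i
  proof -
    have "c (i - 1 + (N - 3)) = c (i - 4)" using per[of "i - 4"] by (simp add: algebra_simps)
    moreover have "c (i - 4 + 3) = c (i - 1)" by simp
    ultimately show ?thesis unfolding A_def by (simp only: adj_sym[of G "c (i - 1)"])
  qed
  define D where "D i = int (card (nbh G (c i)))" for i
  define T where "T i = (\<Sum>k\<in>{4..N - 3}. A i k)" for i
  define T' where "T' i = (\<Sum>k\<in>{4..N - 3}. A i (k - 1))" for i
  \<comment> \<open>Offsets 1 and \<open>N - 1\<close> are cycle edges; 2 and \<open>N - 2\<close>
    would skip a vertex. \<open>DT\<close> splits off offset 3 and \<open>DT'\<close> offset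
    \<open>N - 3\<close>, so that the remaining offsets of \<open>c i\<close> and of
    \<open>c (i - 1)\<close> are paired by the cross rule.\<close>
  have DT: "D i = 2 + A i 3 + T i" for i
  proof -
    have set: "{1..N - 1} = insert 1 (insert 2 (insert 3 (insert (N - 2) (insert (N - 1) {4..N - 3}))))"
      using N7 by auto
    have "D i = (\<Sum>k\<in>{1..N - 1}. A i k)" unfolding D_def A_def by (rule degree_cycle[OF G])
    also have "\<dots> = A i 1 + (A i 2 + (A i 3 + (A i (N - 2) + (A i (N - 1) + T i))))"
      unfolding set T_def using N7 by simp
    finally show ?thesis using A1 A2 AN1 AN2 by simp
  qed
  have DT': "D i = 2 + A i (N - 3) + T' i" for i
  proof -
    have re: "T' i = (\<Sum>k\<in>{3..N - 4}. A i k)"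
      unfolding T'_def
      by (rule sum.reindex_bij_witness[where i = "\<lambda>k. k + 1" and j = "\<lambda>k. k - 1"]) auto
    have set: "{1..N - 1} = insert 1 (insert 2 (insert (N - 3) (insert (N - 2) (insert (N - 1) {3..N - 4}))))"
      using N7 by auto
    have "D i = (\<Sum>k\<in>{1..N - 1}. A i k)" unfolding D_def A_def by (rule degree_cycle[OF G])
    also have "\<dots> = A i 1 + (A i 2 + (A i (N - 3) + (A i (N - 2) + (A i (N - 1) + T' i))))"
      unfolding set re using N7 by simp
    finally show ?thesis using A1 A2 AN1 AN2 by simp
  qed
  define \<beta> where "\<beta> i = (\<Sum>k\<in>{4..N - 3}. 1 - A i k - A (i - 1) (k - 1))" for i
  have \<beta>0: "0 \<le> \<beta> i" for i
    unfolding \<beta>_def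
  proof (rule sum_nonneg)
    fix k assume k: "k \<in> {4..N - 3}"
    then have "\<not> (adj G (c i) (c (i + k)) \<and> adj G (c (i - 1)) (c (i - 1 + (k - 1))))"
      using cross[of k i] by (simp add: algebra_simps)
    then show "0 \<le> 1 - A i k - A (i - 1) (k - 1)" unfolding A_def by auto
  qed
  have \<beta>T: "\<beta> i = (N - 6) - T i - T' (i - 1)" for i
    unfolding \<beta>_def T_def T'_def using N7 by (simp add: sum_subtractf)
  define C where "C k = A k 3" for k
  have C01: "C k = 0 \<or> C k = 1" for k unfolding C_def by (rule A01)
  have pair: "D i + D (i - 1) = N - 2 + C i + C (i - 4) - \<beta> i" for i
    using DT[of i] DT'[of "i - 1"] \<beta>T[of i] AN3[of i] unfolding C_def by linarith
  have perC: "C (i + N) = C i" for i unfolding C_def by (rule perA)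
  have perD: "D (i + N) = D i" for i unfolding D_def using per by simp
  have shD: "(\<Sum>i\<in>?W. D (i + -1)) = (\<Sum>i\<in>?W. D i)" by (rule sum_window_shift[OF N0]) (rule perD)
  have sumD: "(\<Sum>i\<in>?W. D i) = 2 * int (card (edges G))"
    unfolding D_def by (rule degree_sum_cycle[OF G])
  define g where "g = (\<Sum>k\<in>?W. C k)"
  have sh4: "(\<Sum>i\<in>?W. C (i + -4)) = g" unfolding g_def by (rule sum_window_shift[OF N0]) (rule perC)
  have sh2: "(\<Sum>i\<in>?W. C (i + 2)) = g" unfolding g_def by (rule sum_window_shift[OF N0]) (rule perC)
  have "(\<Sum>i\<in>?W. D i) + (\<Sum>i\<in>?W. D (i + -1)) = (\<Sum>i\<in>?W. N - 2 + C i + C (i + -4) - \<beta> i)"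
    unfolding sum.distrib[symmetric] by (rule sum.cong[OF refl]) (use pair in simp)
  also have "\<dots> = N * (N - 2) + g + g - (\<Sum>i\<in>?W. \<beta> i)"
    using N0 sh4 unfolding g_def by (simp add: sum.distrib sum_subtractf)
  finally have "4 * int (card (edges G)) = N * (N - 2) + 2 * g - (\<Sum>i\<in>?W. \<beta> i)"
    using shD sumD by linarith
  then have sum\<beta>: "(\<Sum>i\<in>?W. \<beta> i) \<le> 2 * g - 8"
    using size by (simp add: algebra_simps)
  have per\<beta>: "\<beta> (i + N) = \<beta> i" for i
    using pair[of i] pair[of "i + N"] perD[of i] perD[of "i - 1"] perC[of i] perC[of "i - 4"]
    by (simp add: algebra_simps)
  have g4: "4 \<le> g" using sum\<beta> sum_nonneg[of ?W \<beta>] \<beta>0 by simp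
  \<comment> \<open>\<open>p\<close> counts the pairs of span-three chords whose starts differ by
    two. Such a companion chord raises the degree sum of the skipped pair, so it lowers the
    deficiency \<delta> defined below.\<close>
  define p where "p = (\<Sum>k\<in>?W. C k * C (k + 2))"
  have p': "(\<Sum>k\<in>?W. C k * C (k - 2)) = p"
  proof -
    have "(\<Sum>k\<in>?W. C (k + 2) * C (k + 2 - 2)) = (\<Sum>k\<in>?W. C k * C (k - 2))"
      by (rule sum_window_shift[OF N0, where f = "\<lambda>k. C k * C (k - 2)"])
        (metis perC add.commute add_diff_eq)
    then show ?thesis unfolding p_def by (simp add: mult.commute)
  qed
  define \<delta> where "\<delta> k = 2 - C (k + 2) - C (k - 2) + \<beta> (k + 2)" for k
  have sh\<beta>: "(\<Sum>i\<in>?W. \<beta> (i + 2)) = (\<Sum>i\<in>?W. \<beta> i)" by (rule sum_window_shift[OF N0]) (rule per\<beta>)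
  have "(\<Sum>k\<in>?W. C k * \<delta> k) = (\<Sum>k\<in>?W. 2 * C k - C k * C (k + 2) - C k * C (k - 2) + C k * \<beta> (k + 2))"
    by (rule sum.cong) (simp_all add: \<delta>_def algebra_simps)
  also have "\<dots> = 2 * g - p - p + (\<Sum>k\<in>?W. C k * \<beta> (k + 2))"
    unfolding p_def[symmetric] g_def
    by (simp add: sum.distrib sum_subtractf sum_distrib_left p' flip: p_def)
  finally have eq: "(\<Sum>k\<in>?W. C k * \<delta> k) = 2 * g - p - p + (\<Sum>k\<in>?W. C k * \<beta> (k + 2))" .
  have "(\<Sum>k\<in>?W. C k * \<beta> (k + 2)) \<le> (\<Sum>k\<in>?W. \<beta> (k + 2))"
  proof (rule sum_mono)
    fix k show "C k * \<beta> (k + 2) \<le> \<beta> (k + 2)" using C01[of k] \<beta>0[of "k + 2"] by auto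
  qed
  \<comment> \<open>The deficiencies sum to 2 g - 2 p plus at most the sum of \<beta>, which is at
    most 2 g - 8.\<close>
  then have tot: "(\<Sum>k\<in>?W. C k * \<delta> k) \<le> 4 * g - 2 * p - 8"
    using eq sh\<beta> sum\<beta> by linarith
  have wg: "0 \<le> p" unfolding p_def
    using sum_nonneg[of ?W "\<lambda>k. C k * C (k + 2)"] C01 by (smt (verit) mult_nonneg_nonneg)
  \<comment> \<open>The chord starts and their shift by two are sets of \<open>g\<close> indices
    each among \<open>N\<close> indices, with \<open>p\<close> in common.\<close>
  have wN: "2 * g \<le> N + p"
  proof -
    have "(\<Sum>k\<in>?W. C k - C k * C (k + 2)) \<le> (\<Sum>k\<in>?W. 1 - C (k + 2))"
    proof (rule sum_mono)
      fix k show "C k - C k * C (k + 2) \<le> 1 - C (k + 2)" using C01[of k] C01[of "k + 2"] by auto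
    qed
    then show ?thesis using sh2 N0 unfolding p_def g_def by (simp add: sum_subtractf)
  qed
  obtain k where k: "C k = 1" "\<delta> k * g \<le> 4 * g - 2 * p - 8"
    using exists_le_average[of ?W C \<delta>] C01 g4 tot unfolding g_def by fastforce
  have d0: "0 \<le> \<delta> k" unfolding \<delta>_def using C01[of "k + 2"] C01[of "k - 2"] \<beta>0[of "k + 2"] by linarith
  have mono: "x * g \<le> 4 * g - 2 * p - 8" if "x \<le> \<delta> k" for x
    using mult_right_mono[OF that, of g] g4 k(2) by linarith
  \<comment> \<open>A deficiency of 4 would give 4 g \<le> 4 g - 2 p - 8. From \<delta> \<ge> 2
    follows 2 g \<ge> 2 p + 8, from \<delta> \<ge> 3 follows 2 g \<ge> 4 p + 16; against 2 g \<le> N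
    + p this means N \<ge> 8 and N \<ge> 16.\<close>
  have d3: "\<delta> k \<le> 3" using mono[of 4] wg by linarith
  have d8: "8 \<le> N" if "2 \<le> \<delta> k" using mono[OF that] wg wN g4 by linarith
  have d16: "16 \<le> N" if "3 \<le> \<delta> k" using mono[OF that] wg wN g4 by linarith
  have "adj G (c k) (c (k + 3))" using k(1) unfolding C_def A_def by (simp split: if_splits)
  moreover have "int (card (nbh G (c (k + 1)))) + int (card (nbh G (c (k + 2)))) = N - \<delta> k"
  proof -
    have e: "k + 2 - 1 = k + 1" "k + 2 - 4 = k - 2" by simp_all
    show ?thesis using pair[of "k + 2"] unfolding e D_def \<delta>_def by linarith
  qed
  ultimately show thesis using that d0 d3 d8 d16 by blast
qed

text \<open>Indices are normalised so that \<open>D 0\<close> is \<open>c (k + 3)\<close> and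
  \<open>D (- 1)\<close> is \<open>c k\<close>; the skipped vertices \<open>c (k + 1)\<close> and
  \<open>c (k + 2)\<close> are then adjacent to \<open>D (- 1)\<close> and \<open>D 0\<close>, as
  \<open>pair_contradiction\<close> requires.\<close>

lemma skip_two_cyc:
  fixes N :: int
  assumes "simple_graph G" "cyc G N c" "5 \<le> N" "adj G (c k) (c (k + 3))"
  defines "D \<equiv> \<lambda>i. c (k + 3 + i mod (N - 2))"
  shows "cyc G (N - 2) D" "range D = c ` {k + 3..k + N}"
proof -
  have m: "0 < N - 2" using assms(3) by simp
  have inj: "D i = D j \<longleftrightarrow> i mod (N - 2) = j mod (N - 2)" for i j
  proof -
    have b: "0 \<le> i mod (N - 2)" "i mod (N - 2) < N - 2" "0 \<le> j mod (N - 2)" "j mod (N - 2) < N - 2"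
      using m by simp_all
    show ?thesis unfolding D_def
      using cyc_neq[OF assms(2), of "k + 3 + i mod (N - 2)" "k + 3 + j mod (N - 2)"]
        cyc_neq[OF assms(2), of "k + 3 + j mod (N - 2)" "k + 3 + i mod (N - 2)"] b by force
  qed
  have adj: "adj G (D i) (D (i + 1))" for i
  proof (cases "i mod (N - 2) = N - 3")
    case True
    have "(i + 1) mod (N - 2) = (i mod (N - 2) + 1) mod (N - 2)" by (simp add: mod_add_left_eq)
    also have "\<dots> = 0" using True by simp
    finally have "D (i + 1) = c (k + 3)" unfolding D_def by simp
    moreover have "D i = c k" unfolding D_def using True cyc_period[OF assms(2), of k] by simp
    ultimately show ?thesis using assms(4) by simp
  next
    case False
    have b: "0 \<le> i mod (N - 2)" "i mod (N - 2) < N - 2" using m by simp_all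
    have "(i + 1) mod (N - 2) = (i mod (N - 2) + 1) mod (N - 2)" by (simp add: mod_add_left_eq)
    also have "\<dots> = i mod (N - 2) + 1" using False b by (intro mod_pos_pos_trivial) auto
    finally show ?thesis unfolding D_def by (intro cyc_adj'[OF assms(2)]) simp
  qed
  show "cyc G (N - 2) D" unfolding cyc_def using inj adj assms(3) by simp
  show "range D = c ` {k + 3..k + N}"
  proof
    show "range D \<subseteq> c ` {k + 3..k + N}"
    proof
      fix v assume "v \<in> range D"
      then obtain i where i: "v = c (k + 3 + i mod (N - 2))" unfolding D_def by blast
      have "0 \<le> i mod (N - 2)" "i mod (N - 2) < N - 2" using m by simp_all
      then show "v \<in> c ` {k + 3..k + N}" unfolding i by (intro imageI) simp
    qed
    show "c ` {k + 3..k + N} \<subseteq> range D"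
    proof
      fix v assume "v \<in> c ` {k + 3..k + N}"
      then obtain j where j: "v = c j" "k + 3 \<le> j" "j \<le> k + N" by auto
      then have "v = D (j - k - 3)" unfolding D_def by simp
      then show "v \<in> range D" by blast
    qed
  qed
qed

theorem hamiltonian_predecessor:
  assumes "simple_graph G" "\<not> bipartite G" "card (verts G) = n" "4 \<le> n"
    and "(n - 1)\<^sup>2 div 4 + 2 \<le> card (edges G)" "is_cycle G xs0" "length xs0 = n"
  shows "\<exists>xs. is_cycle G xs \<and> length xs = n - 1"
  using assms
proof (induction n arbitrary: G xs0 rule: less_induct)
  case (less n)
  note G = less.prems(1) and nb = less.prems(2) and n = less.prems(3,4) and size = less.prems(5)
  obtain c where c: "cyc G (int n) c" "range c = set xs0"
    using is_cycle_imp_cyc[OF less.prems(6)] less.prems(7) by metis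
  have rc: "range c = verts G"
    by (rule card_subset_eq[OF simple_finite[OF G]])
      (use cyc_rangeI[OF G c(1)] cyc_card_range[OF c(1)] n(1) in auto)
  define N where "N = int n"
  have cN: "cyc G N c" using c(1) unfolding N_def .
  show ?case
  proof (rule ccontr)
    assume no: "\<not> ?case"
    have no_cycle: "int (length xs) \<noteq> N - 1" if "is_cycle G xs" for xs
      using no that n(2) unfolding N_def by (metis int_ops(6) le_trans nat_int not_numeral_le_zero of_nat_1 one_le_numeral order.trans zero_le_one of_nat_diff)
    have no2: "\<not> adj G (c i) (c (i + 2))" for i
      using cyc_skip[OF G cN, of i] no_cycle[of "seg c (i + 2) (i + N)"] n(2) N_def by auto
    have no2': "\<not> adj G (c i) (c (i - 2))" for i
      using no2[of "i - 2"] by (simp add: adj_sym[of G "c i"])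
    have per: "c (i + N) = c i" for i by (rule cyc_period[OF cN])
    have per2: "c (i + (N - 2)) = c (i - 2)" for i
      using per[of "i - 2"] by (simp add: algebra_simps)
    have vtx: "\<exists>k. v = c (i + k) \<and> 1 \<le> k \<and> k \<le> N - 1" if "adj G (c i) v" for i v
    proof -
      have "v \<in> range c" using adj_in(2)[OF G that] rc by simp
      then obtain j0 where "v = c j0" by blast
      then obtain j where j: "i \<le> j" "j < i + N" "c j = v"
        using cyc_window_obtain[OF cN, of i j0] by metis
      have "j \<noteq> i" using adj_in(3)[OF G that] j(3) by auto
      then show ?thesis using j by (intro exI[of _ "j - i"]) auto
    qed
    \<comment> \<open>For orders 4 and 6 the excluded spans are exactly the even ones, so index
      parity is a bipartition. For order 5 every chord is excluded and at most five edges remain,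
      below the bound 6. From 7 on the averaging applies.\<close>
    consider "N = 4 \<or> N = 6" | "N = 5" | "7 \<le> N" using n(2) N_def by linarith
    then show False
    proof cases
      case 1
      have ev: "even N" using 1 by auto
      have odd: "odd (j - i)" if a: "adj G (c i) (c j)" for i j
      proof -
        obtain k where k: "c j = c (i + k)" "1 \<le> k" "k \<le> N - 1" using vtx[OF a] by blast
        have "k \<noteq> 2" using a k(1) no2 by auto
        moreover have "N = 6 \<Longrightarrow> k \<noteq> 4" using a k(1) no2'[of i] per2[of i] by auto
        ultimately have "odd k" using 1 k(2,3) by presburger
        moreover have "N dvd (j - (i + k))" using k(1) cyc_eq[OF cN] by (simp add: mod_eq_dvd_iff)
        then have "2 dvd (j - (i + k))" using ev dvd_trans by blast
        ultimately show ?thesis by presburger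
      qed
      have cls: "even j \<longleftrightarrow> even i" if "c i = c j" for i j
      proof -
        have "N dvd (i - j)" using that cyc_eq[OF cN] by (simp add: mod_eq_dvd_iff)
        then have "2 dvd (i - j)" using ev dvd_trans by blast
        then show ?thesis by presburger
      qed
      have "bipartite G"
      proof (rule bipartiteI_indep[OF G])
        show "c ` {i. even i} \<union> c ` {i. odd i} = verts G"
          unfolding rc[symmetric] image_Un[symmetric] by (rule arg_cong[where f = "image c"]) blast
        show "c ` {i. even i} \<inter> c ` {i. odd i} = {}"
        proof (rule equals0I)
          fix v assume "v \<in> c ` {i. even i} \<inter> c ` {i. odd i}"
          then obtain i j where "v = c i" "even i" "v = c j" "odd j" by (elim IntE imageE) simp
          then show False using cls[of i j] by simp
        qed
        show "\<not> adj G u v" if uv: "u \<in> c ` {i. even i}" "v \<in> c ` {i. even i}" for u v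
        proof -
          obtain i j where ij: "u = c i" "v = c j" "even i" "even j" using uv by (elim imageE) simp
          then have "even (j - i)" by presburger
          then show ?thesis using odd[of i j] ij(1,2) by blast
        qed
        show "\<not> adj G u v" if uv: "u \<in> c ` {i. odd i}" "v \<in> c ` {i. odd i}" for u v
        proof -
          obtain i j where ij: "u = c i" "v = c j" "odd i" "odd j" using uv by (elim imageE) simp
          then have "even (j - i)" by presburger
          then show ?thesis using odd[of i j] ij(1,2) by blast
        qed
      qed
      then show False using nb by blast
    next
      case 2
      have "nbh G (c i) \<subseteq> {c (i + 1), c (i + 4)}" for i
      proof
        fix v assume "v \<in> nbh G (c i)"
        then have a: "adj G (c i) v" by (simp add: nbh_def)
        obtain k where k: "v = c (i + k)" "1 \<le> k" "k \<le> N - 1" using vtx[OF a] by blast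
        have "k \<noteq> 2" using a k(1) no2 by auto
        moreover have "k \<noteq> 3" using a k(1) no2'[of i] per2[of i] 2 by auto
        ultimately have "k = 1 \<or> k = 4" using 2 k by linarith
        then show "v \<in> {c (i + 1), c (i + 4)}" using k(1) by auto
      qed
      then have le2: "card (nbh G (c i)) \<le> 2" for i
        using card_mono[of "{c (i + 1), c (i + 4)}" "nbh G (c i)"] card_insert_le_m1[of 2 "{c (i + 4)}" "c (i + 1)"]
        by fastforce
      have "(\<Sum>i\<in>{0..<N}. int (card (nbh G (c i)))) \<le> (\<Sum>i\<in>{0..<N}. 2)"
      proof (rule sum_mono)
        fix i show "int (card (nbh G (c i))) \<le> 2" using le2[of i] by simp
      qed
      then have "card (edges G) \<le> 5" using degree_sum_cycle[OF G cN rc] 2 by simp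
      moreover have "n = 5" using 2 N_def by simp
      ultimately show False using size by simp
    next
      case 3
      \<comment> \<open>The integer division loses at most 1 from (n - 1)^2, so four times the size
        is at least (n - 1)^2 - 1 + 8.\<close>
      have "N * N - 2 * N + 8 \<le> 4 * int (card (edges G))"
      proof -
        have "(n - 1)\<^sup>2 \<le> 4 * ((n - 1)\<^sup>2 div 4) + 1" by (rule square_div4_lower)
        then have "(n - 1)\<^sup>2 + 7 \<le> 4 * card (edges G)" using size by linarith
        then have "int ((n - 1)\<^sup>2) + 7 \<le> 4 * int (card (edges G))" by linarith
        moreover have "int ((n - 1)\<^sup>2) = (N - 1) * (N - 1)"
          using n(2) unfolding N_def by (simp add: power2_eq_square of_nat_diff)
        ultimately show ?thesis by (simp add: algebra_simps)
      qed
      then obtain k \<delta> where k: "adj G (c k) (c (k + 3))" "0 \<le> \<delta>" "\<delta> \<le> 3" "2 \<le> \<delta> \<Longrightarrow> 8 \<le> N"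
        "3 \<le> \<delta> \<Longrightarrow> 16 \<le> N"
        "int (card (nbh G (c (k + 1)))) + int (card (nbh G (c (k + 2)))) = N - \<delta>"
        using good_short_chord[OF G cN rc 3 no_cycle] by blast
      define D where "D = (\<lambda>i. c (k + 3 + i mod (N - 2)))"
      have D: "cyc G (N - 2) D" "range D = c ` {k + 3..k + N}"
        using skip_two_cyc[OF G cN _ k(1)] 3 unfolding D_def by auto
      have out: "c (k + 1) \<notin> range D" "c (k + 2) \<notin> range D"
      proof -
        have "c (k + 1) \<noteq> c x" "c (k + 2) \<noteq> c x" if "x \<in> {k + 3..k + N}" for x
          using that by (intro cyc_neq[OF cN]; simp)+
        then show "c (k + 1) \<notin> range D" "c (k + 2) \<notin> range D" unfolding D(2) by blast+
      qed
      interpret P: outside_pair G "N - 2" D "c (k + 1)" "c (k + 2)"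
      proof
        show "adj G (c (k + 1)) (c (k + 2))" by (rule cyc_adj'[OF cN]) simp
        fix xs assume "is_cycle G xs"
        then show "int (length xs) \<noteq> N - 2 + 1" using no_cycle by fastforce
      qed (use G D(1) out in auto)
      have win: "{k + 1..<k + 1 + N} = insert (k + 1) (insert (k + 2) {k + 3..k + N})" using 3 by auto
      have V: "verts G = insert (c (k + 1)) (insert (c (k + 2)) (range D))"
        unfolding rc[symmetric] cyc_range_window[OF cN, of "k + 1"] win D(2) by simp
      have "(- 1) mod (N - 2) = N - 3"
        using 3 by (simp add: zmod_minus1)
      then have Dm1: "D (- 1) = c k" unfolding D_def using per[of k] by simp
      have I1: "adj G (c (k + 1)) (D (- 1))"
        unfolding Dm1 using cyc_adj[OF cN, of k] by (simp add: adj_sym[of G "c (k + 1)"])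
      have J0: "adj G (c (k + 2)) (D 0)" unfolding D_def by (rule cyc_adj'[OF cN]) simp
      have nm: "n = nat (N - 2) + 2" using 3 N_def by simp
      show False
      proof (rule P.pair_contradiction[OF V nb I1 J0])
        show "(nat (N - 2) + 1)\<^sup>2 div 4 + 2 \<le> card (edges G)" using size nm by simp
        show "int (card (nbh G (c (k + 1)))) + int (card (nbh G (c (k + 2)))) = N - 2 + 2 - \<delta>" using k(6) by simp
        show "0 \<le> \<delta>" "\<delta> \<le> 3" by (rule k)+
        show "5 \<le> N - 2" using 3 by simp
        show "6 \<le> N - 2" if "2 \<le> \<delta>" using k(4)[OF that] by simp
        show "14 \<le> N - 2" if "3 \<le> \<delta>" using k(5)[OF that] by simp
        let ?H = "del G {c (k + 1), c (k + 2)}"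
        assume H: "\<not> bipartite ?H" "(nat (N - 2) - 1)\<^sup>2 div 4 + 2 \<le> card (edges ?H)"
        have DH: "cyc ?H (N - 2) D" unfolding cyc_del using D(1) out by auto
        have "verts ?H = range D" using V out by auto
        then have "card (verts ?H) = nat (N - 2)" using cyc_card_range[OF D(1)] by simp
        moreover have "length (seg D 0 (N - 2 - 1)) = nat (N - 2)"
          using cyc_imp_cycle(3)[OF del_simple[OF G] DH] 3 by simp
        ultimately have "\<exists>xs. is_cycle ?H xs \<and> length xs = nat (N - 2) - 1"
          using less.IH[OF _ del_simple[OF G] H(1) _ _ H(2) cyc_imp_cycle(1)[OF del_simple[OF G] DH]]
            nm 3 by simp
        then show "\<exists>xs. is_cycle ?H xs \<and> int (length xs) = N - 2 - 1" using 3 by fastforce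
      qed
    qed
  qed
qed

section \<open>Paths in almost complete bipartite graphs\<close>

text \<open>\<open>S\<close> only bounds the vertices of the path from above, so a path found after
  deleting vertices from the classes is also one in the full classes.\<close>

definition gpath :: "'a graph \<Rightarrow> 'a set \<Rightarrow> 'a \<Rightarrow> 'a \<Rightarrow> 'a list \<Rightarrow> bool" where
  "gpath G S x y xs \<longleftrightarrow> xs \<noteq> [] \<and> hd xs = x \<and> last xs = y \<and> distinct xs \<and> set xs \<subseteq> S \<and>
     successively (adj G) xs"

lemma gpath_mono: "gpath G S x y xs \<Longrightarrow> S \<subseteq> T \<Longrightarrow> gpath G T x y xs"
  unfolding gpath_def by blast

lemma gpath_Cons:
  assumes "gpath G S x y xs" "adj G z x" "z \<notin> S"
  shows "gpath G (insert z S) z y (z # xs)"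
  using assms unfolding gpath_def by (auto simp: successively_Cons)

lemma gpath_snoc:
  assumes "gpath G S x y xs" "adj G y z" "z \<notin> S"
  shows "gpath G (insert z S) x z (xs @ [z])"
  using assms unfolding gpath_def by (auto simp: successively_append_iff)

lemma gpath_close:
  assumes "simple_graph G" "gpath G S x y xs" "adj G y x" "3 \<le> length xs"
  shows "is_cycle G xs"
  by (rule is_cycle_successively[OF assms(1,4)]) (use assms(2,3) in \<open>auto simp: gpath_def\<close>)

lemma gpath_through:
  assumes "simple_graph G" "gpath G S x y xs" "adj G u x" "adj G u y" "u \<notin> S" "2 \<le> length xs"
  shows "is_cycle G (u # xs)"
proof (rule gpath_close[OF assms(1)])
  show "gpath G (insert u S) u y (u # xs)" by (rule gpath_Cons[OF assms(2,3,5)])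
  show "adj G y u" using assms(4) by (rule adj_sym[THEN iffD1])
qed (use assms(6) in simp)

lemma gpath_ends: "gpath G S x y xs \<Longrightarrow> x \<in> set xs \<and> y \<in> set xs"
  unfolding gpath_def by auto

definition miss :: "'a graph \<Rightarrow> 'a set \<Rightarrow> 'a set \<Rightarrow> 'a \<Rightarrow> 'a \<Rightarrow> ('a \<times> 'a) set" where
  "miss G A B a b = {(x, y) \<in> A \<times> B. \<not> adj G x y \<and> (x, y) \<noteq> (a, b)}"

lemma finite_miss: "finite A \<Longrightarrow> finite B \<Longrightarrow> finite (miss G A B a b)"
  unfolding miss_def by (rule finite_subset[of _ "A \<times> B"]) auto

lemma exists_outside:
  assumes "finite X" "card Y < card X" "finite Y"
  shows "\<exists>x\<in>X. x \<notin> Y"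
  using assms card_mono[of Y X] by (metis leD subsetI)

text \<open>The pair of end vertices is never an edge of a path of length greater than two, so its
  adjacency does not count.\<close>

lemma even_path_except:
  assumes "2 \<le> k" "finite A" "finite B" "A \<inter> B = {}" "k \<le> card A" "k \<le> card B"
    and "card (miss G A B a b) + 2 \<le> k" "a \<in> A" "b \<in> B" "2 \<le> j" "j \<le> k"
  shows "\<exists>xs. gpath G (A \<union> B) a b xs \<and> length xs = 2 * j"
  using assms
proof (induction k arbitrary: A B a b j rule: nat_induct_at_least)
  case base
  note fin = base(1,2)
  have "card (miss G A B a b) = 0" using base by simp
  then have M: "miss G A B a b = {}" using finite_miss[OF fin] by simp
  have two: "card {a} < card A" "card {b} < card B" using base(4,5) by simp_all
  obtain a' where a': "a' \<in> A" "a' \<noteq> a"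
    using exists_outside[OF fin(1) two(1)] by blast
  obtain b' where b': "b' \<in> B" "b' \<noteq> b"
    using exists_outside[OF fin(2) two(2)] by blast
  have ad: "adj G x y" if "x \<in> A" "y \<in> B" "x \<noteq> a \<or> y \<noteq> b" for x y
    using M that unfolding miss_def by auto
  have "adj G a b'" "adj G a' b'" "adj G a' b" using ad a' b' base(7,8) by auto
  then have "gpath G (A \<union> B) a b [a, b', a', b]"
    unfolding gpath_def using a' b' base(3,7,8) by (auto simp: adj_sym[of G b'])
  moreover have "j = 2" using base(9,10) by simp
  ultimately show ?case by (intro exI[of _ "[a, b', a', b]"]) simp
next
  case (Suc k)
  let ?M = "miss G A B a b"
  note fin = Suc.prems(1,2) and disj = Suc.prems(3) and cA = Suc.prems(4) and cB = Suc.prems(5)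
    and cM = Suc.prems(6) and aA = Suc.prems(7) and bB = Suc.prems(8)
  have finM: "finite ?M" by (rule finite_miss[OF fin])
  \<comment> \<open>The allowance of \<open>k - 2\<close> missing pairs shrinks with
    \<open>k\<close>, so each deletion of vertices has to destroy a missing pair, unless there is
    none.\<close>
  have red: "card (miss G A' B' a' b') + 2 \<le> k"
    if "miss G A' B' a' b' \<subseteq> ?M" "?M = {} \<or> (\<exists>p\<in>?M. p \<notin> miss G A' B' a' b')" for A' B' a' b'
    using that(2)
  proof
    assume "?M = {}"
    then show ?thesis using that(1) Suc.hyps by simp
  next
    assume "\<exists>p\<in>?M. p \<notin> miss G A' B' a' b'"
    then have "miss G A' B' a' b' \<subset> ?M" using that(1) by blast
    then have "card (miss G A' B' a' b') < card ?M" by (rule psubset_card_mono[OF finM])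
    then show ?thesis using cM by simp
  qed
  show ?case
  proof (cases "j \<le> k")
    case True
    show ?thesis
    proof (cases "?M = {}")
      case M: True
      show ?thesis
        by (rule Suc.IH[OF fin disj _ _ red[OF order.refl] aA bB Suc.prems(9) True])
          (use M cA cB in auto)
    next
      case False
      \<comment> \<open>For \<open>j \<le> k\<close> the path can spare a vertex of each class. A
        missing pair differs from the pair of ends, so it contains a vertex that is not an end of
        the path and may be deleted.\<close>
      then obtain a0 b0 where m: "(a0, b0) \<in> ?M" by auto
      then have m': "a0 \<in> A" "b0 \<in> B" "a0 \<noteq> a \<or> b0 \<noteq> b" unfolding miss_def by auto
      show ?thesis
      proof (cases "a0 \<noteq> a")
        case a0: True
        have "\<exists>xs. gpath G ((A - {a0}) \<union> B) a b xs \<and> length xs = 2 * j"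
        proof (rule Suc.IH)
          show "card (miss G (A - {a0}) B a b) + 2 \<le> k"
            by (rule red) (use m in \<open>auto simp: miss_def\<close>)
          show "k \<le> card (A - {a0})" using cA m'(1) fin by simp
        qed (use fin disj cB aA bB Suc.prems(9) True a0 in auto)
        then show ?thesis using gpath_mono[of G "(A - {a0}) \<union> B" a b _ "A \<union> B"] by blast
      next
        case a0: False
        have "\<exists>xs. gpath G (A \<union> (B - {b0})) a b xs \<and> length xs = 2 * j"
        proof (rule Suc.IH)
          show "card (miss G A (B - {b0}) a b) + 2 \<le> k"
            by (rule red) (use m in \<open>auto simp: miss_def\<close>)
          show "k \<le> card (B - {b0})" using cB m'(2) fin by simp
        qed (use fin disj cA aA bB Suc.prems(9) True a0 m' in auto)
        then show ?thesis using gpath_mono[of G "A \<union> (B - {b0})" a b _ "A \<union> B"] by blast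
      qed
    qed
  next
    case False
    then have j: "j = Suc k" using Suc.prems(10) by simp
    have nbrB: "\<exists>y\<in>B - {b}. adj G x y" if "x \<in> A" for x
    proof -
      have "card (snd ` (?M \<inter> {x} \<times> B)) < card (B - {b})"
        using card_image_le[of "?M \<inter> {x} \<times> B" snd] card_mono[OF finM, of "?M \<inter> {x} \<times> B"] finM cM cB bB fin
        by simp
      then obtain y where "y \<in> B - {b}" "y \<notin> snd ` (?M \<inter> {x} \<times> B)"
        using exists_outside[of "B - {b}" "snd ` (?M \<inter> {x} \<times> B)"] fin finM by auto
      then show ?thesis using that unfolding miss_def by (intro bexI[of _ y]) force+
    qed
    have nbrA: "\<exists>x\<in>A - {a}. adj G x y" if "y \<in> B" for y
    proof -
      have "card (fst ` (?M \<inter> A \<times> {y})) < card (A - {a})"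
        using card_image_le[of "?M \<inter> A \<times> {y}" fst] card_mono[OF finM, of "?M \<inter> A \<times> {y}"] finM cM cA aA fin
        by simp
      then obtain x where "x \<in> A - {a}" "x \<notin> fst ` (?M \<inter> A \<times> {y})"
        using exists_outside[of "A - {a}" "fst ` (?M \<inter> A \<times> {y})"] fin finM by auto
      then show ?thesis using that unfolding miss_def by (intro bexI[of _ x]) force+
    qed
    \<comment> \<open>At full length the first two vertices \<open>a\<close>, \<open>b1\<close> are
      split off, which needs a missing pair at one of them. If no missing pair contains
      \<open>a\<close>, then \<open>a\<close> is adjacent to the vertex \<open>b0\<close> of a
      missing pair. Missing pairs at \<open>b\<close> are met by splitting off the last two vertices
      instead.\<close>
    have a_side: ?thesis
      if b1: "b1 \<in> B - {b}" "adj G a b1" and hit: "?M = {} \<or> (\<exists>p\<in>?M. fst p = a \<or> snd p = b1)" for b1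
    proof -
      obtain a2 where a2: "a2 \<in> A - {a}" "adj G a2 b1" using nbrA b1(1) by blast
      have "\<exists>xs. gpath G ((A - {a}) \<union> (B - {b1})) a2 b xs \<and> length xs = 2 * k"
      proof (rule Suc.IH)
        show "card (miss G (A - {a}) (B - {b1}) a2 b) + 2 \<le> k"
          by (rule red) (use hit in \<open>auto simp: miss_def\<close>)
        show "k \<le> card (A - {a})" "k \<le> card (B - {b1})" using cA cB aA b1(1) fin by simp_all
      qed (use fin disj bB a2 b1 Suc.hyps in auto)
      then obtain xs where xs: "gpath G ((A - {a}) \<union> (B - {b1})) a2 b xs" "length xs = 2 * k" by blast
      have "gpath G (insert b1 ((A - {a}) \<union> (B - {b1}))) b1 b (b1 # xs)"
        by (rule gpath_Cons[OF xs(1)]) (use a2 b1 disj in \<open>auto simp: adj_sym[of G b1]\<close>)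
      then have "gpath G (insert a (insert b1 ((A - {a}) \<union> (B - {b1})))) a b (a # b1 # xs)"
        by (rule gpath_Cons) (use aA b1 disj in auto)
      then have "gpath G (A \<union> B) a b (a # b1 # xs)"
        by (rule gpath_mono) (use aA b1(1) in auto)
      then show ?thesis using xs(2) j by (intro exI[of _ "a # b1 # xs"]) simp
    qed
    show ?thesis
    proof (cases "\<exists>a0. (a0, b) \<in> ?M")
      case True
      then obtain a0 where a0: "(a0, b) \<in> ?M" by blast
      obtain a1 where a1: "a1 \<in> A - {a}" "adj G a1 b" using nbrA bB by blast
      obtain b2 where b2: "b2 \<in> B - {b}" "adj G a1 b2" using nbrB a1(1) by blast
      have "\<exists>xs. gpath G ((A - {a1}) \<union> (B - {b})) a b2 xs \<and> length xs = 2 * k"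
      proof (rule Suc.IH)
        show "card (miss G (A - {a1}) (B - {b}) a b2) + 2 \<le> k"
          by (rule red) (use a0 in \<open>auto simp: miss_def\<close>)
        show "k \<le> card (A - {a1})" "k \<le> card (B - {b})" using cA cB bB a1(1) fin by simp_all
      qed (use fin disj aA a1 b2 Suc.hyps in auto)
      then obtain xs where xs: "gpath G ((A - {a1}) \<union> (B - {b})) a b2 xs" "length xs = 2 * k" by blast
      have "gpath G (insert a1 ((A - {a1}) \<union> (B - {b}))) a a1 (xs @ [a1])"
        by (rule gpath_snoc[OF xs(1)]) (use b2 a1 disj in \<open>auto simp: adj_sym[of G b2]\<close>)
      then have "gpath G (insert b (insert a1 ((A - {a1}) \<union> (B - {b})))) a b ((xs @ [a1]) @ [b])"
        by (rule gpath_snoc) (use bB a1 disj in auto)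
      then have "gpath G (A \<union> B) a b ((xs @ [a1]) @ [b])"
        by (rule gpath_mono) (use bB a1(1) in auto)
      then show ?thesis using xs(2) j by (intro exI[of _ "(xs @ [a1]) @ [b]"]) simp
    next
      case no_b: False
      obtain b1 where b1: "b1 \<in> B - {b}" "adj G a b1" using nbrB aA by blast
      show ?thesis
      proof (cases "?M = {} \<or> (\<exists>p\<in>?M. fst p = a)")
        case True
        then show ?thesis using a_side[OF b1] by blast
      next
        case False
        then obtain a0 b0 where m: "(a0, b0) \<in> ?M" by auto
        then have b0: "b0 \<in> B - {b}" using no_b unfolding miss_def by auto
        moreover have "adj G a b0"
        proof (rule ccontr)
          assume "\<not> adj G a b0"
          then have "(a, b0) \<in> ?M" using b0 aA unfolding miss_def by auto
          then show False using False by force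
        qed
        ultimately show ?thesis using a_side m by force
      qed
    qed
  qed
qed

definition missing :: "'a graph \<Rightarrow> 'a set \<Rightarrow> 'a set \<Rightarrow> nat" where
  "missing G A B = card {(x, y) \<in> A \<times> B. \<not> adj G x y}"

lemma missing_swap: "missing G A B = missing G B A"
  unfolding missing_def
proof (rule bij_betw_same_card[where f = prod.swap])
  show "bij_betw prod.swap {(x, y) \<in> A \<times> B. \<not> adj G x y} {(x, y) \<in> B \<times> A. \<not> adj G x y}"
    by (rule bij_betw_byWitness[where f' = prod.swap]) (auto simp: adj_sym[of G])
qed

lemma even_path:
  assumes "finite A" "finite B" "A \<inter> B = {}" "k \<le> card A" "k \<le> card B"
    and "missing G A B + 2 \<le> k" "a \<in> A" "b \<in> B" "2 \<le> j" "j \<le> k"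
  shows "\<exists>xs. gpath G (A \<union> B) a b xs \<and> length xs = 2 * j"
proof (rule even_path_except)
  have "card (miss G A B a b) \<le> missing G A B"
    unfolding missing_def by (rule card_mono) (use assms(1,2) in \<open>auto simp: miss_def intro: finite_subset[of _ "A \<times> B"]\<close>)
  then show "card (miss G A B a b) + 2 \<le> k" using assms(6) by simp
  show "2 \<le> k" using assms(6) by simp
qed (use assms in auto)

text \<open>The end \<open>a'\<close> is appended to a path with an even number of vertices. The
  other end \<open>b\<close> of that path lies in no missing pair, so it is adjacent to
  \<open>a'\<close>; a vertex \<open>b0\<close> of a missing pair is removed along with
  \<open>a'\<close> to pay for the smaller classes.\<close>

lemma odd_path:
  assumes fin: "finite A" "finite B" and disj: "A \<inter> B = {}" and kA: "k \<le> card A" and kB: "k \<le> card B"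
    and mis: "missing G A B + 2 \<le> k" and a: "a \<in> A" "a' \<in> A" "a \<noteq> a'" and j: "1 \<le> j" "j + 1 \<le> k"
  shows "\<exists>xs. gpath G (A \<union> B) a a' xs \<and> length xs = 2 * j + 1"
proof -
  let ?M = "{(x, y) \<in> A \<times> B. \<not> adj G x y}"
  have finM: "finite ?M" by (rule finite_subset[of _ "A \<times> B"]) (use fin in auto)
  have cM: "card ?M + 2 \<le> k" using mis unfolding missing_def .
  have cm: "card (snd ` ?M) + 2 \<le> k" using card_image_le[OF finM, of snd] cM by simp
  show ?thesis
  proof (cases "j = 1")
    case True
    have "card (snd ` ?M) < card B" using cm kB by simp
    then obtain y where y: "y \<in> B" "y \<notin> snd ` ?M" using exists_outside[of B "snd ` ?M"] fin finM by auto
    then have "adj G a y" "adj G a' y" using a by force+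
    then have "gpath G (A \<union> B) a a' [a, y, a']"
      unfolding gpath_def using a y disj by (auto simp: adj_sym[of G y])
    then show ?thesis using True by (intro exI[of _ "[a, y, a']"]) simp
  next
    case False
    then have j2: "2 \<le> j" using j by simp
    obtain b0 where b0: "b0 \<in> B" "?M = {} \<or> (\<exists>p\<in>?M. snd p = b0)"
    proof (cases "?M = {}")
      case True
      then show thesis using that kB cM by (metis (lifting) add_leD2 all_not_in_conv card.empty le_trans not_numeral_le_zero)
    next
      case False
      then show thesis using that by fastforce
    qed
    have "card (insert b0 (snd ` ?M)) < card B"
      using cm kB card_insert_le_m1[of "k - 1" "snd ` ?M" b0] finM by (simp add: card_insert_if)
    then obtain b where b: "b \<in> B" "b \<noteq> b0" "b \<notin> snd ` ?M"
      using exists_outside[of B "insert b0 (snd ` ?M)"] fin finM by auto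
    then have ab: "adj G b a'" using a by (force simp: adj_sym[of G b])
    let ?A = "A - {a'}" and ?B = "B - {b0}"
    have "\<exists>xs. gpath G (?A \<union> ?B) a b xs \<and> length xs = 2 * j"
    proof (rule even_path)
      show "missing G ?A ?B + 2 \<le> k - 1"
      proof -
        let ?M' = "{(x, y) \<in> ?A \<times> ?B. \<not> adj G x y}"
        have sub: "?M' \<subseteq> ?M" by auto
        from b0(2) show ?thesis
        proof
          assume "?M = {}"
          then have "?M' = {}" using sub by blast
          then have "card ?M' = 0" by (simp only: card.empty)
          then have "missing G ?A ?B = 0" unfolding missing_def .
          then show ?thesis using j j2 by simp
        next
          assume "\<exists>p\<in>?M. snd p = b0"
          then have "?M' \<subset> ?M" by force
          then have "card ?M' < card ?M" by (rule psubset_card_mono[OF finM])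
          then show ?thesis unfolding missing_def using cM by simp
        qed
      qed
    qed (use fin disj kA kB a b b0 j j2 in auto)
    then obtain xs where xs: "gpath G (?A \<union> ?B) a b xs" "length xs = 2 * j" by blast
    have "gpath G (insert a' (?A \<union> ?B)) a a' (xs @ [a'])"
      by (rule gpath_snoc[OF xs(1) ab]) (use disj a in auto)
    then have "gpath G (A \<union> B) a a' (xs @ [a'])" by (rule gpath_mono) (use a in auto)
    then show ?thesis using xs(2) by (intro exI[of _ "xs @ [a']"]) simp
  qed
qed

text \<open>Paths between the ends of the edge have an even number of vertices: the edge closes them
  to even cycles, \<open>t\<close> closes them to odd ones. The alternative in the assumption on
  \<open>missing\<close> admits \<open>k = 1\<close>, where the edge itself is the path.\<close>

lemma edge_on_all_cycles:
  assumes G: "simple_graph G" and fin: "finite A" "finite B" and disj: "A \<inter> B = {}"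
    and k: "k \<le> card A" "k \<le> card B" "missing G A B + 2 \<le> k \<or> (missing G A B = 0 \<and> 1 \<le> k)"
    and t: "t \<notin> A \<union> B" "adj G t x" "adj G t y" and xy: "x \<in> A" "y \<in> B" "adj G x y"
    and l: "3 \<le> l" "l \<le> 2 * k + 1"
  shows "on_cycle G x l \<and> on_cycle G y l \<and> (odd l \<longrightarrow> on_cycle G t l)"
proof -
  have path: "\<exists>xs. gpath G (A \<union> B) x y xs \<and> length xs = 2 * j" if "1 \<le> j" "j \<le> k" for j
  proof (cases "j = 1")
    case True
    have "gpath G (A \<union> B) x y [x, y]" unfolding gpath_def using xy disj by auto
    then show ?thesis using True by (intro exI[of _ "[x, y]"]) simp
  next
    case False
    then show ?thesis using even_path[OF fin disj k(1,2) _ xy(1,2), of G j] that k(3) by auto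
  qed
  show ?thesis
  proof (cases "odd l")
    case True
    then obtain j where j: "l = 2 * j + 1" by (rule oddE)
    obtain xs where xs: "gpath G (A \<union> B) x y xs" "length xs = 2 * j" using path[of j] j l by auto
    have "is_cycle G (t # xs)" by (rule gpath_through[OF G xs(1) t(2,3,1)]) (use xs(2) j l in simp)
    moreover have "length (t # xs) = l" using xs(2) j by simp
    moreover have "x \<in> set (t # xs)" "y \<in> set (t # xs)" "t \<in> set (t # xs)" using gpath_ends[OF xs(1)] by auto
    ultimately show ?thesis unfolding on_cycle_def by blast
  next
    case False
    then obtain j where j: "l = 2 * j" by blast
    obtain xs where xs: "gpath G (A \<union> B) x y xs" "length xs = 2 * j" using path[of j] j l by auto
    have "is_cycle G xs"
      by (rule gpath_close[OF G xs(1)]) (use xs(2) j l xy(3) in \<open>auto simp: adj_sym[of G y]\<close>)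
    then show ?thesis using xs(2) j gpath_ends[OF xs(1)] False unfolding on_cycle_def by blast
  qed
qed

text \<open>Two neighbours of \<open>t\<close> in the same class are joined by a path with an odd
  number of vertices, which \<open>t\<close> closes to an even cycle.\<close>

lemma even_cycle_through:
  assumes G: "simple_graph G" and fin: "finite A" "finite B" and disj: "A \<inter> B = {}"
    and k: "k \<le> card A" "k \<le> card B" "missing G A B + 2 \<le> k"
    and t: "t \<notin> A \<union> B" "adj G t x" "adj G t x'" and x: "x \<in> A" "x' \<in> A" "x \<noteq> x'"
    and l: "4 \<le> l" "l \<le> 2 * k" "even l"
  shows "on_cycle G t l"
proof -
  obtain j where j: "l = 2 * j" using l(3) by blast
  have "\<exists>xs. gpath G (A \<union> B) x x' xs \<and> length xs = 2 * (j - 1) + 1"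
    by (rule odd_path[OF fin disj k x]) (use j l in auto)
  then obtain xs where xs: "gpath G (A \<union> B) x x' xs" "length xs = 2 * (j - 1) + 1" by blast
  have "is_cycle G (t # xs)" by (rule gpath_through[OF G xs(1) t(2,3,1)]) (use xs(2) j l in simp)
  moreover have "length (t # xs) = l" using xs(2) j l by simp
  ultimately show ?thesis unfolding on_cycle_def by (metis list.set_intros(1))
qed

section \<open>Deleting a vertex of low degree\<close>

text \<open>BT(n) is described inside the given graph, so that the induction can build and take
  apart such graphs on any vertex type without handling isomorphisms. \<open>BT_form_iso\<close>
  makes the connection with \<open>BT\<close>.\<close>

definition BT_form :: "'a graph \<Rightarrow> nat \<Rightarrow> bool" where
  "BT_form G n \<longleftrightarrow> (\<exists>A B w a b. A \<inter> B = {} \<and> w \<notin> A \<union> B \<and> verts G = insert w (A \<union> B) \<and>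
     card A = (n - 1) div 2 \<and> card B = n div 2 \<and> a \<in> A \<and> b \<in> B \<and>
     (\<forall>x\<in>A. \<forall>y\<in>B. adj G x y) \<and> (\<forall>x\<in>A. \<forall>y\<in>A. \<not> adj G x y) \<and> (\<forall>x\<in>B. \<forall>y\<in>B. \<not> adj G x y) \<and>
     (\<forall>v\<in>A \<union> B. adj G w v \<longleftrightarrow> v = a \<or> v = b))"

lemma square_sum_div4:
  fixes p q :: nat
  assumes "p \<le> q"
  shows "(p + q)\<^sup>2 div 4 = p * q + (q - p)\<^sup>2 div 4"
proof -
  obtain D where D: "q = p + D" using assms le_Suc_ex by blast
  have "(p + q)\<^sup>2 = (q - p)\<^sup>2 + (p * q) * 4" unfolding D by (simp add: power2_eq_square algebra_simps)
  then show ?thesis by simp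
qed

lemma half_le_square: "2 \<le> D \<Longrightarrow> D div 2 \<le> D\<^sup>2 div (4::nat)"
proof -
  assume D: "2 \<le> D"
  have "4 * (D div 2) \<le> 2 * D" by simp
  also have "\<dots> \<le> D * D" using D by simp
  finally show ?thesis by (simp add: power2_eq_square less_eq_div_iff_mult_less_eq mult.commute)
qed

text \<open>Let p \<le> q be the class sizes, D = q - p and M the number of missing pairs. As (p +
  q)^2 = 4 p q + D^2, the size bound makes the degree of \<open>u\<close> at least M + 2 + D^2 div
  4, and low degree makes it at most p + D div 2. Hence M + 2 \<le> p, the allowance of the path
  lemmas. An edge between neighbours of \<open>u\<close> in different classes then yields the
  cycles.\<close>

lemma near_bipartite_ordered:
  assumes G: "simple_graph G" "\<not> bipartite G" and u: "u \<in> verts G"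
    and AB: "A \<union> B = verts G - {u}" "A \<inter> B = {}" "card A \<le> card B"
    and bip: "\<And>x y. adj (del G {u}) x y \<Longrightarrow> x \<in> A \<longleftrightarrow> y \<in> B"
    and n: "card (verts G) = n" and size: "(n - 1)\<^sup>2 div 4 + 2 \<le> card (edges G)"
    and low: "2 * card (nbh G u) \<le> n - 1" and noBT: "5 \<le> n \<Longrightarrow> \<not> BT_form G n"
  shows "1 \<le> card A \<and> (\<exists>S. card S = 3 \<and> S \<subseteq> verts G \<and> (\<forall>v\<in>S. \<forall>l. 3 \<le> l \<longrightarrow> l \<le> 2 * card A + 1 \<longrightarrow> on_cycle G v l))"
proof -
  have fin: "finite A" "finite B" using AB(1) simple_finite[OF G(1)] by (metis finite_Diff finite_Un)+
  let ?p = "card A" and ?q = "card B" and ?M = "missing G A B" and ?d = "card (nbh G u)"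
  have uAB: "u \<notin> A \<union> B" using AB(1) by blast
  have "card (A \<union> B) = ?p + ?q" by (rule card_Un_disjoint[OF fin AB(2)])
  then have np: "n - 1 = ?p + ?q" using AB(1) n u simple_finite[OF G(1)] by simp
  have irr: "\<not> adj G x x" for x using adj_in(3)[OF G(1)] by blast
  have bip': "x \<in> A \<longleftrightarrow> y \<in> B" if "adj G x y" "x \<noteq> u" "y \<noteq> u" for x y
    using bip[of x y] that by simp
  have noA: "\<not> adj G x y" if "x \<in> A" "y \<in> A" for x y
    using bip'[of x y] that AB(2) uAB by blast
  have noB: "\<not> adj G x y" if "x \<in> B" "y \<in> B" for x y
    using bip'[of x y] that AB(2) uAB by blast
  let ?NA = "nbh G u \<inter> A" and ?NB = "nbh G u \<inter> B"
  have nbu: "nbh G u = ?NA \<union> ?NB" using nbh_subset[OF G(1), of u] AB(1) by blast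
  have dsum: "?d = card ?NA + card ?NB"
    by (subst nbu, rule card_Un_disjoint) (use fin AB(2) in auto)
  have ne: "?NA \<noteq> {}" "?NB \<noteq> {}"
  proof -
    have "bipartite G" if e: "?NA = {}"
    proof (rule bipartiteI_indep[OF G(1)])
      show "insert u A \<union> B = verts G" using AB(1) u by blast
      show "insert u A \<inter> B = {}" using AB uAB by blast
      show "\<not> adj G x y" if "x \<in> insert u A" "y \<in> insert u A" for x y
        using that noA e irr adj_sym[of G x y] unfolding nbh_def by blast
      show "\<not> adj G x y" if "x \<in> B" "y \<in> B" for x y using noB that by blast
    qed
    moreover have "bipartite G" if e: "?NB = {}"
    proof (rule bipartiteI_indep[OF G(1)])
      show "A \<union> insert u B = verts G" using AB(1) u by blast
      show "A \<inter> insert u B = {}" using AB uAB by blast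
      show "\<not> adj G x y" if "x \<in> insert u B" "y \<in> insert u B" for x y
        using that noB e irr adj_sym[of G x y] unfolding nbh_def by blast
      show "\<not> adj G x y" if "x \<in> A" "y \<in> A" for x y using noA that by blast
    qed
    ultimately show "?NA \<noteq> {}" "?NB \<noteq> {}" using G(2) by blast+
  qed
  have pos: "1 \<le> card ?NA" "1 \<le> card ?NB"
    using ne fin by (simp_all add: Suc_le_eq card_gt_0_iff)
  have "card (edges (del G {u})) + card {(a, b) \<in> A \<times> B. \<not> adj (del G {u}) a b} = ?p * ?q"
    by (rule bip_edges[OF del_simple[OF G(1)]]) (use AB bip in auto)
  moreover have "{(a, b) \<in> A \<times> B. \<not> adj (del G {u}) a b} = {(a, b) \<in> A \<times> B. \<not> adj G a b}"
    using uAB by auto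
  ultimately have e: "card (edges (del G {u})) + ?M = ?p * ?q" unfolding missing_def by simp
  let ?D = "?q - ?p"
  have key: "?M + 2 + ?D\<^sup>2 div 4 \<le> ?d"
    using size e edges_del_vertex[OF G(1), of u] square_sum_div4[OF AB(3)] unfolding np by linarith
  have low': "?d \<le> ?p + ?D div 2" using low AB(3) unfolding np by linarith
  have Mp: "?M + 2 \<le> ?p"
  proof (cases "2 \<le> ?D")
    case True
    then show ?thesis using half_le_square[OF True] key low' by linarith
  next
    case False
    then have "?D div 2 = 0" by simp
    then show ?thesis using key low' by linarith
  qed
  have Mq: "?p \<le> ?q" by (rule AB(3))
  \<comment> \<open>Degree 2 would leave a complete balanced bipartite rest, hence BT(n). With three
    neighbours two lie in one class, which is what the even cycles through \<open>u\<close>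
    need.\<close>
  have d3: "3 \<le> ?d"
  proof (rule ccontr)
    assume "\<not> 3 \<le> ?d"
    then have d2: "?d = 2" "?M = 0" "?D\<^sup>2 div 4 = 0" using key by linarith+
    have D1: "?D \<le> 1" using half_le_square[of ?D] d2(3) by (cases "2 \<le> ?D") auto
    have "card ?NA = 1" "card ?NB = 1" using dsum pos d2(1) by linarith+
    then obtain a b where ab: "?NA = {a}" "?NB = {b}" by (metis card_1_singletonE)
    have "finite {(x, y) \<in> A \<times> B. \<not> adj G x y}" by (rule finite_subset[of _ "A \<times> B"]) (use fin in auto)
    then have "{(x, y) \<in> A \<times> B. \<not> adj G x y} = {}" using d2(2) unfolding missing_def by simp
    then have comp: "\<forall>x\<in>A. \<forall>y\<in>B. adj G x y" by blast
    have "1 \<le> n" using u n simple_finite[OF G(1)] by (auto simp: Suc_le_eq card_gt_0_iff)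
    then have n': "n = Suc (?p + ?q)" using np by linarith
    have "?q = ?p \<or> ?q = Suc ?p" using D1 AB(3) by linarith
    then have "card A = (n - 1) div 2 \<and> card B = n div 2" unfolding n' by auto
    then have "card A = (n - 1) div 2" "card B = n div 2" by blast+
    moreover have "a \<in> A" "b \<in> B" using ab by blast+
    moreover have "\<forall>v\<in>A \<union> B. adj G u v \<longleftrightarrow> v = a \<or> v = b" using ab AB(2) unfolding nbh_def by blast
    moreover have "verts G = insert u (A \<union> B)" using AB(1) u by blast
    ultimately have "BT_form G n" using AB(2) uAB comp noA noB unfolding BT_form_def
      by (intro exI[of _ A] exI[of _ B] exI[of _ u] exI[of _ a] exI[of _ b]) simp
    moreover have "5 \<le> n" using low d2(1) by linarith
    ultimately show False using noBT by blast
  qed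
  \<comment> \<open>Otherwise all pairs of neighbours of \<open>u\<close> from different classes are
    missing. By \<open>product_lower\<close> there are at least \<open>?d - 1\<close> of them, more
    than \<open>?M\<close>.\<close>
  obtain x y where xy: "x \<in> ?NA" "y \<in> ?NB" "adj G x y"
  proof (rule ccontr)
    assume "\<not> thesis"
    then have "?NA \<times> ?NB \<subseteq> {(a, b) \<in> A \<times> B. \<not> adj G a b}" using that by auto
    then have "card (?NA \<times> ?NB) \<le> ?M" unfolding missing_def
      by (intro card_mono) (use fin in \<open>auto intro: finite_subset[of _ "A \<times> B"]\<close>)
    then have "card ?NA * card ?NB \<le> ?M" by (simp add: card_cartesian_product)
    then show False using product_lower[OF pos] key dsum by linarith
  qed
  have ux: "adj G u x" "adj G u y" using xy unfolding nbh_def by auto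
  have cyc_xy: "on_cycle G x l \<and> on_cycle G y l \<and> (odd l \<longrightarrow> on_cycle G u l)" if "3 \<le> l" "l \<le> 2 * ?p + 1" for l
    by (rule edge_on_all_cycles[OF G(1) fin AB(2) order.refl Mq _ uAB ux _ _ xy(3) that]) (use Mp xy in auto)
  have ev: "on_cycle G u l" if l: "4 \<le> l" "l \<le> 2 * ?p" "even l" for l
  proof (cases "2 \<le> card ?NA")
    case True
    then obtain x' where "x' \<in> ?NA" "x' \<noteq> x" using exists_outside[of ?NA "{x}"] fin by auto
    then show ?thesis
      using even_cycle_through[OF G(1) fin AB(2) order.refl Mq Mp uAB ux(1) _ _ _ _ l, of x'] xy(1)
      unfolding nbh_def by auto
  next
    case False
    then have "2 \<le> card ?NB" using d3 dsum by linarith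
    then obtain y' where y': "y' \<in> ?NB" "y' \<noteq> y" using exists_outside[of ?NB "{y}"] fin by auto
    show ?thesis
    proof (rule even_cycle_through[OF G(1) fin(2,1) _ Mq order.refl _ _ ux(2) _ _ _ _ l, of y'])
      show "missing G B A + 2 \<le> card A" using Mp missing_swap[of G A B] by simp
    qed (use AB(2) uAB y' xy(2) in \<open>auto simp: nbh_def\<close>)
  qed
  have "on_cycle G u l" if "3 \<le> l" "l \<le> 2 * ?p + 1" for l
  proof (cases "odd l")
    case True
    then show ?thesis using cyc_xy[OF that] by blast
  next
    case False
    then have "l \<noteq> 3" "l \<noteq> 2 * ?p + 1" by (auto simp del: One_nat_def)
    then show ?thesis using ev[of l] that False by simp
  qed
  then have "\<forall>v\<in>{u, x, y}. \<forall>l. 3 \<le> l \<longrightarrow> l \<le> 2 * ?p + 1 \<longrightarrow> on_cycle G v l" using cyc_xy by blast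
  moreover have "u \<noteq> x" "u \<noteq> y" "x \<noteq> y" using xy uAB AB(2) by blast+
  then have "card {u, x, y} = 3" by simp
  moreover have "{u, x, y} \<subseteq> verts G" using xy u AB(1) by blast
  moreover have "1 \<le> ?p" using Mp by linarith
  ultimately show ?thesis by (intro conjI exI[of _ "{u, x, y}"])
qed

section \<open>Cycle lengths bounded by vertex covers\<close>

lemma cycle_length_cover:
  assumes "simple_graph G" "is_cycle G xs" "finite S"
    and "\<And>x y. adj G x y \<Longrightarrow> x \<in> S \<or> y \<in> S"
  shows "length xs \<le> 2 * card S"
proof -
  obtain d where d: "cyc G (int (length xs)) d" "range d = set xs"
    using is_cycle_imp_cyc[OF assms(2)] by blast
  have "d t \<in> S \<or> d (t + 1) \<in> S" for t using assms(4)[OF cyc_adj[OF d(1)]] .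
  then have "{t \<in> {0..<int (length xs)}. d t \<in> S \<or> d (t + 1) \<in> S} = {0..<int (length xs)}" by blast
  then show ?thesis using cyc_cover[OF d(1) assms(3)] by simp
qed

text \<open>A cycle traverses the exceptional edge at most once. In BT(n) the class \<open>A\<close>
  covers every edge except the one from the extra vertex to \<open>b\<close>.\<close>

lemma cycle_length_cover_except:
  assumes "simple_graph G" "is_cycle G xs" "finite S"
    and S: "\<And>x y. adj G x y \<Longrightarrow> x \<in> S \<or> y \<in> S \<or> (x = w \<and> y = b) \<or> (x = b \<and> y = w)"
  shows "length xs \<le> 2 * card S + 1"
proof -
  let ?m = "int (length xs)"
  obtain d where d: "cyc G ?m d" "range d = set xs"
    using is_cycle_imp_cyc[OF assms(2)] by blast
  have m: "3 \<le> ?m" using d(1) unfolding cyc_def by blast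
  let ?C = "{t \<in> {0..<?m}. d t \<in> S \<or> d (t + 1) \<in> S}"
  let ?D = "{t \<in> {0..<?m}. (d t = w \<and> d (t + 1) = b) \<or> (d t = b \<and> d (t + 1) = w)}"
  have eq: "x = y" if "d x = d y" "x \<in> {0..<?m}" "y \<in> {0..<?m}" for x y
    using inj_onD[OF cyc_inj_window[OF d(1), of 0] that(1)] that(2,3) by simp
  have no: False if "d x = w" "d (x + 1) = b" "d y = b" "d (y + 1) = w" for x y
  proof -
    have "d y = d (x + 1)" using that by simp
    then have "d (y + 1) = d (x + 1 + 1)" by (rule cyc_cong[OF d(1)])
    moreover have "d x \<noteq> d (x + 2)" by (rule cyc_neq[OF d(1)]) (use m in auto)
    ultimately show False using that by (simp add: add.assoc)
  qed
  have uniq: "x = y" if "x \<in> ?D" "y \<in> ?D" for x y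
  proof -
    have r: "x \<in> {0..<?m}" "y \<in> {0..<?m}" using that by simp_all
    have "d x = w \<and> d (x + 1) = b \<or> d x = b \<and> d (x + 1) = w"
      "d y = w \<and> d (y + 1) = b \<or> d y = b \<and> d (y + 1) = w" using that by simp_all
    then have "d x = d y \<or> d x = w \<and> d (x + 1) = b \<and> d y = b \<and> d (y + 1) = w \<or>
        d y = w \<and> d (y + 1) = b \<and> d x = b \<and> d (x + 1) = w" by (elim disjE conjE) simp_all
    with r show ?thesis using eq[of x y] no[of x y] no[of y x] by blast
  qed
  have "card ?D \<le> Suc 0"
    by (intro card_le_Suc0_iff_eq[THEN iffD2, OF finite_cnt] ballI) (rule uniq)
  moreover have "{0..<?m} = ?C \<union> ?D" using S[OF cyc_adj[OF d(1)]] by blast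
  then have "card {0..<?m} \<le> card ?C + card ?D" using card_Un_le[of ?C ?D] by (simp only:)
  ultimately show ?thesis using cyc_cover[OF d(1) assms(3)] by simp
qed

text \<open>The length bound is taken from a second graph, which is \<open>G\<close> itself or \<open>G\<close> minus a vertex.\<close>

definition good_triple :: "'a graph \<Rightarrow> 'a graph \<Rightarrow> bool" where
  "good_triple G H \<longleftrightarrow> (\<exists>L S. 3 \<le> L \<and> card S = 3 \<and> S \<subseteq> verts G \<and> (\<forall>xs. is_cycle H xs \<longrightarrow> length xs \<le> L) \<and>
     (\<forall>v\<in>S. \<forall>l. 3 \<le> l \<longrightarrow> l \<le> L \<longrightarrow> on_cycle G v l))"

lemma good_tripleI:
  assumes "3 \<le> L" "card S = 3" "S \<subseteq> verts G" "\<And>xs. is_cycle H xs \<Longrightarrow> length xs \<le> L"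
    and "\<And>v l. v \<in> S \<Longrightarrow> 3 \<le> l \<Longrightarrow> l \<le> L \<Longrightarrow> on_cycle G v l"
  shows "good_triple G H"
  unfolding good_triple_def by (intro exI[of _ L] exI[of _ S]) (use assms in blast)

text \<open>The classes are named so that \<open>A\<close> is the smaller one. It covers all edges
  of the graph without \<open>u\<close>, so cycles there have length at most 2 |A|, within the range
  reached by the three vertices.\<close>

lemma near_bipartite:
  assumes G: "simple_graph G" "\<not> bipartite G" and u: "u \<in> verts G"
    and bip: "bipartite (del G {u})"
    and n: "card (verts G) = n" and size: "(n - 1)\<^sup>2 div 4 + 2 \<le> card (edges G)"
    and low: "2 * card (nbh G u) \<le> n - 1" and noBT: "5 \<le> n \<Longrightarrow> \<not> BT_form G n"
  shows "good_triple G (del G {u})"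
proof -
  have main: "good_triple G (del G {u})"
    if AB: "A \<union> B = verts G - {u}" "A \<inter> B = {}" "card A \<le> card B"
      and b: "\<And>x y. adj (del G {u}) x y \<Longrightarrow> x \<in> A \<longleftrightarrow> y \<in> B" for A B
  proof -
    have n_b: "1 \<le> card A \<and> (\<exists>S. card S = 3 \<and> S \<subseteq> verts G \<and>
        (\<forall>v\<in>S. \<forall>l. 3 \<le> l \<longrightarrow> l \<le> 2 * card A + 1 \<longrightarrow> on_cycle G v l))"
      by (rule near_bipartite_ordered[OF G u AB _ n size low]) (fact b, fact noBT)
    obtain S where S: "card S = 3" "S \<subseteq> verts G"
      "\<forall>v\<in>S. \<forall>l. 3 \<le> l \<longrightarrow> l \<le> 2 * card A + 1 \<longrightarrow> on_cycle G v l"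
      using conjunct2[OF n_b] by (elim exE conjE)
    have fA: "finite A" by (rule finite_subset[OF _ simple_finite[OF G(1)]]) (use AB(1) in blast)
    have cov: "x \<in> A \<or> y \<in> A" if xy: "adj (del G {u}) x y" for x y
    proof -
      have "y \<in> A \<union> B" using adj_in(2)[OF del_simple[OF G(1)] xy] AB(1) by (simp only: verts_del)
      then show ?thesis using b[OF xy] by blast
    qed
    have "length xs \<le> 2 * card A" if "is_cycle (del G {u}) xs" for xs
      by (rule cycle_length_cover[OF del_simple[OF G(1)] that fA]) (rule cov)
    then have "length xs \<le> 2 * card A + 1" if "is_cycle (del G {u}) xs" for xs
      using that by (simp add: le_SucI)
    moreover have "3 \<le> 2 * card A + 1" using n_b by linarith
    ultimately show ?thesis using S(3) by (intro good_tripleI[OF _ S(1,2)]) blast+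
  qed
  obtain A B where AB: "A \<union> B = verts (del G {u})" "A \<inter> B = {}"
    "\<And>x y. adj (del G {u}) x y \<Longrightarrow> x \<in> A \<longleftrightarrow> y \<in> B"
    using bipartite_adj[OF del_simple[OF G(1)] bip] by blast
  have sw: "x \<in> B \<longleftrightarrow> y \<in> A" if "adj (del G {u}) x y" for x y
    using AB(3)[of y x] that by (metis adj_sym)
  show ?thesis
  proof (cases "card A \<le> card B")
    case True
    show ?thesis by (rule main[of A B]) (use AB True in auto)
  next
    case False
    show ?thesis by (rule main[of B A, OF _ _ _ sw]) (use AB False in auto)
  qed
qed

lemma complete_path:
  assumes "finite A" "finite B" "A \<inter> B = {}" "\<And>x y. x \<in> A \<Longrightarrow> y \<in> B \<Longrightarrow> adj G x y"
    and "a \<in> A" "b \<in> B" "1 \<le> j" "j \<le> card A" "j \<le> card B"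
  shows "\<exists>xs. gpath G (A \<union> B) a b xs \<and> length xs = 2 * j"
proof (cases "j = 1")
  case True
  have "gpath G (A \<union> B) a b [a, b]" unfolding gpath_def using assms(3-6) by auto
  then show ?thesis using True by (intro exI[of _ "[a, b]"]) simp
next
  case False
  have "{(x, y) \<in> A \<times> B. \<not> adj G x y} = {}" using assms(4) by blast
  then have "missing G A B = 0" unfolding missing_def by (simp only: card.empty)
  then show ?thesis
    by (intro even_path[OF assms(1-3) assms(8,9) _ assms(5,6)]) (use False assms(7) in auto)
qed

text \<open>A path from \<open>a\<close> to \<open>x\<close> between different classes has an even
  number of vertices, and closing it through the two outside vertices \<open>w\<close> and
  \<open>u\<close> keeps the length even.\<close>

lemma outside_edge_even_cycle:
  assumes G: "simple_graph G" and AB: "finite A" "finite B" "A \<inter> B = {}"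
    and comp: "\<And>x y. x \<in> A \<Longrightarrow> y \<in> B \<Longrightarrow> adj G x y"
    and xy: "a \<in> A" "x \<in> B" "adj G w a" "adj G u x" "adj G u w" "u \<notin> A \<union> B" "w \<notin> A \<union> B"
    and l: "even l" "4 \<le> l" "l \<le> 2 * card A" "l \<le> 2 * card B"
  shows "on_cycle G w l"
proof -
  obtain j where j: "l = 2 * j" using l(1) by blast
  have "\<exists>xs. gpath G (A \<union> B) a x xs \<and> length xs = 2 * (j - 1)"
    by (rule complete_path[OF AB comp xy(1,2)]) (use j l in auto)
  then obtain xs where xs: "gpath G (A \<union> B) a x xs" "length xs = 2 * (j - 1)" by blast
  have p: "gpath G (insert w (A \<union> B)) w x (w # xs)" by (rule gpath_Cons[OF xs(1) xy(3,7)])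
  have "u \<noteq> w" using adj_in(3)[OF G xy(5)] .
  then have "is_cycle G (u # w # xs)"
    by (intro gpath_through[OF G p xy(5,4)]) (use xy(6) xs(2) j l in auto)
  moreover have "length (u # w # xs) = l" using xs(2) j l by simp
  ultimately show ?thesis unfolding on_cycle_def by (metis list.set_intros(1,2))
qed

text \<open>Being adjacent to exactly \<open>A\<close>, the vertex \<open>u\<close> is one more
  vertex of the class \<open>B\<close>, away from the attached triangle.\<close>

lemma BT_form_extend:
  assumes "A \<inter> B = {}" "w \<notin> A \<union> B" "verts G = insert u (insert w (A \<union> B))" "u \<notin> insert w (A \<union> B)"
    and "a \<in> A" "b \<in> B" "finite B" "card A = (n - 1) div 2" "card B + 1 = n div 2"
    and "\<And>x y. x \<in> A \<Longrightarrow> y \<in> B \<Longrightarrow> adj G x y" "\<And>x y. x \<in> A \<Longrightarrow> y \<in> A \<Longrightarrow> \<not> adj G x y"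
      "\<And>x y. x \<in> B \<Longrightarrow> y \<in> B \<Longrightarrow> \<not> adj G x y" "\<And>v. v \<in> A \<union> B \<Longrightarrow> adj G w v \<longleftrightarrow> v = a \<or> v = b"
      "\<And>v. adj G u v \<longleftrightarrow> v \<in> A"
  shows "BT_form G n"
  unfolding BT_form_def
proof (rule exI[of _ A], rule exI[of _ "insert u B"], rule exI[of _ w], rule exI[of _ a],
    rule exI[of _ b], intro conjI)
  have us: "adj G v u \<longleftrightarrow> v \<in> A" for v using assms(14)[of v] adj_sym[of G v u] by simp
  have uAB: "u \<notin> A" "u \<notin> B" "u \<noteq> w" using assms(4) by auto
  show "A \<inter> insert u B = {}" "w \<notin> A \<union> insert u B" "verts G = insert w (A \<union> insert u B)"
    "a \<in> A" "b \<in> insert u B" "card A = (n - 1) div 2" using assms by auto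
  show "card (insert u B) = n div 2" using assms(7,9) uAB by simp
  show "\<forall>x\<in>A. \<forall>y\<in>insert u B. adj G x y" using assms(10) us by simp
  show "\<forall>x\<in>A. \<forall>y\<in>A. \<not> adj G x y" using assms(11) by simp
  show "\<forall>x\<in>insert u B. \<forall>y\<in>insert u B. \<not> adj G x y"
    using assms(1,12,14) us uAB by auto
  show "\<forall>v\<in>A \<union> insert u B. adj G w v \<longleftrightarrow> v = a \<or> v = b"
  proof
    fix v assume v: "v \<in> A \<union> insert u B"
    show "adj G w v \<longleftrightarrow> v = a \<or> v = b"
    proof (cases "v = u")
      case True
      then show ?thesis using us[of w] assms(2,5,6) uAB by auto
    next
      case False
      then show ?thesis using assms(13)[of v] v by blast
    qed
  qed
qed

text \<open>Counting edges leaves a single value for the degree of \<open>u\<close>, namely |B|. The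
  vertices \<open>a\<close> and \<open>b\<close> lie on cycles of all lengths up to 2 |A| + 1, so
  one more vertex suffices: \<open>w\<close> or a neighbour of \<open>u\<close>. If all neighbours
  of \<open>u\<close> lie in one class, they are the whole class and the graph is BT(n), which is
  excluded.\<close>

lemma BT_vertex:
  assumes G: "simple_graph G" and u: "u \<in> verts G"
    and n: "card (verts G) = n" "6 \<le> n" and size: "(n - 1)\<^sup>2 div 4 + 2 \<le> card (edges G)"
    and low: "2 * card (nbh G u) \<le> n - 1"
    and BT: "BT_form (del G {u}) (n - 1)" and noBT: "\<not> BT_form G n"
  shows "good_triple G (del G {u})"
proof -
  let ?H = "del G {u}" and ?N = "nbh G u"
  define P Q where "P = (n - 2) div 2" and "Q = (n - 1) div 2"
  have H: "simple_graph ?H" by (rule del_simple[OF G])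
  obtain A B w a b where AB: "A \<inter> B = {}" and w: "w \<notin> A \<union> B" and vH: "verts ?H = insert w (A \<union> B)"
    and cAB: "card A = (n - 1 - 1) div 2" "card B = (n - 1) div 2" and ab: "a \<in> A" "b \<in> B"
    and comp: "\<forall>x\<in>A. \<forall>y\<in>B. adj ?H x y" and noA: "\<forall>x\<in>A. \<forall>y\<in>A. \<not> adj ?H x y"
    and noB: "\<forall>x\<in>B. \<forall>y\<in>B. \<not> adj ?H x y" and wab: "\<forall>v\<in>A \<union> B. adj ?H w v \<longleftrightarrow> v = a \<or> v = b"
    using BT unfolding BT_form_def by (elim exE conjE)
  have vG: "verts G = insert u (insert w (A \<union> B))" using vH u by auto
  have u': "u \<notin> insert w (A \<union> B)" using vH[symmetric] by simp
  have wu: "w \<noteq> u" and uAB: "u \<notin> A \<union> B" using u' by auto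
  have fin: "finite A" "finite B" using simple_finite[OF H] unfolding vH by simp_all
  have cA: "card A = P" and cB: "card B = Q" using cAB n unfolding P_def Q_def by simp_all
  have adjH: "adj ?H x y \<longleftrightarrow> adj G x y" if "x \<in> insert w (A \<union> B)" "y \<in> insert w (A \<union> B)" for x y
    using that u' by auto
  have comp': "adj G x y" "adj G y x" if "x \<in> A" "y \<in> B" for x y
    using comp that by (simp_all add: adj_sym[of G y])
  have noA': "\<not> adj G x y" if "x \<in> A" "y \<in> A" for x y using noA that adjH[of x y] by blast
  have noB': "\<not> adj G x y" if "x \<in> B" "y \<in> B" for x y using noB that adjH[of x y] by blast
  have wab': "adj G w v \<longleftrightarrow> v = a \<or> v = b" if "v \<in> A \<union> B" for v
    using wab that adjH[of w v] by blast
  have wa: "adj G w a" "adj G w b" using wab' ab by simp_all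
  have miss0: "missing G A B = 0"
  proof -
    have "{(x, y) \<in> A \<times> B. \<not> adj G x y} = {}" using comp' by blast
    then show ?thesis unfolding missing_def by (simp only: card.empty)
  qed
  have PQ: "P + Q + 2 = n" "P \<le> Q" "Q \<le> P + 1" "2 \<le> P" unfolding P_def Q_def using n(2) by presburger+
  have sz: "(n - 1)\<^sup>2 div 4 = P * Q + Q"
  proof -
    have "Q = P \<or> Q = P + 1" using PQ by linarith
    then show ?thesis
    proof
      assume q: "Q = P"
      have "n - 1 = P + (P + 1)" using PQ q by linarith
      then show ?thesis using square_sum_div4[of P "P + 1"] q by simp
    next
      assume q: "Q = P + 1"
      have "n - 1 = Q + Q" using PQ q by linarith
      then show ?thesis using square_sum_div4[of Q Q] q by simp
    qed
  qed
  have nbw: "nbh ?H w = {a, b}"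
  proof
    show "nbh ?H w \<subseteq> {a, b}" 
    proof
      fix v assume "v \<in> nbh ?H w"
      then have wv: "adj ?H w v" unfolding nbh_def by simp
      then have "v \<in> A \<union> B" using adj_in(2,3)[OF H wv] unfolding vH by blast
      then show "v \<in> {a, b}" using wab wv by blast
    qed
    show "{a, b} \<subseteq> nbh ?H w" using wab ab unfolding nbh_def by blast
  qed
  have abne: "a \<noteq> b" using AB ab by blast
  have Hw: "A \<union> B = verts (del ?H {w})" using vH w by (simp only: verts_del) blast
  have "card (edges (del ?H {w})) + card {(x, y) \<in> A \<times> B. \<not> adj (del ?H {w}) x y} = card A * card B"
  proof (rule bip_edges[OF del_simple[OF H] Hw AB])
    fix x y assume xy: "adj (del ?H {w}) x y"
    then have "x \<in> A \<union> B" "y \<in> A \<union> B" using adj_in[OF del_simple[OF H] xy] unfolding Hw by blast+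
    then show "x \<in> A \<longleftrightarrow> y \<in> B" using xy noA' noB' AB by auto
  qed
  moreover have "{(x, y) \<in> A \<times> B. \<not> adj (del ?H {w}) x y} = {}" using comp' w uAB by auto
  then have "card {(x, y) \<in> A \<times> B. \<not> adj (del ?H {w}) x y} = 0" by (simp only: card.empty)
  ultimately have "card (edges ?H) = P * Q + 2"
    using edges_del_vertex[OF H, of w] abne unfolding nbw cA cB by simp
  then have d: "card ?N = Q"
    using edges_del_vertex[OF G, of u] size sz low PQ by linarith
  have Nsub: "?N \<subseteq> insert w (A \<union> B)" using nbh_subset[OF G, of u] vG by blast
  have len: "length xs \<le> 2 * P + 1" if xs: "is_cycle ?H xs" for xs
    unfolding cA[symmetric]
  proof (rule cycle_length_cover_except[OF H xs fin(1)])
    fix x y assume xy: "adj ?H x y"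
    have xyV: "x \<in> insert w (A \<union> B)" "y \<in> insert w (A \<union> B)" using adj_in(1,2)[OF H xy] unfolding vH .
    have yx: "adj ?H y x" using xy by (rule adj_sym[THEN iffD1])
    consider "x \<in> A \<or> y \<in> A" | "x \<in> B" "y \<in> B" | "x = w" "y = w" | "x = w" "y \<in> B" | "x \<in> B" "y = w"
      using xyV by blast
    then show "x \<in> A \<or> y \<in> A \<or> (x = w \<and> y = b) \<or> (x = b \<and> y = w)"
    proof cases
      case 1
      then show ?thesis by blast
    next
      case 2
      then show ?thesis using noB xy by blast
    next
      case 3
      then show ?thesis using adj_in(3)[OF H xy] by blast
    next
      case 4
      then have "y = a \<or> y = b" using wab xy by blast
      then show ?thesis using 4 ab by blast
    next
      case 5
      then have "x = a \<or> x = b" using wab yx by blast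
      then show ?thesis using 5 ab by blast
    qed
  qed
  have kAB: "P \<le> card A" "P \<le> card B" using cA cB PQ by simp_all
  have mP: "missing G A B + 2 \<le> P \<or> (missing G A B = 0 \<and> 1 \<le> P)" using miss0 PQ by simp
  have good: "on_cycle G x l \<and> on_cycle G y l \<and> (odd l \<longrightarrow> on_cycle G t l)"
    if "t \<notin> A \<union> B" "adj G t x" "adj G t y" "x \<in> A" "y \<in> B" "3 \<le> l" "l \<le> 2 * P + 1" for t x y l
    by (rule edge_on_all_cycles[OF G fin AB kAB mP that(1-5) comp'(1)[OF that(4,5)] that(6,7)])
  have triple: "good_triple G ?H"
    if v: "v \<in> verts G" "v \<noteq> a" "v \<noteq> b" "\<And>l. 3 \<le> l \<Longrightarrow> l \<le> 2 * P + 1 \<Longrightarrow> on_cycle G v l" for v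
  proof (rule good_tripleI[of "2 * P + 1" "{v, a, b}"])
    show "card {v, a, b} = 3" using v abne by simp
    show "{v, a, b} \<subseteq> verts G" using v ab vG by blast
    show "on_cycle G x l" if "x \<in> {v, a, b}" "3 \<le> l" "l \<le> 2 * P + 1" for x l
    proof -
      have "on_cycle G a l" "on_cycle G b l" using good[OF w wa ab that(2,3)] by blast+
      moreover have "on_cycle G v l" by (rule v(4)[OF that(2,3)])
      ultimately show ?thesis using that(1) by (elim insertE emptyE) (simp_all only:)
    qed
    show "3 \<le> 2 * P + 1" using PQ by simp
  qed (rule len)
  have wgood: "good_triple G ?H" if "\<And>l. even l \<Longrightarrow> 4 \<le> l \<Longrightarrow> l \<le> 2 * P \<Longrightarrow> on_cycle G w l"
  proof (rule triple[of w])
    fix l assume l: "3 \<le> l" "l \<le> 2 * P + 1"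
    show "on_cycle G w l"
    proof (cases "odd l")
      case True
      then show ?thesis using good[OF w wa ab l] by blast
    next
      case False
      then have "l \<noteq> 3" "l \<noteq> 2 * P + 1" by (auto simp del: One_nat_def)
      then show ?thesis using that[of l] False l by simp
    qed
  qed (use vG ab w in auto)
  show ?thesis
  proof (cases "w \<in> ?N")
    case True
    then have uw: "adj G u w" unfolding nbh_def by simp
    have "card {w} < card ?N" using d PQ by simp
    then obtain x where x: "x \<in> ?N" "x \<noteq> w" using exists_outside[OF finite_nbh[OF G]] by blast
    then have ux: "adj G u x" "x \<in> A \<union> B" using Nsub unfolding nbh_def by auto
    show ?thesis
    proof (rule wgood)
      fix l :: nat assume l: "even l" "4 \<le> l" "l \<le> 2 * P"
      then have l': "l \<le> 2 * card A" "l \<le> 2 * card B" using kAB by linarith+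
      show "on_cycle G w l"
      proof (cases "x \<in> B")
        case True
        show ?thesis
          by (rule outside_edge_even_cycle[OF G fin AB comp'(1) ab(1) True wa(1) ux(1) uw uAB w l(1,2) l'])
      next
        case False
        then have xA: "x \<in> A" using ux by blast
        have s: "B \<inter> A = {}" "u \<notin> B \<union> A" "w \<notin> B \<union> A" using AB uAB w by auto
        show ?thesis
          by (rule outside_edge_even_cycle[OF G fin(2,1) s(1) comp'(2) ab(2) xA wa(2) ux(1) uw s(2,3) l(1,2) l'(2,1)])
      qed
    qed
  next
    case False
    then have Nsub': "?N \<subseteq> A \<union> B" using Nsub by blast
    have ne1: "?N \<inter> A \<noteq> {}"
    proof
      assume "?N \<inter> A = {}"
      then have "?N \<subseteq> B" using Nsub' by blast
      then have "?N = B" using card_subset_eq[OF fin(2)] d cB by simp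
      then have uB: "adj G u v \<longleftrightarrow> v \<in> B" for v unfolding nbh_def by blast
      have "BT_form G n"
      proof (rule BT_form_extend[of B A w _ u b a])
        show "B \<inter> A = {}" "w \<notin> B \<union> A" "verts G = insert u (insert w (B \<union> A))"
          "u \<notin> insert w (B \<union> A)" using AB w vG u' by auto
        show "card B = (n - 1) div 2" by (rule cAB(2))
        show "card A + 1 = n div 2" unfolding cA P_def using n by presburger
        show "adj G w v \<longleftrightarrow> v = b \<or> v = a" if "v \<in> B \<union> A" for v using wab'[of v] that by blast
      qed (use ab fin comp' noA' noB' uB in auto)
      then show False using noBT by blast
    qed
    have ne2: "?N \<inter> B \<noteq> {}"
    proof
      assume "?N \<inter> B = {}"
      then have s: "?N \<subseteq> A" using Nsub' by blast
      then have "Q \<le> P" using card_mono[OF fin(1) s] d cA by simp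
      then have pq: "P = Q" using PQ by simp
      then have "?N = A" using card_subset_eq[OF fin(1) s] d cA by simp
      then have uA: "adj G u v \<longleftrightarrow> v \<in> A" for v unfolding nbh_def by blast
      have "BT_form G n"
      proof (rule BT_form_extend[of A B w _ u a b])
        show "card A = (n - 1) div 2" unfolding cA pq Q_def by (rule refl)
        show "card B + 1 = n div 2" unfolding cB using PQ pq by presburger
        show "adj G w v \<longleftrightarrow> v = a \<or> v = b" if "v \<in> A \<union> B" for v by (rule wab'[OF that])
      qed (use AB w vG u' ab fin comp' noA' noB' uA in auto)
      then show False using noBT by blast
    qed
    obtain x y where xy: "x \<in> ?N" "x \<in> A" "y \<in> ?N" "y \<in> B" using ne1 ne2 by blast
    have third: "good_triple G ?H" if v: "v \<in> ?N" "v \<noteq> a" "v \<noteq> b" for v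
    proof (rule triple[OF _ v(2,3)])
      show "v \<in> verts G" using v(1) Nsub' vG by blast
      fix l assume l: "3 \<le> l" "l \<le> 2 * P + 1"
      have u1: "adj G u v" "adj G u x" "adj G u y" using v(1) xy unfolding nbh_def by simp_all
      have "v \<in> A \<or> v \<in> B" using v(1) Nsub' by blast
      then show "on_cycle G v l"
        using good[OF uAB u1(1) u1(3) _ xy(4) l] good[OF uAB u1(2) u1(1) xy(2) _ l] by blast
    qed
    show ?thesis
    proof (cases "?N \<subseteq> {a, b}")
      case False
      then show ?thesis using third by blast
    next
      case True
      \<comment> \<open>Here \<open>u\<close> and \<open>w\<close> have the same neighbours. The
        degree of \<open>u\<close> forces classes of size two, so 4 is the only even length to be
        found.\<close>
      then have "x = a" "y = b" using xy AB ab by auto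
      then have uab: "adj G u a" "adj G u b" using xy unfolding nbh_def by simp_all
      have "Q \<le> 2" using card_mono[OF _ True] abne d by simp
      then have "P = 2" using PQ by simp
      show ?thesis
      proof (rule wgood)
        fix l :: nat assume "even l" "4 \<le> l" "l \<le> 2 * P"
        then have l: "l = 4" using \<open>P = 2\<close> by simp
        have "is_cycle G [w, a, u, b]"
          by (rule is_cycle_successively[OF G])
            (use wa uab abne wu w uAB ab in \<open>auto simp: adj_sym[of G a u] adj_sym[of G b w]\<close>)
        then show "on_cycle G w l" unfolding on_cycle_def l by (intro exI[of _ "[w, a, u, b]"]) simp
      qed
    qed
  qed
qed

text \<open>The prescribed value serves to send the ends of the shared edge to \<open>0\<close> and
  \<open>(n - 1) div 2\<close>, the vertices that \<open>BT\<close> singles out.\<close>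

lemma bij_betw_pointed:
  assumes "finite X" "finite Y" "card X = card Y" "x \<in> X" "y \<in> Y"
  obtains f where "bij_betw f X Y" "f x = y"
proof -
  have "card (X - {x}) = card (Y - {y})" using assms by simp
  then obtain g where g: "bij_betw g (X - {x}) (Y - {y})"
    using finite_same_card_bij[of "X - {x}" "Y - {y}"] assms by blast
  let ?f = "g(x := y)"
  have "bij_betw ?f (X - {x}) (Y - {y})" using g by (rule bij_betw_cong[THEN iffD1, rotated]) simp
  then have "bij_betw ?f ((X - {x}) \<union> {x}) ((Y - {y}) \<union> {?f x})"
    by (intro notIn_Un_bij_betw) simp_all
  moreover have "(X - {x}) \<union> {x} = X" "(Y - {y}) \<union> {?f x} = Y" using assms(4,5) by auto
  ultimately show thesis by (intro that[of ?f]) simp_all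
qed

lemma BT_form_iso:
  assumes G: "simple_graph G" and n: "5 \<le> n" and BT: "BT_form G n"
  shows "graph_iso G (BT n)"
proof -
  obtain A B w a b where AB: "A \<inter> B = {}" and w: "w \<notin> A \<union> B" and vG: "verts G = insert w (A \<union> B)"
    and cAB: "card A = (n - 1) div 2" "card B = n div 2" and ab: "a \<in> A" "b \<in> B"
    and comp: "\<forall>x\<in>A. \<forall>y\<in>B. adj G x y" and noA: "\<forall>x\<in>A. \<forall>y\<in>A. \<not> adj G x y"
    and noB: "\<forall>x\<in>B. \<forall>y\<in>B. \<not> adj G x y" and wab: "\<forall>v\<in>A \<union> B. adj G w v \<longleftrightarrow> v = a \<or> v = b"
    using BT unfolding BT_form_def by (elim exE conjE)
  let ?p = "(n - 1) div 2" and ?q = "n div 2"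
  have pq: "?p + ?q = n - 1" "0 < ?p" "0 < ?q" using n by presburger+
  have fin: "finite A" "finite B" using simple_finite[OF G] unfolding vG by simp_all
  obtain f where f: "bij_betw f A {..<?p}" "f a = 0"
    by (rule bij_betw_pointed[of A "{..<?p}" a 0]) (use fin cAB ab pq in auto)
  obtain h where h: "bij_betw h B {?p..<?p + ?q}" "h b = ?p"
  proof (rule bij_betw_pointed[of B "{?p..<?p + ?q}" b ?p])
    show "card B = card {?p..<?p + ?q}"
      unfolding cAB(2) by (simp only: card_atLeastLessThan add_diff_cancel_left')
  qed (use fin ab pq in auto)
  define F where "F v = (if v = w then n - 1 else if v \<in> A then f v else h v)" for v
  have FA: "F v = f v" if "v \<in> A" for v using that w unfolding F_def by auto
  have FB: "F v = h v" if "v \<in> B" for v using that w AB unfolding F_def by auto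
  have Fw: "F w = n - 1" unfolding F_def by simp
  have bA: "bij_betw F A {..<?p}" using f(1) FA by (simp cong: bij_betw_cong)
  have bB: "bij_betw F B {?p..<?p + ?q}" using h(1) FB by (simp cong: bij_betw_cong)
  have "bij_betw F (A \<union> B) ({..<?p} \<union> {?p..<?p + ?q})" by (rule bij_betw_combine[OF bA bB]) auto
  then have "bij_betw F ((A \<union> B) \<union> {w}) (({..<?p} \<union> {?p..<?p + ?q}) \<union> {F w})"
    by (intro notIn_Un_bij_betw) (use w pq in \<open>auto simp: Fw\<close>)
  moreover have "(A \<union> B) \<union> {w} = verts G" using vG by blast
  moreover have "({..<?p} \<union> {?p..<?p + ?q}) \<union> {F w} = verts (BT n)"
    using pq unfolding Fw BT_def complete_bipartite_def Let_def by auto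
  ultimately have bij: "bij_betw F (verts G) (verts (BT n))" by (simp only:)
  have Fa: "F v < ?p" "F v = 0 \<longleftrightarrow> v = a" if "v \<in> A" for v
  proof -
    show "F v < ?p" using bij_betw_apply[OF bA that] by simp
    have "F a = 0" using f(2) FA ab by simp
    then show "F v = 0 \<longleftrightarrow> v = a" using inj_onD[OF bij_betw_imp_inj_on[OF bA] _ that ab(1)] by auto
  qed
  have Fb: "?p \<le> F v" "F v < ?p + ?q" "F v = ?p \<longleftrightarrow> v = b" if "v \<in> B" for v
  proof -
    show "?p \<le> F v" "F v < ?p + ?q" using bij_betw_apply[OF bB that] by simp_all
    have "F b = ?p" using h(2) FB ab by simp
    then show "F v = ?p \<longleftrightarrow> v = b" using inj_onD[OF bij_betw_imp_inj_on[OF bB] _ that ab(2)] by auto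
  qed
  have edge: "{x, y} \<in> edges (BT n) \<longleftrightarrow> x < ?p \<and> ?p \<le> y \<and> y < ?p + ?q \<or> y < ?p \<and> ?p \<le> x \<and> x < ?p + ?q \<or>
      x = n - 1 \<and> (y = 0 \<or> y = ?p) \<or> y = n - 1 \<and> (x = 0 \<or> x = ?p)" for x y
    unfolding BT_def complete_bipartite_def Let_def by (auto simp: doubleton_eq_iff)
  have "{u, v} \<in> edges G \<longleftrightarrow> {F u, F v} \<in> edges (BT n)" if uv: "u \<in> verts G" "v \<in> verts G" for u v
  proof -
    have ca: "adj G x y \<longleftrightarrow> {F x, F y} \<in> edges (BT n)" if "x \<in> A" "y \<in> verts G" for x y
    proof -
      consider "y \<in> A" | "y \<in> B" | "y = w" using \<open>y \<in> verts G\<close> vG by blast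
      then show ?thesis
      proof cases
        case 1
        then show ?thesis unfolding edge using noA that(1) Fa(1)[OF that(1)] Fa(1)[of y] pq by simp
      next
        case 2
        then show ?thesis unfolding edge using comp that(1) Fa(1)[OF that(1)] Fb(1,2)[of y] by simp
      next
        case 3
        have "adj G x y \<longleftrightarrow> x = a" using 3 wab that(1) AB ab adj_sym[of G x y] by auto
        then show ?thesis unfolding edge 3 Fw using Fa[OF that(1)] pq by auto
      qed
    qed
    have cb: "adj G x y \<longleftrightarrow> {F x, F y} \<in> edges (BT n)" if "x \<in> B" "y \<in> insert w B" for x y
    proof -
      consider "y \<in> B" | "y = w" using \<open>y \<in> insert w B\<close> by blast
      then show ?thesis
      proof cases
        case 1
        then show ?thesis unfolding edge using noB that(1) Fb(1,2)[OF that(1)] Fb(1,2)[of y] pq by simp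
      next
        case 2
        have "adj G x y \<longleftrightarrow> x = b" using 2 wab that(1) AB ab adj_sym[of G x y] by auto
        then show ?thesis unfolding edge 2 Fw using Fb[OF that(1)] pq by auto
      qed
    qed
    have cw: "\<not> adj G w w" "\<not> {F w, F w} \<in> edges (BT n)"
      using adj_in(3)[OF G, of w w] pq unfolding edge Fw by auto
    have sym: "{F u, F v} = {F v, F u}" "adj G u v \<longleftrightarrow> adj G v u" by (simp_all add: insert_commute adj_sym[of G u])
    consider "u \<in> A" | "v \<in> A" | "u \<in> B" "v \<in> insert w B" | "v \<in> B" "u \<in> insert w B" | "u = w" "v = w"
      using uv unfolding vG by blast
    then have "adj G u v \<longleftrightarrow> {F u, F v} \<in> edges (BT n)"
    proof cases
      case 1
      then show ?thesis by (rule ca[OF _ uv(2)])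
    next
      case 2
      then show ?thesis unfolding sym by (rule ca[OF _ uv(1)])
    next
      case 3
      then show ?thesis by (rule cb)
    next
      case 4
      then show ?thesis unfolding sym by (rule cb)
    next
      case 5
      then show ?thesis using cw by simp
    qed
    then show ?thesis unfolding adj_def .
  qed
  then show ?thesis unfolding graph_iso_def using bij by blast
qed

lemma reduce_low_vertex:
  fixes G :: "'a graph"
  assumes G: "simple_graph G" "\<not> bipartite G" and u: "u \<in> verts G"
    and n: "card (verts G) = n" "4 \<le> n" and size: "(n - 1)\<^sup>2 div 4 + 2 \<le> card (edges G)"
    and low: "2 * card (nbh G u) \<le> n - 1" and noBT: "5 \<le> n \<Longrightarrow> \<not> BT_form G n"
    and IH: "\<And>H :: 'a graph. simple_graph H \<Longrightarrow> \<not> bipartite H \<Longrightarrow> card (verts H) = n - 1 \<Longrightarrow>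
      (n - 1 - 1)\<^sup>2 div 4 + 2 \<le> card (edges H) \<Longrightarrow> (5 \<le> n - 1 \<Longrightarrow> \<not> BT_form H (n - 1)) \<Longrightarrow> good_triple H H"
  shows "good_triple G (del G {u})"
proof -
  consider "bipartite (del G {u})" | "5 \<le> n - 1" "BT_form (del G {u}) (n - 1)"
    | "\<not> bipartite (del G {u})" "5 \<le> n - 1 \<longrightarrow> \<not> BT_form (del G {u}) (n - 1)" by blast
  then show ?thesis
  proof cases
    case 1
    then show ?thesis by (rule near_bipartite[OF G u _ n(1) size low noBT])
  next
    case 2
    then have "6 \<le> n" "\<not> BT_form G n" using noBT by simp_all
    then show ?thesis by (intro BT_vertex[OF G(1) u n(1) _ size low 2(2)])
  next
    case 3
    have "(n - 1)\<^sup>2 div 4 = (n - 1 - 1)\<^sup>2 div 4 + (n - 1) div 2"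
    proof -
      have "\<exists>k. n = 2 * k + 2 \<or> n = 2 * k + 3" using n(2) by presburger
      then obtain k where "n = 2 * k + 2 \<or> n = 2 * k + 3" by blast
      then show ?thesis
      proof
        assume k: "n = 2 * k + 2"
        have "(n - 1)\<^sup>2 = (k * k + k) * 4 + 1" "(n - 1 - 1)\<^sup>2 = (k * k) * 4"
          unfolding k by (simp_all add: power2_eq_square algebra_simps)
        moreover have "(n - 1) div 2 = k" unfolding k by simp
        ultimately show ?thesis by simp
      next
        assume k: "n = 2 * k + 3"
        have "(n - 1)\<^sup>2 = (k * k + 2 * k + 1) * 4" "(n - 1 - 1)\<^sup>2 = (k * k + k) * 4 + 1"
          unfolding k by (simp_all add: power2_eq_square algebra_simps)
        moreover have "(n - 1) div 2 = k + 1" unfolding k by simp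
        ultimately show ?thesis by simp
      qed
    qed
    then have sz: "(n - 1 - 1)\<^sup>2 div 4 + 2 \<le> card (edges (del G {u}))"
      using size low edges_del_vertex[OF G(1), of u] by linarith
    have "card (verts (del G {u})) = n - 1" using n u simple_finite[OF G(1)] by simp
    then have "good_triple (del G {u}) (del G {u})"
      by (intro IH[OF del_simple[OF G(1)] 3(1) _ sz]) (use 3(2) in blast)+
    then obtain L S where L: "3 \<le> L" "card S = 3" "S \<subseteq> verts (del G {u})"
      "\<forall>xs. is_cycle (del G {u}) xs \<longrightarrow> length xs \<le> L"
      "\<forall>v\<in>S. \<forall>l. 3 \<le> l \<longrightarrow> l \<le> L \<longrightarrow> on_cycle (del G {u}) v l"
      unfolding good_triple_def by (elim exE conjE)
    show ?thesis
    proof (rule good_tripleI[OF L(1,2)])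
      show "S \<subseteq> verts G" using L(3) by auto
      show "length xs \<le> L" if "is_cycle (del G {u}) xs" for xs using L(4) that by blast
      show "on_cycle G v l" if "v \<in> S" "3 \<le> l" "l \<le> L" for v l
        by (rule on_cycle_del[of G "{u}"]) (use L(5) that in blast)
    qed
  qed
qed

section \<open>Nonhamiltonian graphs\<close>

text \<open>The path \<open>ws\<close> replaces the \<open>t\<close> vertices strictly between its
  attachments \<open>c (- 1)\<close> and \<open>c t\<close>. Indices from \<open>t - m\<close> to
  \<open>- 1\<close> make the kept arc a single segment.\<close>

lemma cyc_detour:
  assumes G: "simple_graph G" and c: "cyc G m c" and t: "0 \<le> t" "t < m"
    and ws: "ws \<noteq> []" "distinct ws" "successively (adj G) ws" "set ws \<inter> range c = {}"
    and ends: "adj G (last ws) (c (- 1))" "adj G (hd ws) (c t)"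
    and len: "3 \<le> int (length ws) + (m - t)"
  shows "is_cycle G (ws @ rev (seg c (t - m) (- 1)))"
    and "int (length (ws @ rev (seg c (t - m) (- 1)))) = int (length ws) + (m - t)"
proof -
  let ?P = "seg c (t - m) (- 1)"
  have ne: "?P \<noteq> []" by (rule seg_nonempty) (use t in simp)
  show l: "int (length (ws @ rev ?P)) = int (length ws) + (m - t)" using t by simp
  show "is_cycle G (ws @ rev ?P)"
  proof (rule is_cycle_successively[OF G])
    show "3 \<le> length (ws @ rev ?P)" using l len by linarith
    have "distinct ?P" by (rule distinct_seg[OF c]) (use t in simp)
    moreover have "set ws \<inter> set ?P = {}" using ws(4) by auto
    ultimately show "distinct (ws @ rev ?P)" using ws(2) by simp
    have "hd (rev ?P) = c (- 1)" using ne t by (simp add: hd_rev last_seg)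
    moreover have "successively (adj G) (rev ?P)"
      by (rule successively_adj_rev[THEN iffD2, OF successively_seg[OF c]])
    ultimately show "successively (adj G) (ws @ rev ?P)"
      using ws(3) ends(1) by (simp add: successively_append_iff del: successively_rev)
    have "last (ws @ rev ?P) = c (t - m)" using ne t by (simp add: last_rev hd_seg)
    also have "\<dots> = c t" by (rule cyc_period'[OF c])
    finally show "adj G (last (ws @ rev ?P)) (hd (ws @ rev ?P))"
      using ends(2) ws(1) adj_sym[of G "c t"] by simp
  qed
qed

lemma longest_path:
  assumes G: "simple_graph G" and ne: "verts G \<noteq> {}"
  obtains ws where "ws \<noteq> []" "distinct ws" "set ws \<subseteq> verts G" "successively (adj G) ws"
    "nbh G (hd ws) \<subseteq> set ws" "nbh G (last ws) \<subseteq> set ws"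
proof -
  define P where "P ws \<longleftrightarrow> ws \<noteq> [] \<and> distinct ws \<and> set ws \<subseteq> verts G \<and> successively (adj G) ws" for ws
  obtain v where v: "v \<in> verts G" using ne by blast
  have Pv: "P [v]" unfolding P_def using v by simp
  have bnd: "\<forall>ws. P ws \<longrightarrow> length ws < Suc (card (verts G))"
  proof (intro allI impI)
    fix ws assume "P ws"
    then have "distinct ws" "set ws \<subseteq> verts G" unfolding P_def by blast+
    then show "length ws < Suc (card (verts G))"
      using card_mono[OF simple_finite[OF G], of "set ws"] distinct_card[of ws] by simp
  qed
  obtain ws where ws: "P ws" "\<forall>ys. P ys \<longrightarrow> length ys \<le> length ws"
    using ex_has_greatest_nat[OF Pv bnd] by (elim exE conjE)
  have p: "ws \<noteq> []" "distinct ws" "set ws \<subseteq> verts G" "successively (adj G) ws"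
    using ws(1) unfolding P_def by blast+
  show thesis
  proof (rule that[OF p])
    show "nbh G (hd ws) \<subseteq> set ws"
    proof (rule subsetI, rule ccontr)
      fix x assume x: "x \<in> nbh G (hd ws)" "x \<notin> set ws"
      then have a: "adj G x (hd ws)" unfolding nbh_def by (simp add: adj_sym[of G x])
      have "P (x # ws)" unfolding P_def
        using p x(2) a adj_in(1)[OF G a] by (simp add: successively_Cons)
      then show False using ws(2) by fastforce
    qed
    show "nbh G (last ws) \<subseteq> set ws"
    proof (rule subsetI, rule ccontr)
      fix x assume x: "x \<in> nbh G (last ws)" "x \<notin> set ws"
      then have a: "adj G (last ws) x" unfolding nbh_def by simp
      have "P (ws @ [x])" unfolding P_def
        using p x(2) a adj_in(2)[OF G a] by (simp add: successively_append_iff)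
      then show False using ws(2) by fastforce
    qed
  qed
qed

text \<open>The neighbours of the end occupy distinct positive positions on the path, so the
  farthest is at a position not below the degree; the path up to it closes to a cycle.\<close>

lemma long_cycle_at_path_end:
  assumes G: "simple_graph G" and ws: "ws \<noteq> []" "distinct ws" "successively (adj G) ws"
    and end_nbh: "nbh G (hd ws) \<subseteq> set ws" and deg: "2 \<le> card (nbh G (hd ws))"
  shows "\<exists>xs. is_cycle G xs \<and> card (nbh G (hd ws)) + 1 \<le> length xs"
proof -
  let ?N = "nbh G (hd ws)"
  let ?I = "{i. i < length ws \<and> ws ! i \<in> ?N}"
  have finI: "finite ?I" by simp
  have img: "(\<lambda>i. ws ! i) ` ?I = ?N"
  proof
    show "?N \<subseteq> (\<lambda>i. ws ! i) ` ?I"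
    proof
      fix x assume x: "x \<in> ?N"
      then have "x \<in> set ws" using end_nbh by blast
      then obtain i where "i < length ws" "ws ! i = x" unfolding in_set_conv_nth by blast
      then show "x \<in> (\<lambda>i. ws ! i) ` ?I" using x by (intro image_eqI[of _ _ i]) simp_all
    qed
  qed blast
  have cI: "card ?N \<le> card ?I" using card_image_le[OF finI, of "\<lambda>i. ws ! i"] unfolding img .
  then have "card ?I \<noteq> 0" using deg by linarith
  then have "?I \<noteq> {}" by (intro notI) (simp only: card.empty)
  define k where "k = Max ?I"
  have kI: "k \<in> ?I" unfolding k_def by (rule Max_in[OF finI \<open>?I \<noteq> {}\<close>])
  then have k: "k < length ws" "adj G (hd ws) (ws ! k)" unfolding nbh_def by auto
  have "hd ws \<notin> ?N" using nbh_subset[OF G, of "hd ws"] by blast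
  then have "0 \<notin> ?I" using ws(1) by (simp add: hd_conv_nth)
  have "?I \<subseteq> {1..k}"
  proof
    fix i assume i: "i \<in> ?I"
    then have "i \<noteq> 0" using \<open>0 \<notin> ?I\<close> by (intro notI) (simp only:)
    moreover have "i \<le> k" unfolding k_def by (rule Max_ge[OF finI i])
    ultimately show "i \<in> {1..k}" by simp
  qed
  then have "card ?I \<le> k" using card_mono[of "{1..k}" ?I] by simp
  then have dk: "card ?N \<le> k" using cI by simp
  let ?xs = "take (Suc k) ws"
  have len: "length ?xs = Suc k" using k(1) by simp
  have "is_cycle G ?xs"
  proof (rule is_cycle_successively[OF G])
    show "3 \<le> length ?xs" using len dk deg by simp
    show "distinct ?xs" using ws(2) by simp
    have "successively (adj G) (?xs @ drop (Suc k) ws)" using ws(3) by simp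
    then show "successively (adj G) ?xs" unfolding successively_append_iff by blast
    have "last ?xs = ws ! k" using k(1) by (simp add: take_Suc_conv_app_nth)
    moreover have "hd ?xs = hd ws" using ws(1) by (simp add: hd_take)
    ultimately show "adj G (last ?xs) (hd ?xs)" using k(2) adj_sym[of G "hd ws"] by simp
  qed
  then show ?thesis using len dk by (intro exI[of _ ?xs]) simp
qed

text \<open>For an end \<open>u\<close> of a longest path off the cycle, the neighbours of \<open>u\<close> on the cycle are
  nonconsecutive and stay away from a whole interval after a neighbour of the other end.\<close>

lemma low_vertex_off_cycle:
  assumes G: "simple_graph G" and n: "card (verts G) = n" "3 \<le> n"
    and C: "is_cycle G xs" "\<And>ys. is_cycle G ys \<Longrightarrow> length ys \<le> length xs" "length xs \<noteq> n"
  shows "\<exists>u\<in>verts G. u \<notin> set xs \<and> 2 * card (nbh G u) \<le> n - 1"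
proof -
  let ?m = "int (length xs)"
  let ?H = "del G (set xs)"
  have dxs: "distinct xs" "set xs \<subseteq> verts G" using C(1) unfolding is_cycle_def by blast+
  have fin: "finite (verts G)" by (rule simple_finite[OF G])
  have cset: "card (set xs) = length xs" by (rule distinct_card[OF dxs(1)])
  have H: "simple_graph ?H" by (rule del_simple[OF G])
  have "verts ?H \<noteq> {}" using dxs(2) cset C(3) n by auto
  then obtain ws where ws: "ws \<noteq> []" "distinct ws" "set ws \<subseteq> verts ?H" "successively (adj ?H) ws"
    "nbh ?H (hd ws) \<subseteq> set ws" "nbh ?H (last ws) \<subseteq> set ws"
    using longest_path[OF H] by blast
  have sG: "successively (adj G) ws" using ws(4) by (rule successively_mono) simp
  have disj: "set ws \<inter> set xs = {}" "set ws \<subseteq> verts G" using ws(3) by auto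
  have "card (set xs \<union> set ws) = length xs + length ws"
    using cset distinct_card[OF ws(2)] disj by (subst card_Un_disjoint) auto
  then have tot: "length xs + length ws \<le> n"
    using card_mono[OF fin, of "set xs \<union> set ws"] dxs(2) disj(2) n(1) by simp
  have w_in: "hd ws \<in> set ws" "last ws \<in> set ws" using ws(1) by simp_all
  have nbH: "nbh ?H v = nbh G v - set xs" if "v \<in> set ws" for v
    using disj(1) that unfolding nbh_def by auto
  have path_deg: "card (nbh ?H (hd ps)) + 1 \<le> length ps"
    if ps: "ps \<noteq> []" "distinct ps" "nbh ?H (hd ps) \<subseteq> set ps" for ps
  proof -
    have "nbh ?H (hd ps) \<subseteq> set ps - {hd ps}" using nbh_subset[OF H, of "hd ps"] ps(3) by blast
    then have "card (nbh ?H (hd ps)) \<le> card (set ps - {hd ps})" by (intro card_mono) simp_all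
    moreover have "card (set ps - {hd ps}) + 1 = length ps"
      using ps(1) distinct_card[OF ps(2)] by (simp add: card_Diff_singleton Suc_leI card_gt_0_iff)
    ultimately show ?thesis by linarith
  qed
  \<comment> \<open>If an end sees no vertex of the cycle, its degree is less than the order of the
    path and, from degree 2 on, also less than the length of the longest cycle, since part of the
    path closes to a cycle. These two numbers add up to at most \<open>n\<close>.\<close>
  have low: "2 * card (nbh G (hd ps)) \<le> n - 1"
    if ps: "ps \<noteq> []" "distinct ps" "successively (adj ?H) ps" "nbh ?H (hd ps) \<subseteq> set ps"
      "set ps = set ws" "nbh G (hd ps) \<inter> set xs = {}" for ps
  proof -
    have eq: "nbh ?H (hd ps) = nbh G (hd ps)" 
    proof -
      have "hd ps \<in> set ws" using ps(1) unfolding ps(5)[symmetric] by simp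
      then show ?thesis using nbH[of "hd ps"] ps(6) by blast
    qed
    have l: "length ps = length ws" 
      using distinct_card[OF ps(2)] distinct_card[OF ws(2)] ps(5) by simp
    have d1: "card (nbh G (hd ps)) + 1 \<le> length ws" using path_deg[OF ps(1,2,4)] unfolding eq l .
    have d2: "card (nbh G (hd ps)) + 1 \<le> length xs" if "2 \<le> card (nbh G (hd ps))"
    proof -
      have "2 \<le> card (nbh ?H (hd ps))" using that unfolding eq .
      then obtain ys where ys: "is_cycle ?H ys" "card (nbh ?H (hd ps)) + 1 \<le> length ys"
        using long_cycle_at_path_end[OF H ps(1-4)] by blast
      then show ?thesis using C(2)[OF is_cycle_del[OF ys(1)]] unfolding eq by linarith
    qed
    show ?thesis
    proof (cases "2 \<le> card (nbh G (hd ps))")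
      case True
      then show ?thesis using d1 d2[OF True] tot by linarith
    next
      case False
      then show ?thesis using n(2) by linarith
    qed
  qed
  obtain u where "u \<in> set ws" "2 * card (nbh G u) \<le> n - 1"
  proof (cases "nbh G (hd ws) \<inter> set xs = {} \<or> nbh G (last ws) \<inter> set xs = {}")
    case True
    then show thesis
    proof
      assume "nbh G (hd ws) \<inter> set xs = {}"
      then show thesis using that[OF w_in(1)] low[OF ws(1,2,4,5)] by blast
    next
      assume "nbh G (last ws) \<inter> set xs = {}"
      moreover have "successively (adj ?H) (rev ws)"
        by (rule successively_adj_rev[THEN iffD2, OF ws(4)])
      ultimately have "2 * card (nbh G (hd (rev ws))) \<le> n - 1"
        by (intro low) (use ws in \<open>simp_all add: hd_rev del: successively_rev\<close>)
      then show thesis using that[OF w_in(2)] ws(1) by (simp add: hd_rev)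
    qed
  next
    case False
    then obtain y where y: "y \<in> nbh G (last ws)" "y \<in> set xs" by blast
    obtain c0 where c0: "cyc G ?m c0" "range c0 = set xs" using is_cycle_imp_cyc[OF C(1)] by blast
    obtain j where j: "c0 j = y" using y(2) unfolding c0(2)[symmetric] by (elim imageE) simp
    \<comment> \<open>The cycle is rotated so that a neighbour of the last path vertex sits at index
      - 1.\<close>
    define c where "c i = c0 (i + (j + 1))" for i
    have c: "cyc G ?m c" unfolding c_def by (rule cyc_shift[OF c0(1)])
    have rc: "range c = set xs" unfolding c_def range_shift c0(2) ..
    have cy: "c (- 1) = y" unfolding c_def using j by simp
    have m: "3 \<le> ?m" using c unfolding cyc_def by blast
    let ?w = "hd ws"
    define N where "N i \<longleftrightarrow> adj G ?w (c i)" for i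
    have perN: "N (i + ?m) = N i" for i unfolding N_def using cyc_period[OF c, of i] by simp
    have w_out: "?w \<notin> range c" using w_in(1) disj(1) unfolding rc by blast
    have short: "int (length ys) \<le> ?m" if "is_cycle G ys" for ys using C(2)[OF that] by simp
    have no2: "\<not> (N i \<and> N (i + 1))" for i
    proof
      assume a: "N i \<and> N (i + 1)"
      have "c (i + 1 + (?m - 1)) = c i" using cyc_period[OF c, of i] by simp
      then have "is_cycle G (?w # seg c (i + 1) (i + 1 + (?m - 1)))"
        by (intro cyc_insert[OF G c w_out]) (use a m in \<open>auto simp: N_def\<close>)
      then show False using short[of "?w # seg c (i + 1) (i + 1 + (?m - 1))"] m by simp
    qed
    let ?p = "int (length ws)"
    \<comment> \<open>A neighbour of \<open>?w\<close> this close after \<open>c (- 1)\<close> would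
      let the path replace fewer vertices than it has, against the choice of the longest
      cycle.\<close>
    have gap: "\<not> N t" if t: "0 \<le> t" "t < ?p" "t < ?m" for t
    proof
      assume a: "N t"
      have s: "set ws \<inter> range c = {}" using disj(1) unfolding rc .
      have e: "adj G (last ws) (c (- 1))" using y(1) cy unfolding nbh_def by simp
      have l: "3 \<le> ?p + (?m - t)" using m t by linarith
      note D = cyc_detour[OF G c t(1,3) ws(1,2) sG s e a[unfolded N_def] l]
      show False using short[OF D(1)] D(2) t(2) by linarith
    qed
    let ?R = "\<lambda>i. N i \<or> N (i + 1)"
    have "cnt ?m ?R = cnt ?m N + cnt ?m (\<lambda>i. N (i + 1))" by (rule cnt_add) (rule no2)
    also have "cnt ?m (\<lambda>i. N (i + 1)) = cnt ?m N" by (rule cnt_shift[where P = N]) (use m perN in auto)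
    finally have R2: "cnt ?m ?R = 2 * cnt ?m N" by simp
    have Nne: "\<exists>i. N i"
    proof -
      obtain z where "z \<in> nbh G ?w" "z \<in> range c" using False unfolding rc by blast
      then show ?thesis unfolding N_def nbh_def by (elim imageE) auto
    qed
    have pm: "?p \<le> ?m"
    proof (rule ccontr)
      assume pm: "\<not> ?p \<le> ?m"
      obtain i where "N i" using Nne by blast
      obtain i' where "0 \<le> i'" "i' < 0 + ?m" "c i' = c i" by (rule cyc_window_obtain[OF c])
      then show False using gap[of i'] pm \<open>N i\<close> unfolding N_def by simp
    qed
    have "cnt ?m ?R \<le> card {?p - 1..<?m}" unfolding cnt_def
    proof (rule card_mono)
      show "{i \<in> {0..<?m}. ?R i} \<subseteq> {?p - 1..<?m}"
      proof
        fix i assume i: "i \<in> {i \<in> {0..<?m}. ?R i}"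
        then have "\<not> i < ?p - 1" using gap[of i] gap[of "i + 1"] pm by auto
        then show "i \<in> {?p - 1..<?m}" using i by simp
      qed
    qed simp
    \<comment> \<open>Since \<open>?w\<close> has at most \<open>?p - 1\<close> neighbours off the
      cycle, twice its degree is then at most \<open>?m + ?p - 1\<close>.\<close>
    then have bound: "2 * int (cnt ?m N) + ?p \<le> ?m + 1" using R2 pm by simp
    have "card (nbh G ?w \<inter> set xs) = cnt ?m N"
    proof -
      have "nbh G ?w \<inter> set xs = c ` {i. N i}" unfolding rc[symmetric] nbh_def N_def by auto
      then show ?thesis using cnt_image[OF c, of N] perN by simp
    qed
    moreover have "nbh G ?w = (nbh G ?w \<inter> set xs) \<union> nbh ?H ?w" using nbH[OF w_in(1)] by blast
    then have "card (nbh G ?w) \<le> card (nbh G ?w \<inter> set xs) + card (nbh ?H ?w)"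
      using card_Un_le[of "nbh G ?w \<inter> set xs" "nbh ?H ?w"] by simp
    ultimately have "2 * card (nbh G ?w) \<le> n - 1"
      using bound path_deg[OF ws(1,2,5)] tot by linarith
    then show thesis by (rule that[OF w_in(1)])
  qed
  then show ?thesis using disj by blast
qed

text \<open>Graphs without cycles are included: there the end of a longest path has degree at most
  one and the survival of cycles is vacuous.\<close>

lemma low_vertex_nonhamiltonian:
  assumes G: "simple_graph G" and n: "card (verts G) = n" "3 \<le> n"
    and nham: "\<not> (\<exists>xs. is_cycle G xs \<and> length xs = n)"
  obtains u where "u \<in> verts G" "2 * card (nbh G u) \<le> n - 1"
    "\<And>xs. is_cycle G xs \<Longrightarrow> \<exists>ys. is_cycle (del G {u}) ys \<and> length xs \<le> length ys"
proof (cases "\<exists>xs. is_cycle G xs")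
  case True
  then obtain xs0 where xs0: "is_cycle G xs0" by blast
  have bnd: "\<forall>xs. is_cycle G xs \<longrightarrow> length xs < Suc n"
    using cycle_length_le[OF G] n(1) by (simp add: less_Suc_eq_le)
  obtain xs where xs: "is_cycle G xs" "\<forall>ys. is_cycle G ys \<longrightarrow> length ys \<le> length xs"
    using ex_has_greatest_nat[OF xs0 bnd] by (elim exE conjE)
  have "\<exists>u\<in>verts G. u \<notin> set xs \<and> 2 * card (nbh G u) \<le> n - 1"
    by (rule low_vertex_off_cycle[OF G n xs(1)]) (use xs nham in blast)+
  then obtain u where u: "u \<in> verts G" "u \<notin> set xs" "2 * card (nbh G u) \<le> n - 1" by blast
  have "is_cycle (del G {u}) xs" unfolding is_cycle_del_iff using xs(1) u(2) by simp
  then show thesis using xs(2) by (intro that[OF u(1,3)]) blast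
next
  case False
  have "verts G \<noteq> {}" using n by auto
  then obtain ws where ws: "ws \<noteq> []" "distinct ws" "set ws \<subseteq> verts G" "successively (adj G) ws"
    "nbh G (hd ws) \<subseteq> set ws" "nbh G (last ws) \<subseteq> set ws"
    using longest_path[OF G] by blast
  have "\<not> 2 \<le> card (nbh G (hd ws))"
    using long_cycle_at_path_end[OF G ws(1,2,4,5)] False by blast
  moreover have "hd ws \<in> verts G" using ws(1,3) hd_in_set by blast
  ultimately show thesis using False n(2) by (intro that[of "hd ws"]) auto
qed

section \<open>Vertices omitted by a long cycle\<close>

text \<open>More than half of the cycle vertices are neighbours of \<open>v\<close>, so the set of
  their indices meets its shift by \<open>l - 2\<close>. The \<open>l - 1\<close> vertices from one
  such neighbour to the other form the cycle together with \<open>v\<close>.\<close>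

lemma pancyclic_off_cycle:
  assumes G: "simple_graph G" and c: "cyc G m c" "v \<notin> range c"
    and deg: "m < 2 * int (cnt m (\<lambda>i. adj G v (c i)))" and l: "3 \<le> l" "int l \<le> m + 1"
  shows "on_cycle G v l"
proof -
  define N where "N i \<longleftrightarrow> adj G v (c i)" for i
  have m: "3 \<le> m" using c unfolding cyc_def by blast
  have perN: "N (i + m) = N i" for i unfolding N_def using cyc_period[OF c(1), of i] by simp
  define t where "t = int l - 2"
  have t: "1 \<le> t" "t \<le> m - 1" using l unfolding t_def by simp_all
  have "\<exists>i. N i \<and> N (i + t)"
  proof (rule ccontr)
    assume no: "\<nexists>i. N i \<and> N (i + t)"
    have "cnt m (\<lambda>i. N i \<or> N (i + t)) = cnt m N + cnt m (\<lambda>i. N (i + t))"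
      by (rule cnt_add) (use no in blast)
    moreover have "cnt m (\<lambda>i. N (i + t)) = cnt m N" by (rule cnt_shift[where P = N]) (use m perN in auto)
    moreover have "cnt m (\<lambda>i. N i \<or> N (i + t)) \<le> cnt m (\<lambda>i. True)" by (rule cnt_mono) simp
    moreover have "int (cnt m (\<lambda>i. True)) = m" unfolding cnt_True using m by simp
    moreover have "m < 2 * int (cnt m N)" using deg unfolding N_def .
    ultimately show False by linarith
  qed
  then obtain i where i: "adj G v (c i)" "adj G v (c (i + t))" unfolding N_def by blast
  have "is_cycle G (v # seg c i (i + t))" by (rule cyc_insert[OF G c t i])
  moreover have "length (v # seg c i (i + t)) = l" unfolding t_def using l by simp
  ultimately show ?thesis unfolding on_cycle_def by (intro exI[of _ "v # seg c i (i + t)"]) simp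
qed

lemma cnt_union_inter: "cnt m (\<lambda>i. P i \<or> R i) + cnt m (\<lambda>i. P i \<and> R i) = cnt m P + cnt m R"
proof -
  have "{i \<in> {0..<m}. P i \<or> R i} = {i \<in> {0..<m}. P i} \<union> {i \<in> {0..<m}. R i}"
    "{i \<in> {0..<m}. P i \<and> R i} = {i \<in> {0..<m}. P i} \<inter> {i \<in> {0..<m}. R i}" by auto
  then show ?thesis unfolding cnt_def using card_Un_Int[OF finite_cnt finite_cnt, of m P m R] by simp
qed

text \<open>Membership in \<open>N\<close> alternates along \<open>i0 + 2, i0 + 4, \<dots>\<close>, and since \<open>m\<close> is odd these indices
  run through all residues modulo \<open>m\<close>.\<close>

lemma alternating_neighbours:
  fixes N :: "int \<Rightarrow> bool"
  assumes m: "odd m" "0 < m" and per: "\<And>i. N (i + m) = N i" and N0: "N i0" "N (i0 + 2)"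
    and all: "\<And>i. N i \<or> N (i + 2)"
    and uniq: "\<And>i. N i \<Longrightarrow> N (i + 2) \<Longrightarrow> i mod m = i0 mod m"
    and t: "1 \<le> t" "t \<le> m - 1"
  shows "N (i0 + t) \<or> N (i0 - t)"
proof -
  have alt: "N (i0 + 2 * int s) \<longleftrightarrow> odd s" if "1 \<le> s" "int s \<le> m" for s
    using that
  proof (induction s rule: nat_induct_at_least)
    case base
    then show ?case using N0 by simp
  next
    case (Suc s)
    have IH: "N (i0 + 2 * int s) \<longleftrightarrow> odd s" using Suc by simp
    have step: "i0 + 2 * int (Suc s) = i0 + 2 * int s + 2" by simp
    have "\<not> (N (i0 + 2 * int s) \<and> N (i0 + 2 * int s + 2))"
    proof
      assume "N (i0 + 2 * int s) \<and> N (i0 + 2 * int s + 2)"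
      then have "(i0 + 2 * int s) mod m = i0 mod m" using uniq by blast
      then have "m dvd 2 * int s" by (simp add: mod_eq_dvd_iff)
      moreover have "coprime m 2" using m(1) by (simp add: coprime_right_2_iff_odd)
      ultimately have "m dvd int s" by (simp add: coprime_dvd_mult_right_iff)
      then have "m \<le> int s" by (rule zdvd_imp_le) (use Suc in simp)
      then show False using Suc.prems by simp
    qed
    then show ?case using all[of "i0 + 2 * int s"] IH unfolding step by auto
  qed
  have sym: "N (i0 + 2 * s) \<or> N (i0 - 2 * s)" if s: "1 \<le> s" "s \<le> m - 1" for s
  proof -
    have "N (i0 + 2 * (m - s)) = N (i0 + m - 2 * s)" using per[of "i0 + m - 2 * s"] by (simp add: algebra_simps)
    also have "\<dots> = N (i0 - 2 * s)" using per[of "i0 - 2 * s"] by (simp add: algebra_simps)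
    finally have e: "N (i0 + 2 * (m - s)) = N (i0 - 2 * s)" .
    have "N (i0 + 2 * s) \<longleftrightarrow> odd (nat s)" using alt[of "nat s"] s by simp
    moreover have "N (i0 + 2 * (m - s)) \<longleftrightarrow> odd (nat (m - s))" using alt[of "nat (m - s)"] s by simp
    moreover have "odd (nat s) \<or> odd (nat (m - s))" using m s by (simp add: even_nat_iff)
    ultimately show ?thesis using e by blast
  qed
  show ?thesis
  proof (cases "even t")
    case True
    then obtain s where "t = 2 * s" by blast
    then show ?thesis using sym[of s] t by simp
  next
    case False
    then have "even (t + m)" using m by simp
    then obtain s where s: "t + m = 2 * s" by blast
    have "N (i0 + 2 * s) = N (i0 + t)" using per[of "i0 + t"] unfolding s[symmetric] by (simp add: add.assoc)
    moreover have "N (i0 - 2 * s) = N (i0 - t)" using per[of "i0 - 2 * s"] unfolding s[symmetric] by simp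
    ultimately show ?thesis using sym[of s] s t by simp
  qed
qed

lemma card_nbh_off_cycle:
  assumes G: "simple_graph G" and n: "card (verts G) = n" and u: "u \<in> verts G"
    and d: "cyc G (int n - 1) d" "u \<notin> range d"
  shows "card (nbh G u) = cnt (int n - 1) (\<lambda>i. adj G u (d i))"
proof -
  have fin: "finite (verts G)" by (rule simple_finite[OF G])
  have "range d = verts G - {u}"
  proof (rule card_subset_eq)
    show "range d \<subseteq> verts G - {u}" using cyc_rangeI[OF G d(1)] d(2) by blast
    show "card (range d) = card (verts G - {u})" using cyc_card_range[OF d(1)] u n fin by simp
  qed (use fin in simp)
  moreover have "x \<in> verts G - {u}" if "adj G u x" for x using adj_in(2,3)[OF G that] by blast
  ultimately have sub: "x \<in> range d" if "adj G u x" for x using that by simp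
  have "nbh G u = d ` {i. adj G u (d i)}"
  proof
    show "nbh G u \<subseteq> d ` {i. adj G u (d i)}"
    proof
      fix x assume "x \<in> nbh G u"
      then have a: "adj G u x" unfolding nbh_def by simp
      then obtain i where "x = d i" using sub[OF a] by (elim imageE)
      then show "x \<in> d ` {i. adj G u (d i)}" using a by simp
    qed
    show "d ` {i. adj G u (d i)} \<subseteq> nbh G u" unfolding nbh_def by (rule image_subsetI) simp
  qed
  then show ?thesis
    using cnt_image[OF d(1), of "\<lambda>i. adj G u (d i)"] by (simp only: cyc_period[OF d(1)])
qed

text \<open>Where \<open>v\<close> has neighbours at distance two it can replace the vertex between
  them, which is then omitted too. Two such places give three vertices. Otherwise the degree
  condition is tight and there is exactly one such place \<open>i0\<close>; then \<open>c i0\<close>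
  lies on cycles of all lengths through \<open>v\<close> by
  \<open>alternating_neighbours\<close>.\<close>

lemma three_skippable:
  assumes G: "simple_graph G" and n: "card (verts G) = n" "4 \<le> n"
    and c: "cyc G (int n - 1) c" and v: "v \<in> verts G" "v \<notin> range c"
    and ham: "\<And>u. u \<in> verts G \<Longrightarrow> on_cycle G u n"
    and high: "\<And>u xs. u \<in> verts G \<Longrightarrow> is_cycle G xs \<Longrightarrow> length xs = n - 1 \<Longrightarrow> u \<notin> set xs \<Longrightarrow> n \<le> 2 * card (nbh G u)"
  shows "good_triple G G"
proof -
  let ?m = "int n - 1"
  have len: "length xs \<le> n" if "is_cycle G xs" for xs using cycle_length_le[OF G that] n(1) by simp
  have skip: "on_cycle G u l" if u: "u \<in> verts G" and d: "cyc G ?m d" "u \<notin> range d" and l: "3 \<le> l" "l \<le> n" for u d l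
  proof (rule pancyclic_off_cycle[OF G d _ l(1)])
    have D: "is_cycle G (seg d 0 (?m - 1))" "set (seg d 0 (?m - 1)) = range d"
      "int (length (seg d 0 (?m - 1))) = ?m" by (rule cyc_imp_cycle[OF G d(1)])+
    have h: "n \<le> 2 * card (nbh G u)" by (rule high[OF u D(1)]) (use D d n in auto)
    then show "?m < 2 * int (cnt ?m (\<lambda>i. adj G u (d i)))"
      using card_nbh_off_cycle[OF G n(1) u d] by simp
  qed (use l in simp)
  have triple: "good_triple G G"
    if x: "x \<in> verts G" "y \<in> verts G" "x \<noteq> v" "y \<noteq> v" "x \<noteq> y"
      and xc: "\<And>l. 3 \<le> l \<Longrightarrow> l \<le> n \<Longrightarrow> on_cycle G x l" and yc: "\<And>l. 3 \<le> l \<Longrightarrow> l \<le> n \<Longrightarrow> on_cycle G y l" for x y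
  proof (rule good_tripleI[of n "{v, x, y}"])
    show "card {v, x, y} = 3" using x by simp
    show "on_cycle G u l" if u: "u \<in> {v, x, y}" and l: "3 \<le> l" "l \<le> n" for u l
      using u skip[OF v(1) c v(2) l] xc[OF l] yc[OF l] by (elim insertE emptyE) (simp_all only:)
  qed (use n v x len in auto)
  define N where "N i \<longleftrightarrow> adj G v (c i)" for i
  have perN: "N (i + ?m) = N i" for i unfolding N_def using cyc_period[OF c, of i] by simp
  have perN2: "N (i + t + ?m) = N (i + t)" for i t by (rule perN)
  have m: "3 \<le> ?m" using n by simp
  let ?P = "\<lambda>i. N i \<and> N (i + 2)"
  have skipP: "on_cycle G (c (i + 1)) l" if P: "?P i" and l: "3 \<le> l" "l \<le> n" for i l
  proof -
    have e: "i + 2 + (?m - 2) = i + ?m" by simp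
    have P': "adj G v (c (i + 2))" "adj G v (c (i + 2 + (?m - 2)))"
      using P unfolding e cyc_period[OF c] N_def by blast+
    have cy: "is_cycle G (v # seg c (i + 2) (i + 2 + (?m - 2)))"
      by (rule cyc_insert[OF G c v(2) _ _ P']) (use m in simp_all)
    obtain d where d: "cyc G (int (length (v # seg c (i + 2) (i + 2 + (?m - 2))))) d"
      "range d = set (v # seg c (i + 2) (i + 2 + (?m - 2)))"
      using is_cycle_imp_cyc[OF cy] by blast
    have lm: "int (length (v # seg c (i + 2) (i + 2 + (?m - 2)))) = ?m" using m by simp
    have d1: "cyc G ?m d" using d(1) unfolding lm .
    have "c (i + 1) \<notin> c ` {i + 2..i + ?m}"
    proof
      assume "c (i + 1) \<in> c ` {i + 2..i + ?m}"
      then obtain k where k: "c (i + 1) = c k" "k \<in> {i + 2..i + ?m}" by (rule imageE)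
      have "c (i + 1) \<noteq> c k" by (rule cyc_neq[OF c]) (use k(2) in auto)
      then show False using k(1) by contradiction
    qed
    moreover have "c (i + 1) \<noteq> v" using v(2) by blast
    ultimately have "c (i + 1) \<notin> range d" unfolding d(2) e by simp
    then show ?thesis by (rule skip[OF cyc_rangeI[OF G c] d1 _ l])
  qed
  let ?S = "{i \<in> {0..<?m}. ?P i}"
  show ?thesis
  proof (cases "\<exists>i\<in>?S. \<exists>k\<in>?S. i \<noteq> k")
    case True
    then obtain i k where ik: "i \<in> ?S" "k \<in> ?S" "i \<noteq> k" by (elim bexE)
    have "c (i + 1) \<noteq> c (k + 1)"
    proof
      assume "c (i + 1) = c (k + 1)"
      then have "c (i + 1 + - 1) = c (k + 1 + - 1)" by (rule cyc_cong[OF c])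
      then have "c i = c k" by simp
      then show False using inj_onD[OF cyc_inj_window[OF c, of 0], of i k] ik by simp
    qed
    then show ?thesis using v(2) skipP[of i] skipP[of k] ik
      by (intro triple[of "c (i + 1)" "c (k + 1)"] cyc_rangeI[OF G c]) auto
  next
    case False
    have d1: "card ?S \<le> Suc 0"
      by (intro card_le_Suc0_iff_eq[THEN iffD2, OF finite_cnt] ballI) (use False in blast)
    let ?k = "cnt ?m N"
    have "cnt ?m (\<lambda>i. N (i + 2)) = ?k" by (rule cnt_shift[where P = N]) (use m perN in auto)
    then have ui: "cnt ?m (\<lambda>i. N i \<or> N (i + 2)) + card ?S = 2 * ?k"
      using cnt_union_inter[of ?m N "\<lambda>i. N (i + 2)"] unfolding cnt_def by simp
    have "int n \<le> 2 * int ?k"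
    proof -
      have D: "is_cycle G (seg c 0 (?m - 1))" "set (seg c 0 (?m - 1)) = range c"
        "int (length (seg c 0 (?m - 1))) = ?m" by (rule cyc_imp_cycle[OF G c])+
      have h: "n \<le> 2 * card (nbh G v)" by (rule high[OF v(1) D(1)]) (use D v n in auto)
      then show ?thesis using card_nbh_off_cycle[OF G n(1) v(1) c v(2)] unfolding N_def by simp
    qed
    moreover have le: "cnt ?m (\<lambda>i. N i \<or> N (i + 2)) \<le> cnt ?m (\<lambda>i. True)" by (rule cnt_mono) simp
    \<comment> \<open>The union has 2 |N| - |S| elements, where 2 |N| is at least
      \<open>?m + 1\<close> and |S| at most 1. So equality holds throughout, and the last equation
      makes \<open>?m\<close> odd.\<close>
    ultimately have full: "cnt ?m (\<lambda>i. N i \<or> N (i + 2)) = nat ?m" and one: "card ?S = 1" and mk: "?m + 1 = 2 * int ?k"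
      using ui d1 m unfolding cnt_True by linarith+
    have "odd ?m" using mk by presburger
    have all: "N i \<or> N (i + 2)" for i
    proof -
      have w: "{i \<in> {0..<?m}. N i \<or> N (i + 2)} = {0..<?m}"
        by (rule card_subset_eq) (use full in \<open>auto simp: cnt_def\<close>)
      have e: "i + ?m + 2 = i + 2 + ?m" for i by simp
      have "i mod ?m \<in> {0..<?m}" using m by simp
      then have "i mod ?m \<in> {i \<in> {0..<?m}. N i \<or> N (i + 2)}" unfolding w .
      then have "N (i mod ?m) \<or> N (i mod ?m + 2)" by simp
      moreover have "(N (i mod ?m) \<or> N (i mod ?m + 2)) = (N i \<or> N (i + 2))"
        by (rule periodic_mod[where P = "\<lambda>i. N i \<or> N (i + 2)"]) (simp only: e perN)
      ultimately show ?thesis by blast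
    qed
    obtain i0 where S: "?S = {i0}" using one by (rule card_1_singletonE)
    have "i0 \<in> ?S" unfolding S by simp
    then have i0: "N i0" "N (i0 + 2)" by simp_all
    have uniq: "i mod ?m = i0 mod ?m" if "N i" "N (i + 2)" for i
    proof -
      obtain i' where i': "0 \<le> i'" "i' < 0 + ?m" "c i' = c i" by (rule cyc_window_obtain[OF c])
      have "c (i' + 2) = c (i + 2)" by (rule cyc_cong[OF c i'(3)])
      then have "i' \<in> ?S" using that i' unfolding N_def by simp
      then have "i' = i0" using S by blast
      then show ?thesis using i'(3) cyc_eq[OF c] by simp
    qed
    have c0: "on_cycle G (c i0) l" if l: "3 \<le> l" "l \<le> n" for l
    proof -
      define t where "t = int l - 2"
      have t: "1 \<le> t" "t \<le> ?m - 1" using l unfolding t_def by simp_all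
      have "N (i0 + t) \<or> N (i0 - t)"
        by (rule alternating_neighbours[OF \<open>odd ?m\<close> _ perN i0(1,2) all uniq t]) (use m in simp_all)
      then show ?thesis
      proof
        assume a: "N (i0 + t)"
        have cy: "is_cycle G (v # seg c i0 (i0 + t))"
          by (rule cyc_insert[OF G c v(2) t]) (use i0(1) a in \<open>simp_all add: N_def\<close>)
        have "length (v # seg c i0 (i0 + t)) = l" using l unfolding t_def by simp
        then show ?thesis unfolding on_cycle_def using cy t
          by (intro exI[of _ "v # seg c i0 (i0 + t)"]) simp
      next
        assume a: "N (i0 - t)"
        have cy: "is_cycle G (v # seg c (i0 - t) (i0 - t + t))"
          by (rule cyc_insert[OF G c v(2) t]) (use i0(1) a in \<open>simp_all add: N_def\<close>)
        have "length (v # seg c (i0 - t) (i0 - t + t)) = l" using l unfolding t_def by simp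
        then show ?thesis unfolding on_cycle_def using cy t
          by (intro exI[of _ "v # seg c (i0 - t) (i0 - t + t)"]) simp
      qed
    qed
    have "c i0 \<noteq> c (i0 + 1)" by (rule cyc_neq[OF c]) (use m in auto)
    then show ?thesis using v(2) skipP[of i0] i0 c0
      by (intro triple[of "c i0" "c (i0 + 1)"] cyc_rangeI[OF G c]) auto
  qed
qed

section \<open>The induction on the order\<close>

lemma on_cycle_spanning:
  assumes "simple_graph G" "is_cycle G xs" "length xs = card (verts G)" "u \<in> verts G"
  shows "on_cycle G u (card (verts G))"
proof -
  have xs: "distinct xs" "set xs \<subseteq> verts G" using assms(2) unfolding is_cycle_def by blast+
  have "set xs = verts G"
    by (rule card_subset_eq[OF simple_finite[OF assms(1)] xs(2)]) (use distinct_card[OF xs(1)] assms(3) in simp)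
  then show ?thesis unfolding on_cycle_def using assms(2-4) by blast
qed

text \<open>At order 3 the size bound demands all three edges, so the graph is a triangle.\<close>

lemma good_triple_base:
  assumes G: "simple_graph G" and n: "card (verts G) = 3" and e: "3 \<le> card (edges G)"
  shows "good_triple G G"
proof (rule good_tripleI[OF order.refl n order.refl])
  show "length xs \<le> 3" if "is_cycle G xs" for xs using cycle_length_le[OF G that] n by simp
  obtain x y z where v: "verts G = {x, y, z}" "x \<noteq> y" "x \<noteq> z" "y \<noteq> z"
    using n unfolding card_3_iff by blast
  have "edges G \<subseteq> {{x, y}, {y, z}, {z, x}}"
  proof
    fix f assume "f \<in> edges G"
    then obtain p q where pq: "f = {p, q}" "p \<noteq> q" "p \<in> verts G" "q \<in> verts G"
      by (rule edge_obtain[OF G])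
    then show "f \<in> {{x, y}, {y, z}, {z, x}}" unfolding v(1) by auto
  qed
  moreover have "card {{x, y}, {y, z}, {z, x}} \<le> 3" by (simp add: card_insert_if)
  ultimately have "edges G = {{x, y}, {y, z}, {z, x}}" using e by (intro card_seteq) simp_all
  then have "adj G x y" "adj G y z" "adj G z x" unfolding adj_def by simp_all
  then have "is_cycle G [x, y, z]" by (intro is_cycle_successively[OF G]) (use v(2-4) in simp_all)
  then have c: "on_cycle G u 3" if "u \<in> verts G" for u
    using that unfolding on_cycle_def v(1) by (intro exI[of _ "[x, y, z]"] conjI) simp_all
  show "on_cycle G u l" if "u \<in> verts G" "3 \<le> l" "l \<le> 3" for u l
    using c[OF that(1)] antisym[OF that(2,3)] by (simp only:)
qed

theorem three_good_vertices:
  fixes G :: "'a graph"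
  assumes "simple_graph G" "\<not> bipartite G" "card (verts G) = n" "3 \<le> n"
    and "(n - 1)\<^sup>2 div 4 + 2 \<le> card (edges G)" "5 \<le> n \<Longrightarrow> \<not> BT_form G n"
  shows "good_triple G G"
  using assms
proof (induction n arbitrary: G rule: less_induct)
  case (less n)
  note G = less.prems(1) and nb = less.prems(2) and n = less.prems(3) and size = less.prems(5) and noBT = less.prems(6)
  show ?case
  proof (cases "n = 3")
    case True
    then have "3 \<le> card (edges G)" using size by simp
    then show ?thesis using good_triple_base[OF G] n True by simp
  next
    case False
    then have n4: "4 \<le> n" using less.prems(4) by simp
    have red: "good_triple G (del G {u})" if u: "u \<in> verts G" "2 * card (nbh G u) \<le> n - 1" for u
      by (rule reduce_low_vertex[OF G nb u(1) n n4 size u(2) noBT])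
        (assumption, rule less.IH[of "n - 1"], use n4 in simp_all)
    show ?thesis
    proof (cases "\<exists>xs. is_cycle G xs \<and> length xs = n")
      case False
      obtain u where u: "u \<in> verts G" "2 * card (nbh G u) \<le> n - 1"
        "\<And>xs. is_cycle G xs \<Longrightarrow> \<exists>ys. is_cycle (del G {u}) ys \<and> length xs \<le> length ys"
        using low_vertex_nonhamiltonian[OF G n less.prems(4) False] by blast
      obtain L S where L: "3 \<le> L" "card S = 3" "S \<subseteq> verts G"
        "\<forall>xs. is_cycle (del G {u}) xs \<longrightarrow> length xs \<le> L"
        "\<forall>v\<in>S. \<forall>l. 3 \<le> l \<longrightarrow> l \<le> L \<longrightarrow> on_cycle G v l"
        using red[OF u(1,2)] unfolding good_triple_def by (elim exE conjE)
      have "length xs \<le> L" if "is_cycle G xs" for xs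
        using u(3)[OF that] L(4) le_trans by blast
      then show ?thesis using L(5) by (intro good_tripleI[OF L(1-3)]) blast+
    next
      case True
      then obtain xs0 where xs0: "is_cycle G xs0" "length xs0 = n" by blast
      have ham: "on_cycle G u n" if "u \<in> verts G" for u
        using on_cycle_spanning[OF G xs0(1) _ that] xs0(2) n by simp
      show ?thesis
      proof (cases "\<exists>u xs. u \<in> verts G \<and> is_cycle G xs \<and> length xs = n - 1 \<and> u \<notin> set xs \<and> 2 * card (nbh G u) \<le> n - 1")
        case True
        then obtain u xs where u: "u \<in> verts G" "2 * card (nbh G u) \<le> n - 1"
          and xs: "is_cycle G xs" "length xs = n - 1" "u \<notin> set xs" by blast
        obtain L S where L: "3 \<le> L" "card S = 3" "S \<subseteq> verts G"
          "\<forall>xs. is_cycle (del G {u}) xs \<longrightarrow> length xs \<le> L"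
          "\<forall>v\<in>S. \<forall>l. 3 \<le> l \<longrightarrow> l \<le> L \<longrightarrow> on_cycle G v l"
          using red[OF u] unfolding good_triple_def by (elim exE conjE)
        \<comment> \<open>The cycle of length \<open>n - 1\<close> survives the deletion, which
          forces \<open>n - 1 \<le> L\<close>. The three vertices thus miss at most length
          \<open>n\<close>, and the Hamiltonian cycle supplies it.\<close>
        have "is_cycle (del G {u}) xs" unfolding is_cycle_del_iff using xs by simp
        then have "length xs \<le> L" using L(4) by blast
        then have nL: "n - 1 \<le> L" unfolding xs(2) .
        show ?thesis
        proof (rule good_tripleI[of n S])
          show "length ys \<le> n" if "is_cycle G ys" for ys using cycle_length_le[OF G that] n by simp
          show "on_cycle G v l" if vl: "v \<in> S" "3 \<le> l" "l \<le> n" for v l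
          proof (cases "l = n")
            case True
            then show ?thesis using ham L(3) vl(1) by blast
          next
            case False
            then have "l \<le> L" using vl(3) nL by linarith
            then show ?thesis using L(5) vl by blast
          qed
        qed (use L n4 in simp_all)
      next
        case False
        obtain xs where xs: "is_cycle G xs" "length xs = n - 1"
          using hamiltonian_predecessor[OF G nb n n4 size xs0] by blast
        have dxs: "distinct xs" "set xs \<subseteq> verts G" using xs(1) unfolding is_cycle_def by blast+
        have "card (set xs) < card (verts G)" using distinct_card[OF dxs(1)] xs(2) n n4 by simp
        then obtain v where v: "v \<in> verts G" "v \<notin> set xs"
          using exists_outside[OF simple_finite[OF G]] by blast
        obtain c where c: "cyc G (int (length xs)) c" "range c = set xs"
          using is_cycle_imp_cyc[OF xs(1)] by blast
        have "int (length xs) = int n - 1" using xs(2) n4 by simp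
        then have c': "cyc G (int n - 1) c" using c(1) by simp
        show ?thesis
        proof (rule three_skippable[OF G n n4 c' v(1)])
          show "v \<notin> range c" using v(2) c(2) by simp
          show "n \<le> 2 * card (nbh G u)" if "u \<in> verts G" "is_cycle G ys" "length ys = n - 1" "u \<notin> set ys" for u ys
          proof (rule ccontr)
            assume "\<not> n \<le> 2 * card (nbh G u)"
            then have "2 * card (nbh G u) \<le> n - 1" by linarith
            then show False using False that by blast
          qed
        qed (rule ham)
      qed
    qed
  qed
qed

theorem theorem3:
  fixes G :: "'a graph" and n :: nat
  assumes "simple_graph G"
    and "\<not> bipartite G"
    and "graph_order G = n"
    and "n \<ge> 5"
    and "graph_size G \<ge> (n - 1)^2 div 4 + 2"
    and "\<not> graph_iso G (BT n)"
  shows "card {v. weakly_pancyclic_vertex G v} \<ge> 3"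
proof -
  note G = assms(1)
  have n: "card (verts G) = n" using assms(3) unfolding graph_order_def .
  have "good_triple G G"
  proof (rule three_good_vertices[OF G assms(2) n])
    show "(n - 1)\<^sup>2 div 4 + 2 \<le> card (edges G)" using assms(5) unfolding graph_size_def .
    show "\<not> BT_form G n" using BT_form_iso[OF G assms(4)] assms(6) by blast
  qed (use assms(4) in simp)
  then obtain L S where L: "3 \<le> L" "card S = 3" "S \<subseteq> verts G"
    "\<forall>xs. is_cycle G xs \<longrightarrow> length xs \<le> L" "\<forall>v\<in>S. \<forall>l. 3 \<le> l \<longrightarrow> l \<le> L \<longrightarrow> on_cycle G v l"
    unfolding good_triple_def by (elim exE conjE)
  let ?C = "{length xs |xs. is_cycle G xs}"
  have "?C \<subseteq> {..L}" using L(4) by blast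
  then have finC: "finite ?C" by (rule finite_subset) simp
  have "S \<noteq> {}" using L(2) by auto
  then obtain s where "s \<in> S" by blast
  \<comment> \<open>A triangle makes the bounded set of cycle lengths nonempty, so
    \<open>Min\<close> and \<open>Max\<close> are attained. All cycle lengths lie between 3 and
    \<open>L\<close>, hence so does every length from girth to circumference.\<close>
  then have "on_cycle G s 3" using L(1,5) by blast
  then have neC: "?C \<noteq> {}" unfolding on_cycle_def by blast
  have "girth G \<in> ?C" unfolding girth_def by (rule Min_in[OF finC neC])
  then have g: "3 \<le> girth G" unfolding is_cycle_def by auto
  have "circumference G \<in> ?C" unfolding circumference_def by (rule Max_in[OF finC neC])
  then have c: "circumference G \<le> L" using L(4) by auto
  have "S \<subseteq> {v. weakly_pancyclic_vertex G v}"
  proof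
    fix v assume v: "v \<in> S"
    have "\<exists>xs. is_cycle G xs \<and> length xs = l \<and> v \<in> set xs" if "girth G \<le> l \<and> l \<le> circumference G" for l
    proof -
      have "on_cycle G v l" using L(5) v g c that by simp
      then show ?thesis unfolding on_cycle_def .
    qed
    then show "v \<in> {v. weakly_pancyclic_vertex G v}" unfolding weakly_pancyclic_vertex_def using v L(3) by blast
  qed
  moreover have "{v. weakly_pancyclic_vertex G v} \<subseteq> verts G" unfolding weakly_pancyclic_vertex_def by blast
  then have "finite {v. weakly_pancyclic_vertex G v}" by (rule finite_subset) (rule simple_finite[OF G])
  ultimately show ?thesis using card_mono[of "{v. weakly_pancyclic_vertex G v}" S] L(2) by simp
qed

end
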